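(* Assume that the initial queue-lengths of the learning system and of the genie-aided system are the same, and that $0$ is in the set of optimal thresholds $\mathcal{K}^{\mathrm{opt}}$ of the genie-aided system. Then, for any specified $\epsilon>0$, the learning algorithm (run with this $\epsilon$) achieves $O(\ln^{1+\epsilon}(N))$ regret as $N\to\infty$, where $N$ is the total number of arriving customers; that is, $\tilde G(N)=O(\ln^{1+\epsilon}(N))$ as $N\to\infty$ (with $R,C,\lambda,\mu$, the initial queue-length and the algorithm parameters fixed).
   Context: **Model.** Fix $R>0$ (reward), $C>0$ (holding cost rate), $\lambda\in(0,\infty)$ (arrival rate), $\mu\in(0,\infty)$ (service rate). Customers arrive to a single-server FIFO queue with infinite buffer according to a Poisson process $(N_A(t))_{t\ge0}$ of rate $\lambda$ with arrival times $T^A_1<T^A_2<\dots$; service times are i.i.d. exponential with rate $\mu$. On each arrival the dispatcher admits or rejects the customer (rejected customers leave forever). Each admitted customer brings reward $R$; a cost $C$ per unit time is paid for each customer in the queue (including the one in service). $Q(t)$ is the queue-length at time $t$, $Q_i$ the queue-length right before the $i$-th arrival. A threshold policy $\{K_i\}$ ($K_i\in\mathbb N=\{0,1,\dots\}$, depending only on the past up to the $i$-th arrival) admits the $i$-th arriving customer iff $Q_i<K_i$. **Optimal thresholds.** For $K\in\mathbb N$, $y,z>0$ let $$V(K,y,z)=\frac{K(y-z)-z(1-(z/y)^K)}{(y-z)^2}\ (y\ne z),\qquad V(K,y,y)=\frac{K(K+1)}{2y}.$$ $\bar K\in\mathbb N$ is the unique integer with $V(\bar K,\mu,\lambda)\le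 R/C<V(\bar K+1,\mu,\lambda)$. The set of optimal thresholds (for long-term average profit with known $\lambda,\mu$) is $\mathcal K^{\mathrm{opt}}=\{\bar K\}$ if $V(\bar K,\mu,\lambda)<R/C$ and $\mathcal K^{\mathrm{opt}}=\{\bar K-1,\bar K\}$ if $V(\bar K,\mu,\lambda)=R/C$ (then $\bar K\ge1$). **Learning algorithm** (knows $R,C$, not $\lambda,\mu$; observes the queue-length and all arrivals). Parameters: integers $l_1>1$, $l_2\ge l_1$; $\epsilon>0$; deterministic $\alpha_j\ge 1$ growing to infinity at a polynomial rate in $j$ (there are $a,c,c'>0$ with $c j^a\le\alpha_j\le c' j^a$). Its initial queue-length $Q_0$ is deterministic. Let $K^*(j)=\max\{\lfloor\ln j\rfloor,0\}+l_1+Q_0$. Let $B^1,B^2,\dots$ be Bernoulli variables, independent of each other and of everything else, with $\mathbb P[B^1=1]=1$ and $\mathbb P[B^j=1]=\min\{1,\ln^{\epsilon}(j)/j\}$ for $j>1$. The algorithm works in batches $j=1,2,\dots$, each with an optional phase 1 followed by a phase 2. - Phase 1 (exploration) of batch $j$ takes place iff $j=1$, or $K(j-1)=0$ and $B^j=1$; it consists of the next $l_1$ arrivals, all of which are admitted. - At the beginning of phase 2 (exploitation) of batch $j$, let $\hat m(j)$ be the empirical mean of the service times of all customers who have completed service so far and $\hat\nu(j)$ the empirical mean of all inter-arrival times observed so far. Let $K$ be the integer with $V(K,1/\hat m(j),1/\hat\nu(j))\le R/C<V(K+1,1/\hat m(j),1/\hat\nu(j))$, and set $K(j)=\min\{K^*(j),K\}$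 (if no service has been completed yet, $\hat m(j)$ is an arbitrary fixed value and $K(j)$ an arbitrary value in $\{0,\dots,K^*(j)\}$). Throughout phase 2 of batch $j$ the static threshold $K(j)$ is used. Phase 2 lasts for at least $\lceil\alpha_jl_2\rceil$ arrivals and then ends just before the first subsequent arrival that finds the queue empty (that arrival is the first one of batch $j+1$); so the queue is empty when phase 2 ends. For arrivals $i$ in phase 2 of batch $j$, $K_i=K(j)$. **Coupling.** The learning and the genie-aided system share the same arrival process $N_A$ and the same independent Poisson process $P$ of rate $\mu$ of potential departures: at each jump of $P$, in each system with non-empty queue the head-of-line customer completes service. Bars denote genie-aided quantities ($\bar Q(t),\bar N_{\mathrm{join}}(t)$, etc.). **Genie-aided system** (knows $\lambda,\mu$). If $V(\bar K,\mu,\lambda)<R/C$ it uses the static threshold $\bar K$. If $V(\bar K,\mu,\lambda)=R/C$ it is the following alternating dispatcher. Its busy cycles (a busy period plus the following idle period) begin at times $\tau^B_1=0<\tau^B_2<\dots$, where for $n\ge2$, $\tau^B_n$ is the first arrival time after $\tau^B_{n-1}$ at which the genie-aided system is empty just before the arrival. During the $n$-th busy cycle it uses the constant threshold $\tilde K^n$: $\tilde K^1=\bar K-1$; for $n>1$, with $i$ the index of the customer arriving at $\tau_n^B$, $\tilde K^n=\bar K$ if customer $i$ arrives during a phase 2 of the learning system and $K_i\ge\bar K$, and $\tilde K^n=\bar K-1$ otherwise. **Regret.** With $N_{\mathrm{join}}(t)$, $\bar N_{\mathrm{join}}(t)$ the numbers of customers that joined the queue up to time $t$ in the two systems, $$G(t)=\mathbb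 E\Big[R\bar N_{\mathrm{join}}(t)-C\int_0^t\bar Q(u)\,du-\Big(RN_{\mathrm{join}}(t)-C\int_0^tQ(u)\,du\Big)\Big],$$ and $\tilde G(N)=G(T^A_N)$ is the regret accumulated up to the arrival of the $N$-th customer. *)

theory Defs
  imports "HOL-Probability.Probability" "HOL-Library.Landau_Symbols"
begin

definition V :: "nat \<Rightarrow> real \<Rightarrow> real \<Rightarrow> real" where
  "V K y z =
     (if y = z then real K * (real K + 1) / (2 * y)
      else (real K * (y - z) - z * (1 - (z / y) ^ K)) / (y - z)\<^sup>2)"

text \<open>For positive \<open>y\<close>, \<open>z\<close> the map \<open>K \<mapsto> V K y z\<close> increases strictly from \<open>0\<close> to infinity, so
  the description is proper whenever \<open>R > 0\<close> and \<open>C > 0\<close>. Estimated rates can fail to be positive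
  only on a null set, where the value is fixed to \<open>0\<close>.\<close>

definition crit_threshold :: "real \<Rightarrow> real \<Rightarrow> real \<Rightarrow> real \<Rightarrow> nat" where
  "crit_threshold R C y z =
     (if 0 < y \<and> 0 < z then (THE K. V K y z \<le> R / C \<and> R / C < V (Suc K) y z) else 0)"

definition opt_thresholds :: "real \<Rightarrow> real \<Rightarrow> real \<Rightarrow> real \<Rightarrow> nat set" where
  "opt_thresholds R C lam mu =
     (let K = crit_threshold R C mu lam
      in if V K mu lam < R / C then {K} else {K - 1, K})"

text \<open>A point process on the positive half-line is given by its sequence of gaps: the \<open>n\<close>-th point
  (\<open>n \<ge> 1\<close>) is the sum of the first \<open>n\<close> gaps, and \<open>epoch x 0 = 0\<close> is the time origin. Below,
  \<open>x\<close> stands for the gaps of the arrival process and \<open>y\<close> for those of the process of potential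
  departures.\<close>

definition epoch :: "(nat \<Rightarrow> real) \<Rightarrow> nat \<Rightarrow> real" where
  "epoch x n = (\<Sum>k<n. x k)"

definition num_epochs :: "(nat \<Rightarrow> real) \<Rightarrow> real \<Rightarrow> nat" where
  "num_epochs x t = card {n. 1 \<le> n \<and> epoch x n \<le> t}"

text \<open>\<open>service_start\<close> is the time at which the service of the head-of-line customer began; it is
  meaningless while the queue is empty. The head of the initial queue starts service at time \<open>0\<close>.\<close>

record server =
  queue :: nat
  completed :: nat
  total_service :: real \<comment> \<open>sum of the service times of the completed customers\<close>
  service_start :: real

definition init_server :: "nat \<Rightarrow> server" where
  "init_server q = \<lparr>queue = q, completed = 0, total_service = 0, service_start = 0\<rparr>"

definition potential_departure :: "real \<Rightarrow> server \<Rightarrow> server" where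
  "potential_departure s st =
     (if queue st = 0 then st
      else st\<lparr>queue := queue st - 1,
              completed := completed st + 1,
              total_service := total_service st + (s - service_start st),
              service_start := s\<rparr>)"

definition join_queue :: "real \<Rightarrow> server \<Rightarrow> server" where
  "join_queue s st =
     st\<lparr>queue := queue st + 1,
        service_start := (if queue st = 0 then s else service_start st)\<rparr>"

text \<open>The effect of the potential departures in the interval \<open>(s, t]\<close>.\<close>

definition serve :: "(nat \<Rightarrow> real) \<Rightarrow> real \<Rightarrow> real \<Rightarrow> server \<Rightarrow> server" where
  "serve y s t st =
     fold (\<lambda>k. potential_departure (epoch y k)) [Suc (num_epochs y s)..<Suc (num_epochs y t)] st"

text \<open>\<open>fallback j\<close> is the arbitrary choice of the threshold of batch \<open>j\<close> when no service has been
  completed. It may depend on the past, which then amounts to the inter-arrival times observed so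
  far (padded with zeros).\<close>

record params =
  reward :: real
  hold_cost :: real
  arrival_rate :: real
  service_rate :: real
  init_queue :: nat
  genie_init_queue :: nat
  explore_len :: nat              \<comment> \<open>\<open>l\<^sub>1\<close>\<close>
  exploit_len :: nat              \<comment> \<open>\<open>l\<^sub>2\<close>\<close>
  growth :: "nat \<Rightarrow> real"         \<comment> \<open>\<open>\<alpha>\<close>\<close>
  fallback :: "nat \<Rightarrow> (nat \<Rightarrow> real) \<Rightarrow> nat"

definition max_threshold :: "params \<Rightarrow> nat \<Rightarrow> nat" where
  "max_threshold p j = nat (max \<lfloor>ln (real j)\<rfloor> 0) + explore_len p + init_queue p"

text \<open>The threshold \<open>K(j)\<close> of batch \<open>j\<close>, computed when \<open>i\<close> customers have arrived (so that \<open>i\<close>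
  inter-arrival times have been observed, the first one being the time of the first arrival).\<close>

definition learned_threshold :: "params \<Rightarrow> (nat \<Rightarrow> real) \<Rightarrow> nat \<Rightarrow> nat \<Rightarrow> server \<Rightarrow> nat" where
  "learned_threshold p x j i st =
     (if completed st = 0 then fallback p j (\<lambda>k. if k < i then x k else 0)
      else
        let m = total_service st / real (completed st);
            v = (\<Sum>k<i. x k) / real i
        in min (max_threshold p j) (crit_threshold (reward p) (hold_cost p) (1 / m) (1 / v)))"

record learner =
  server_of :: server
  batch :: nat
  exploiting :: bool              \<comment> \<open>phase 2 rather than phase 1\<close>
  phase_arrivals :: nat           \<comment> \<open>arrivals already handled in the current phase\<close>
  threshold :: nat                \<comment> \<open>\<open>K(j)\<close> if \<open>exploiting\<close>, otherwise not used\<close>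

definition init_learner :: "params \<Rightarrow> learner" where
  "init_learner p =
     \<lparr>server_of = init_server (init_queue p), batch = 1, exploiting = False,
      phase_arrivals = 0, threshold = 0\<rparr>"

text \<open>From the state right after arrival \<open>i - 1\<close> (right after time \<open>0\<close> if \<open>i = 1\<close>) to the state
  that arrival \<open>i\<close> finds. If phase 2 ends just before arrival \<open>i\<close>, the next batch has been entered,
  and when this batch has no phase 1 its threshold has been set. The outcome of the Bernoulli
  variable of batch \<open>j\<close> is \<open>b j\<close>.\<close>

definition before_arrival ::
  "params \<Rightarrow> (nat \<Rightarrow> real) \<Rightarrow> (nat \<Rightarrow> real) \<Rightarrow> (nat \<Rightarrow> bool) \<Rightarrow> nat \<Rightarrow> learner \<Rightarrow> learner" where
  "before_arrival p x y b i s =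
     (let st = serve y (epoch x (i - 1)) (epoch x i) (server_of s);
          j = batch s + 1
      in if exploiting s \<and> nat \<lceil>growth p (batch s) * real (exploit_len p)\<rceil> \<le> phase_arrivals s
              \<and> queue st = 0
         then
           (if threshold s = 0 \<and> b j
            then \<lparr>server_of = st, batch = j, exploiting = False, phase_arrivals = 0, threshold = 0\<rparr>
            else \<lparr>server_of = st, batch = j, exploiting = True, phase_arrivals = 0,
                  threshold = learned_threshold p x j i st\<rparr>)
         else s\<lparr>server_of := st\<rparr>)"

definition admits :: "learner \<Rightarrow> bool" where
  "admits s \<longleftrightarrow> (exploiting s \<longrightarrow> queue (server_of s) < threshold s)"

text \<open>Handling of arrival \<open>i\<close>. Phase 2 begins right after the last arrival of phase 1.\<close>

definition handle_arrival :: "params \<Rightarrow> (nat \<Rightarrow> real) \<Rightarrow> nat \<Rightarrow> learner \<Rightarrow> learner" where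
  "handle_arrival p x i s =
     (let st = (if admits s then join_queue (epoch x i) (server_of s) else server_of s);
          n = phase_arrivals s + 1
      in if \<not> exploiting s \<and> explore_len p \<le> n
         then s\<lparr>server_of := st, exploiting := True, phase_arrivals := 0,
                threshold := learned_threshold p x (batch s) i st\<rparr>
         else s\<lparr>server_of := st, phase_arrivals := n\<rparr>)"

text \<open>\<open>learner_run \<dots> i\<close> is the state right after arrival \<open>i\<close>, \<open>learner_seen \<dots> i\<close> the state found
  by arrival \<open>i \<ge> 1\<close>.\<close>

primrec learner_run ::
  "params \<Rightarrow> (nat \<Rightarrow> real) \<Rightarrow> (nat \<Rightarrow> real) \<Rightarrow> (nat \<Rightarrow> bool) \<Rightarrow> nat \<Rightarrow> learner" where
  "learner_run p x y b 0 = init_learner p"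
| "learner_run p x y b (Suc i) =
     handle_arrival p x (Suc i) (before_arrival p x y b (Suc i) (learner_run p x y b i))"

definition learner_seen ::
  "params \<Rightarrow> (nat \<Rightarrow> real) \<Rightarrow> (nat \<Rightarrow> real) \<Rightarrow> (nat \<Rightarrow> bool) \<Rightarrow> nat \<Rightarrow> learner" where
  "learner_seen p x y b i = before_arrival p x y b i (learner_run p x y b (i - 1))"

definition genie_opt :: "params \<Rightarrow> nat" where
  "genie_opt p = crit_threshold (reward p) (hold_cost p) (service_rate p) (arrival_rate p)"

definition genie_static :: "params \<Rightarrow> bool" where
  "genie_static p \<longleftrightarrow>
     V (genie_opt p) (service_rate p) (arrival_rate p) < reward p / hold_cost p"

text \<open>A state is a server together with the threshold in use. In the alternating case a new busy
  cycle begins at each arrival that finds the system empty, and the threshold is kept until then;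
  the initial threshold belongs to the cycle that begins at time \<open>0\<close>.\<close>

definition init_genie :: "params \<Rightarrow> server \<times> nat" where
  "init_genie p =
     (init_server (genie_init_queue p), if genie_static p then genie_opt p else genie_opt p - 1)"

definition genie_before_arrival ::
  "params \<Rightarrow> (nat \<Rightarrow> real) \<Rightarrow> (nat \<Rightarrow> real) \<Rightarrow> (nat \<Rightarrow> bool) \<Rightarrow> nat \<Rightarrow> server \<times> nat \<Rightarrow> server \<times> nat"
where
  "genie_before_arrival p x y b i g =
     (let st = serve y (epoch x (i - 1)) (epoch x i) (fst g);
          s = learner_seen p x y b i
      in (st,
          if genie_static p \<or> queue st \<noteq> 0 then snd g
          else if exploiting s \<and> genie_opt p \<le> threshold s then genie_opt p
          else genie_opt p - 1))"

definition genie_admits :: "server \<times> nat \<Rightarrow> bool" where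
  "genie_admits g \<longleftrightarrow> queue (fst g) < snd g"

primrec genie_run ::
  "params \<Rightarrow> (nat \<Rightarrow> real) \<Rightarrow> (nat \<Rightarrow> real) \<Rightarrow> (nat \<Rightarrow> bool) \<Rightarrow> nat \<Rightarrow> server \<times> nat" where
  "genie_run p x y b 0 = init_genie p"
| "genie_run p x y b (Suc i) =
     (let g = genie_before_arrival p x y b (Suc i) (genie_run p x y b i)
      in (if genie_admits g then join_queue (epoch x (Suc i)) (fst g) else fst g, snd g))"

definition genie_seen ::
  "params \<Rightarrow> (nat \<Rightarrow> real) \<Rightarrow> (nat \<Rightarrow> real) \<Rightarrow> (nat \<Rightarrow> bool) \<Rightarrow> nat \<Rightarrow> server \<times> nat" where
  "genie_seen p x y b i = genie_before_arrival p x y b i (genie_run p x y b (i - 1))"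

text \<open>Here \<open>run i\<close> is the server state right after arrival \<open>i\<close>, and \<open>adm i\<close> tells whether arrival
  \<open>i\<close> is admitted.\<close>

definition queue_at :: "(nat \<Rightarrow> real) \<Rightarrow> (nat \<Rightarrow> real) \<Rightarrow> (nat \<Rightarrow> server) \<Rightarrow> real \<Rightarrow> nat" where
  "queue_at x y run t =
     (let i = num_epochs x t in queue (serve y (epoch x i) t (run i)))"

definition num_joined :: "(nat \<Rightarrow> real) \<Rightarrow> (nat \<Rightarrow> bool) \<Rightarrow> real \<Rightarrow> nat" where
  "num_joined x adm t = card {i. 1 \<le> i \<and> epoch x i \<le> t \<and> adm i}"

definition profit ::
  "params \<Rightarrow> (nat \<Rightarrow> real) \<Rightarrow> (nat \<Rightarrow> real) \<Rightarrow> (nat \<Rightarrow> server) \<Rightarrow> (nat \<Rightarrow> bool) \<Rightarrow> real \<Rightarrow> real" where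
  "profit p x y run adm t =
     reward p * real (num_joined x adm t)
     - hold_cost p * (LBINT u:{0..t}. real (queue_at x y run u))"

definition profit_gap ::
  "params \<Rightarrow> (nat \<Rightarrow> real) \<Rightarrow> (nat \<Rightarrow> real) \<Rightarrow> (nat \<Rightarrow> bool) \<Rightarrow> real \<Rightarrow> real" where
  "profit_gap p x y b t =
     profit p x y (\<lambda>i. fst (genie_run p x y b i)) (\<lambda>i. genie_admits (genie_seen p x y b i)) t
     - profit p x y (\<lambda>i. server_of (learner_run p x y b i)) (\<lambda>i. admits (learner_seen p x y b i)) t"

text \<open>The profit gap at the time of the \<open>N\<close>-th arrival, as a random variable on the space that
  carries the gaps \<open>X\<close>, \<open>Y\<close> and the Bernoulli variables \<open>B\<close>.\<close>

definition regret_var ::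
  "params \<Rightarrow> (nat \<Rightarrow> 'a \<Rightarrow> real) \<Rightarrow> (nat \<Rightarrow> 'a \<Rightarrow> real) \<Rightarrow> (nat \<Rightarrow> 'a \<Rightarrow> real) \<Rightarrow> nat \<Rightarrow> 'a \<Rightarrow> real"
where
  "regret_var p X Y B N \<omega> =
     profit_gap p (\<lambda>n. X n \<omega>) (\<lambda>n. Y n \<omega>) (\<lambda>j. B j \<omega> = 1) (epoch (\<lambda>n. X n \<omega>) N)"

definition regret ::
  "'a measure \<Rightarrow> params \<Rightarrow> (nat \<Rightarrow> 'a \<Rightarrow> real) \<Rightarrow> (nat \<Rightarrow> 'a \<Rightarrow> real) \<Rightarrow> (nat \<Rightarrow> 'a \<Rightarrow> real) \<Rightarrow> nat \<Rightarrow> real"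
where
  "regret M p X Y B N = (\<integral>\<omega>. regret_var p X Y B N \<omega> \<partial>M)"

end

theory Submission
  imports Defs "HOL-Real_Asymp.Real_Asymp"
begin

text \<open>If \<open>0\<close> is an optimal threshold, the genie's threshold \<open>K\<close> is at most \<open>1\<close>, the coupled genie never
  has more customers than the learner, and a learner whose threshold is at most \<open>K\<close> falls into step
  with the genie once its queue has emptied. So regret is caused only by explorations and by batches
  that overestimate \<open>K\<close>. An exploration costs a bounded amount in expectation, because in each
  inter-arrival time a bounded queue empties with a fixed positive probability; up to arrival \<open>N\<close> the
  expected number of explorations is at most of the order of the sum of \<open>ln\<^sup>\<epsilon>(j) / j\<close>, that is
  \<open>ln\<^bsup>1 + \<epsilon>\<^esup>(N)\<close>.

  Overestimating means that the empirical mean service time is at most some \<open>th < 1 / mu\<close>. With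
  \<open>g = mu / (mu + a)\<close>, the process \<open>exp (- a * (total and current service)) * g ^ (- completed)\<close> is a
  martingale, which makes this exponentially unlikely in the number of completed services, and the
  latter is at least half the number of successful Bernoulli trials. The trials accumulate like
  \<open>A * ln j\<close> for every \<open>A\<close>, so batch \<open>j\<close> overestimates with a probability that decays faster than any
  power of \<open>j\<close>; its expected cost given an overestimation is polynomial in \<open>j\<close>, since thresholds are
  capped at the order of \<open>ln j\<close>.\<close>

section \<open>Thresholds\<close>

text \<open>Batches begin at random arrivals that depend on everything observed so far, so nothing
  is conditioned on a batch. Every cost is counted arrival by arrival, as a sum of indicators over
  \<open>n < N\<close>, and optional stopping becomes an induction on \<open>n\<close> in which the
  mass of the martingale is taken out when batch \<open>j\<close> begins. What each step needs from
  probability is that, given the history up to an arrival, the next gap and the restarted process of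
  potential departures are fresh.

  The number of completed services, which governs the precision of the estimate, depends on the
  services themselves. The pathwise bound by the number of trials removes this dependence: the
  trials are independent of both point processes, so the whole trial sequence may be treated as
  known while the martingale runs, and is averaged out last. The factor one half in that bound is
  due to trials without effect: a successful trial starts no exploration if the previous threshold
  is positive, but then the previous batch has served a customer.\<close>

lemma V_Suc:
  assumes "0 < y" "0 < z"
  shows "V (Suc K) y z = V K y z + (\<Sum>i\<le>K. (z / y) ^ i) / y"
proof (cases "y = z")
  case True
  then show ?thesis using assms by (simp add: V_def field_simps)
next
  case False
  have "z / y \<noteq> 1" using False assms by auto
  then have s: "(\<Sum>i\<le>K. (z / y) ^ i) = (1 - (z / y) ^ Suc K) / (1 - z / y)"
    using sum_gp0 by metis
  have d: "(\<Sum>i\<le>K. (z / y) ^ i) / y = (1 - (z / y) ^ Suc K) / (y - z)"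
    unfolding s using assms False by (simp add: divide_simps)
  define q where "q = (z / y) ^ K"
  have q': "(z / y) ^ Suc K = z / y * q" by (simp add: q_def)
  define w where "w = z / y"
  have z: "z = w * y" using assms by (simp add: w_def)
  have "(real (Suc K) * (y - z) - z * (1 - w * q)) =
      (real K * (y - z) - z * (1 - q)) + (1 - w * q) * (y - z)"
    unfolding z by (simp add: algebra_simps)
  note n = this[unfolded w_def]
  show ?thesis
    unfolding d V_def q' q_def[symmetric] n using False by (simp add: add_divide_distrib power2_eq_square)
qed

lemma V_0 [simp]: "V 0 y z = 0"
  by (simp add: V_def)

text \<open>The geometric sum in \<open>V_Suc\<close> contains the summand \<open>1\<close> for
  \<open>i = 0\<close>. Strict monotonicity, unboundedness and the linear bound \<open>V_ge\<close>
  all rest on this.\<close>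

lemma V_Suc_ge:
  assumes "0 < y" "0 < z"
  shows "V K y z + 1 / y \<le> V (Suc K) y z"
proof -
  have "1 \<le> (\<Sum>i\<le>K. (z / y) ^ i)"
    using assms member_le_sum[of 0 "{..K}" "\<lambda>i. (z / y) ^ i"] by simp
  then show ?thesis
    using assms by (simp add: V_Suc divide_right_mono)
qed

lemma V_strict_mono:
  assumes "0 < y" "0 < z"
  shows "strict_mono (\<lambda>K. V K y z)"
proof (rule strict_monoI_Suc)
  fix K
  have "0 < 1 / y" using assms by simp
  then show "V K y z < V (Suc K) y z" using V_Suc_ge[OF assms, of K] by linarith
qed

lemma V_ge:
  assumes "0 < y" "0 < z"
  shows "real K / y \<le> V K y z"
proof (induction K)
  case (Suc K)
  then show ?case
    using V_Suc_ge[OF assms, of K] by (simp add: add_divide_distrib)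
qed simp

lemma crit_threshold_unique:
  assumes "0 < y" "0 < z" "V K y z \<le> c \<and> c < V (Suc K) y z" "V L y z \<le> c \<and> c < V (Suc L) y z"
  shows "K = L"
proof -
  have "V K y z < V (Suc L) y z" "V L y z < V (Suc K) y z"
    using assms(3,4) by auto
  then show ?thesis
    using strict_mono_less[OF V_strict_mono[OF assms(1,2)]] by (metis less_Suc_eq_le order_antisym)
qed

text \<open>By \<open>V_ge\<close>, some \<open>V n y z\<close> exceeds \<open>c\<close>. The
  witness is the predecessor of the first such \<open>n\<close>; it exists because
  \<open>V 0 y z = 0\<close> does not exceed \<open>c\<close>.\<close>

lemma crit_threshold_exists:
  assumes "0 < y" "0 < z" "0 \<le> c"
  shows "\<exists>K. V K y z \<le> c \<and> c < V (Suc K) y z"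
proof -
  obtain n where "c * y < real n" using reals_Archimedean2 by blast
  then have "c < real n / y" using assms by (simp add: field_simps)
  then have n: "c < V n y z" using V_ge[OF assms(1,2), of n] by simp
  define m where "m = (LEAST n. c < V n y z)"
  have m: "c < V m y z" unfolding m_def by (rule LeastI, rule n)
  then have "m \<noteq> 0" using assms(3) by (cases m) auto
  then obtain K where K: "m = Suc K" using not0_implies_Suc by blast
  have "\<not> c < V K y z" using K unfolding m_def by (metis lessI not_less_Least)
  then show ?thesis using m K by (intro exI[of _ K]) auto
qed

lemma crit_threshold_spec:
  assumes "0 < y" "0 < z" "0 \<le> R / C"
  shows "V (crit_threshold R C y z) y z \<le> R / C" "R / C < V (Suc (crit_threshold R C y z)) y z"
proof -
  have "\<exists>!K. V K y z \<le> R / C \<and> R / C < V (Suc K) y z"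
    using crit_threshold_exists[OF assms] crit_threshold_unique[OF assms(1,2)] by blast
  from theI'[OF this] show "V (crit_threshold R C y z) y z \<le> R / C"
    "R / C < V (Suc (crit_threshold R C y z)) y z"
    using assms by (auto simp: crit_threshold_def)
qed

text \<open>Replaces the definite description by inequalities, level set by level set, which is the
  form that measurability of the learned threshold requires.\<close>

lemma crit_threshold_eq_iff:
  assumes "0 \<le> R / C"
  shows "crit_threshold R C y z = K \<longleftrightarrow>
    (if 0 < y \<and> 0 < z then V K y z \<le> R / C \<and> R / C < V (Suc K) y z else K = 0)"
  using crit_threshold_spec[OF _ _ assms] crit_threshold_unique[of y z]
  by (auto simp: crit_threshold_def)

lemma crit_threshold_gt:
  assumes "K < crit_threshold R C y z" "0 \<le> R / C"
  shows "0 < y" "0 < z" "V (Suc K) y z \<le> R / C"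
proof -
  show yz: "0 < y" "0 < z"
    using assms(1) by (auto simp: crit_threshold_def split: if_splits)
  have "V (Suc K) y z \<le> V (crit_threshold R C y z) y z"
    using strict_mono_less_eq[OF V_strict_mono[OF yz]] assms(1) by simp
  then show "V (Suc K) y z \<le> R / C"
    using crit_threshold_spec(1)[OF yz assms(2)] by simp
qed

lemma V_1: "0 < y \<Longrightarrow> 0 < z \<Longrightarrow> V (Suc 0) y z = 1 / y"
  using V_Suc[of y z 0] by simp

text \<open>When \<open>0\<close> is optimal, an estimated threshold above the true one forces an underestimate
  of the mean service time, whatever the estimate of the arrival rate: \<open>V 2 y z \<ge> 2 / y\<close>.\<close>

lemma overestimate_imp_short_services:
  assumes "0 < R" "0 < C" "0 < lam" "0 < mu" "0 \<in> opt_thresholds R C lam mu"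
  defines "K \<equiv> crit_threshold R C mu lam"
  shows "K \<le> 1" "V K mu lam < R / C \<longleftrightarrow> K = 0"
    "\<exists>th>0. th < 1 / mu \<and> (\<forall>m v. K < crit_threshold R C (1 / m) (1 / v) \<longrightarrow> m \<le> th)"
proof -
  have RC: "0 < R / C" using assms by simp
  have K: "V K mu lam \<le> R / C" "R / C < V (Suc K) mu lam"
    using crit_threshold_spec[of mu lam R C] assms by (auto simp: K_def)
  have opt: "0 \<in> (if V K mu lam < R / C then {K} else {K - 1, K})"
    using assms(5) unfolding opt_thresholds_def K_def Let_def .
  show le: "K \<le> 1" using opt by (auto split: if_splits)
  show iff: "V K mu lam < R / C \<longleftrightarrow> K = 0"
  proof
    assume "V K mu lam < R / C"
    then show "K = 0" using opt by (auto split: if_splits)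
  next
    assume "K = 0"
    then show "V K mu lam < R / C" using RC by simp
  qed
  show "\<exists>th>0. th < 1 / mu \<and> (\<forall>m v. K < crit_threshold R C (1 / m) (1 / v) \<longrightarrow> m \<le> th)"
  proof (cases "K = 0")
    case True
    \<comment> \<open>With \<open>K = 0\<close> the bound is \<open>R / C\<close> itself: an
      estimate of at least \<open>1\<close> means \<open>m = V 1 \<le> R / C\<close> for the
      estimated rates, while \<open>K = 0\<close> means \<open>R / C < V 1 = 1 / mu\<close> for the
      true ones.\<close>
    have "m \<le> R / C" if "K < crit_threshold R C (1 / m) (1 / v)" for m v
      using crit_threshold_gt[OF that] RC V_1[of "1 / m" "1 / v"] True by simp
    moreover have "R / C < 1 / mu" using K(2) True V_1[of mu lam] assms by simp
    ultimately show ?thesis using RC by blast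
  next
    case False
    then have K1: "K = 1" using le by simp
    \<comment> \<open>With \<open>K = 1\<close> and \<open>0\<close> optimal there is equality in
      \<open>V 1 \<le> R / C\<close>, so \<open>R / C = 1 / mu\<close>. An estimate of at least
      \<open>2\<close> then gives \<open>2 * m \<le> V 2 \<le> 1 / mu\<close>, which leaves half of
      the true mean as bound.\<close>
    then have RCmu: "R / C = 1 / mu" using iff K(1) V_1[of mu lam] assms by simp
    have "m \<le> 1 / (2 * mu)" if "K < crit_threshold R C (1 / m) (1 / v)" for m v
    proof -
      have "0 < 1 / m" "0 < 1 / v" "V (Suc 1) (1 / m) (1 / v) \<le> R / C"
        using crit_threshold_gt[OF that] RC K1 by auto
      then have "2 * m \<le> 1 / mu"
        using V_ge[of "1 / m" "1 / v" "Suc 1"] RCmu by simp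
      then show ?thesis using assms(4) by (simp add: field_simps)
    qed
    then show ?thesis
      using assms(4) by (intro exI[of _ "1 / (2 * mu)"]) (auto simp: field_simps)
  qed
qed

lemma measurable_crit_threshold [measurable]:
  assumes [measurable]: "f \<in> borel_measurable N" "g \<in> borel_measurable N" and "0 \<le> R / C"
  shows "(\<lambda>\<omega>. crit_threshold R C (f \<omega>) (g \<omega>)) \<in> measurable N (count_space UNIV)"
proof -
  have V: "(\<lambda>\<omega>. V K (f \<omega>) (g \<omega>)) \<in> borel_measurable N" for K
    unfolding V_def by measurable
  note [measurable] = V
  have "Measurable.pred N (\<lambda>\<omega>. crit_threshold R C (f \<omega>) (g \<omega>) = K)" for K
    unfolding crit_threshold_eq_iff[OF assms(3)] by measurable
  then show ?thesis
    by (subst measurable_count_space_eq2_countable) (auto simp: pred_def vimage_def Int_def conj_commute)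
qed

section \<open>Point processes and the server\<close>

text \<open>The points are distinct and do not accumulate, so every time lies between two
  consecutive ones. The path arguments use this almost sure event; \<open>m\<close> ranges over
  \<open>nat\<close> so that it is a countable combination of measurable events.\<close>

definition regular_gaps :: "(nat \<Rightarrow> real) \<Rightarrow> bool" where
  "regular_gaps y \<longleftrightarrow> (\<forall>n. 0 < y n) \<and> (\<forall>m::nat. \<exists>n. real m < epoch y n)"

lemma epoch_0 [simp]: "epoch y 0 = 0"
  by (simp add: epoch_def)

lemma epoch_Suc: "epoch y (Suc n) = epoch y n + y n"
  by (simp add: epoch_def)

lemma epoch_case_nat: "epoch (case_nat s y) (Suc n) = s + epoch y n"
  by (induction n) (auto simp: epoch_def)

lemma epoch_cong: "(\<And>n. n < k \<Longrightarrow> y n = y' n) \<Longrightarrow> epoch y k = epoch y' k"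
  by (simp add: epoch_def)

lemma epoch_less_iff:
  assumes "\<forall>n. 0 < y n"
  shows "epoch y m < epoch y n \<longleftrightarrow> m < n"
  by (rule strict_mono_less) (use assms in \<open>auto intro!: strict_monoI_Suc simp: epoch_Suc\<close>)

lemma epoch_le_iff:
  assumes "\<forall>n. 0 < y n"
  shows "epoch y m \<le> epoch y n \<longleftrightarrow> m \<le> n"
  by (rule strict_mono_less_eq) (use assms in \<open>auto intro!: strict_monoI_Suc simp: epoch_Suc\<close>)

lemma epoch_nonneg: "\<forall>n. 0 < y n \<Longrightarrow> 0 \<le> epoch y n"
  using epoch_le_iff[of y 0 n] by simp

lemma num_epochs_eq:
  assumes "\<forall>n. 0 < y n" "epoch y k \<le> t" "t < epoch y (Suc k)"
  shows "num_epochs y t = k"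
proof -
  have "{n. 1 \<le> n \<and> epoch y n \<le> t} = {1..k}"
  proof (intro set_eqI iffI; clarsimp)
    fix n assume "Suc 0 \<le> n" "epoch y n \<le> t"
    then have "epoch y n < epoch y (Suc k)" using assms(3) by simp
    then show "n \<le> k" using epoch_less_iff[OF assms(1)] by simp
  next
    fix n assume "Suc 0 \<le> n" "n \<le> k"
    then have "epoch y n \<le> epoch y k" using epoch_le_iff[OF assms(1)] by simp
    then show "epoch y n \<le> t" using assms(2) by simp
  qed
  then show ?thesis by (simp add: num_epochs_def)
qed

lemma regular_gaps_unbounded: "regular_gaps y \<Longrightarrow> \<exists>n. t < epoch y n"
  using reals_Archimedean2[of t] less_trans unfolding regular_gaps_def by blast

lemma ex_epoch_interval:
  assumes "regular_gaps y" "0 \<le> t"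
  shows "\<exists>k. epoch y k \<le> t \<and> t < epoch y (Suc k)"
proof -
  define m where "m = (LEAST n. t < epoch y n)"
  have m: "t < epoch y m"
    using regular_gaps_unbounded[OF assms(1)] unfolding m_def by (rule LeastI_ex)
  then obtain k where k: "m = Suc k" using assms(2) by (cases m) auto
  have "\<not> t < epoch y k" using k unfolding m_def by (metis lessI not_less_Least)
  then show ?thesis using m k by (intro exI[of _ k]) auto
qed

lemma num_epochs_bounds:
  assumes "regular_gaps y" "0 \<le> t"
  shows "epoch y (num_epochs y t) \<le> t" "t < epoch y (Suc (num_epochs y t))"
  using ex_epoch_interval[OF assms] num_epochs_eq[of y _ t] assms(1)
  unfolding regular_gaps_def by metis+

lemma le_num_epochs_iff:
  assumes "regular_gaps y" "0 \<le> t"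
  shows "k \<le> num_epochs y t \<longleftrightarrow> epoch y k \<le> t"
proof -
  have pos: "\<forall>n. 0 < y n" using assms by (simp add: regular_gaps_def)
  note b = num_epochs_bounds[OF assms]
  show ?thesis
  proof
    assume "k \<le> num_epochs y t"
    then show "epoch y k \<le> t" using epoch_le_iff[OF pos, of k "num_epochs y t"] b(1) by linarith
  next
    assume "epoch y k \<le> t"
    then have "epoch y k < epoch y (Suc (num_epochs y t))" using b(2) by linarith
    then show "k \<le> num_epochs y t" using epoch_less_iff[OF pos] by simp
  qed
qed

lemma num_epochs_mono:
  assumes "regular_gaps y" "0 \<le> s" "s \<le> t"
  shows "num_epochs y s \<le> num_epochs y t"
  using num_epochs_bounds[OF assms(1,2)] le_num_epochs_iff[OF assms(1), of t] assms(2,3) by fastforce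

text \<open>The point process seen from time \<open>t\<close>, whose first gap is the unexpired part
  of the gap around \<open>t\<close>. Memorylessness is used in the form that this process is
  distributed like the original and independent of the past.\<close>

definition residual_gaps :: "real \<Rightarrow> (nat \<Rightarrow> real) \<Rightarrow> nat \<Rightarrow> real" where
  "residual_gaps t y n =
     (if n = 0 then epoch y (Suc (num_epochs y t)) - t else y (num_epochs y t + n))"

lemma epoch_residual_gaps:
  "epoch (residual_gaps t y) (Suc m) = epoch y (num_epochs y t + Suc m) - t"
  by (induction m) (simp_all add: residual_gaps_def epoch_Suc)

lemma regular_residual_gaps:
  assumes "regular_gaps y" "0 \<le> t"
  shows "regular_gaps (residual_gaps t y)"
proof -
  have pos: "\<forall>n. 0 < y n" using assms by (simp add: regular_gaps_def)
  have "0 < residual_gaps t y n" for n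
    using num_epochs_bounds[OF assms] pos by (simp add: residual_gaps_def)
  moreover have "\<exists>n. real m < epoch (residual_gaps t y) n" for m :: nat
  proof -
    obtain n where n: "real m + t < epoch y n" using regular_gaps_unbounded[OF assms(1)] by blast
    have "epoch y n \<le> epoch y (num_epochs y t + Suc n)" using epoch_le_iff[OF pos] by simp
    then have "real m < epoch (residual_gaps t y) (Suc n)"
      using n unfolding epoch_residual_gaps by simp
    then show ?thesis by blast
  qed
  ultimately show ?thesis by (auto simp: regular_gaps_def)
qed

lemma num_epochs_residual_gaps:
  assumes "regular_gaps y" "0 \<le> t" "0 \<le> h"
  shows "num_epochs (residual_gaps t y) h = num_epochs y (t + h) - num_epochs y t"
proof -
  have r: "regular_gaps (residual_gaps t y)" by (rule regular_residual_gaps[OF assms(1,2)])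
  have th: "0 \<le> t + h" using assms by simp
  have "m \<le> num_epochs (residual_gaps t y) h \<longleftrightarrow> m \<le> num_epochs y (t + h) - num_epochs y t" for m
  proof (cases m)
    case (Suc n)
    have "m \<le> num_epochs (residual_gaps t y) h \<longleftrightarrow> epoch y (num_epochs y t + m) - t \<le> h"
      unfolding le_num_epochs_iff[OF r assms(3)] Suc epoch_residual_gaps ..
    also have "\<dots> \<longleftrightarrow> num_epochs y t + m \<le> num_epochs y (t + h)"
      unfolding le_num_epochs_iff[OF assms(1) th] by linarith
    finally show ?thesis using Suc by linarith
  qed simp
  then show ?thesis by (metis le_antisym order_refl)
qed

lemma regular_gaps_case_nat: "regular_gaps (case_nat s y) \<longleftrightarrow> 0 < s \<and> regular_gaps y"
proof
  assume r: "regular_gaps (case_nat s y)"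
  then have s: "0 < s" "\<forall>n. 0 < y n"
    unfolding regular_gaps_def by (metis old.nat.simps(4)) (metis r regular_gaps_def old.nat.simps(5))
  have "\<exists>n. real m < epoch y n" for m
  proof -
    obtain n where n: "real m + s < epoch (case_nat s y) n" using regular_gaps_unbounded[OF r] by blast
    then obtain n' where "n = Suc n'" using s by (cases n) auto
    then show ?thesis using n by (auto simp: epoch_case_nat)
  qed
  then show "0 < s \<and> regular_gaps y" using s by (auto simp: regular_gaps_def)
next
  assume r: "0 < s \<and> regular_gaps y"
  then have "\<exists>n. real m < epoch (case_nat s y) n" for m
  proof -
    obtain n where "real m < epoch y n" using r by (auto simp: regular_gaps_def)
    then have "real m < epoch (case_nat s y) (Suc n)" using r by (simp add: epoch_case_nat)
    then show ?thesis by blast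
  qed
  then show "regular_gaps (case_nat s y)" using r by (auto simp: regular_gaps_def split: nat.split)
qed

lemma num_epochs_case_nat:
  assumes "regular_gaps y" "0 < s" "s \<le> t"
  shows "num_epochs (case_nat s y) t = Suc (num_epochs y (t - s))"
proof (rule num_epochs_eq)
  have "0 \<le> t - s" using assms by simp
  from num_epochs_bounds[OF assms(1) this]
  show "epoch (case_nat s y) (Suc (num_epochs y (t - s))) \<le> t"
    "t < epoch (case_nat s y) (Suc (Suc (num_epochs y (t - s))))"
    unfolding epoch_case_nat by linarith+
  show "\<forall>n. 0 < case_nat s y n"
    using assms regular_gaps_case_nat[of s y] by (simp add: regular_gaps_def)
qed

lemma num_epochs_less_first:
  assumes "regular_gaps y" "0 \<le> t" "t < y 0"
  shows "num_epochs y t = 0"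
  by (rule num_epochs_eq) (use assms in \<open>auto simp: regular_gaps_def epoch_Suc\<close>)

lemma residual_gaps_case_nat:
  assumes "regular_gaps y" "0 < s" "s \<le> t"
  shows "residual_gaps t (case_nat s y) = residual_gaps (t - s) y"
  by (rule ext) (simp add: residual_gaps_def num_epochs_case_nat[OF assms] epoch_case_nat)

text \<open>The service times telescope, since each service after the first begins where the
  previous one ends. Hence only the first \<open>m\<close> potential departures have an effect, and
  the last of them determines the state.\<close>

lemma fold_potential_departure:
  fixes st :: server
  assumes "m = min c (queue st)"
  shows "fold (\<lambda>k. potential_departure (epoch y k)) [Suc k..<Suc (k + c)] st =
     (if m = 0 then st
      else st\<lparr>queue := queue st - m, completed := completed st + m,
              total_service := total_service st + (epoch y (k + m) - service_start st),
              service_start := epoch y (k + m)\<rparr>)"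
  using assms
proof (induction c arbitrary: m)
  case (Suc c)
  have l: "[Suc k..<Suc (k + Suc c)] = [Suc k..<Suc (k + c)] @ [Suc (k + c)]" by simp
  show ?case
    unfolding l fold_append comp_def Suc.IH[OF refl] fold.simps id_apply Suc.prems
    by (cases "c < queue st") (auto simp: potential_departure_def min_def split: if_splits)
qed simp

lemma serve_eq:
  fixes st :: server
  assumes "num_epochs y s \<le> num_epochs y t"
  defines "m \<equiv> min (num_epochs y t - num_epochs y s) (queue st)"
  shows "serve y s t st =
     (if m = 0 then st
      else st\<lparr>queue := queue st - m, completed := completed st + m,
              total_service := total_service st + (epoch y (num_epochs y s + m) - service_start st),
              service_start := epoch y (num_epochs y s + m)\<rparr>)"
  using fold_potential_departure[OF m_def[THEN meta_eq_to_obj_eq], of y "num_epochs y s"] assms(1)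
  by (simp add: serve_def del: upt_Suc)

lemma serve_cong:
  assumes "\<And>n. n < num_epochs y t \<Longrightarrow> y n = y' n"
    and "num_epochs y s = num_epochs y' s" "num_epochs y t = num_epochs y' t"
  shows "serve y s t st = serve y' s t st"
  unfolding serve_def assms(2,3)[symmetric]
  by (rule fold_cong) (use assms(1) in \<open>auto intro!: arg_cong[of _ _ "\<lambda>e. potential_departure e"] epoch_cong\<close>)

lemma serve_queue: "num_epochs y s \<le> num_epochs y t \<Longrightarrow>
    queue (serve y s t st) = queue st - (num_epochs y t - num_epochs y s)"
  by (simp add: serve_eq min_def)

lemma serve_completed: "num_epochs y s \<le> num_epochs y t \<Longrightarrow>
    completed (serve y s t st) + queue (serve y s t st) = completed st + queue st"
  by (simp add: serve_eq min_def)

lemma serve_total_mono: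
  assumes "regular_gaps y" "0 \<le> s" "s \<le> t" "service_start st \<le> s"
  shows "total_service st \<le> total_service (serve y s t st)" "service_start (serve y s t st) \<le> t"
proof -
  let ?m = "min (num_epochs y t - num_epochs y s) (queue st)"
  have n: "num_epochs y s \<le> num_epochs y t" using num_epochs_mono[OF assms(1-3)] .
  have pos: "\<forall>n. 0 < y n" using assms by (simp add: regular_gaps_def)
  have 1: "s \<le> epoch y (num_epochs y s + ?m)" if "?m \<noteq> 0"
  proof -
    have "epoch y (Suc (num_epochs y s)) \<le> epoch y (num_epochs y s + ?m)"
      unfolding epoch_le_iff[OF pos] using that by linarith
    then show ?thesis using num_epochs_bounds(2)[OF assms(1,2)] by linarith
  qed
  have 2: "epoch y (num_epochs y s + ?m) \<le> t"
    by (subst le_num_epochs_iff[symmetric]) (use assms n in auto)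
  show "total_service st \<le> total_service (serve y s t st)" "service_start (serve y s t st) \<le> t"
    unfolding serve_eq[OF n] using 1 2 assms by auto
qed

section \<open>Sample paths of the learner and the genie\<close>

text \<open>Arrivals are counted from \<open>0\<close> here: arrival \<open>n\<close> is customer \<open>Suc n\<close>, who finds the state
  \<open>learner_seen p x y b (Suc n)\<close> and leaves the state \<open>learner_run p x y b (Suc n)\<close>.\<close>

definition exploring :: "params \<Rightarrow> (nat \<Rightarrow> real) \<Rightarrow> (nat \<Rightarrow> real) \<Rightarrow> (nat \<Rightarrow> bool) \<Rightarrow> nat \<Rightarrow> bool" where
  "exploring p x y b n \<longleftrightarrow> \<not> exploiting (learner_seen p x y b (Suc n))"

definition overestimating :: "params \<Rightarrow> (nat \<Rightarrow> real) \<Rightarrow> (nat \<Rightarrow> real) \<Rightarrow> (nat \<Rightarrow> bool) \<Rightarrow> nat \<Rightarrow> bool" where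
  "overestimating p x y b n \<longleftrightarrow> exploiting (learner_seen p x y b (Suc n)) \<and>
     genie_opt p < threshold (learner_seen p x y b (Suc n))"

text \<open>Excluding overestimation bounds the learner's queue by \<open>kstar\<close>, the same
  for all batches, so that in each inter-arrival time a lag is wiped out with a probability bounded
  away from \<open>0\<close>.\<close>

definition lagging :: "params \<Rightarrow> (nat \<Rightarrow> real) \<Rightarrow> (nat \<Rightarrow> real) \<Rightarrow> (nat \<Rightarrow> bool) \<Rightarrow> nat \<Rightarrow> bool" where
  "lagging p x y b n \<longleftrightarrow> \<not> overestimating p x y b n \<and>
     queue (fst (genie_run p x y b (Suc n))) < queue (server_of (learner_run p x y b (Suc n)))"

definition batch_len :: "params \<Rightarrow> nat \<Rightarrow> nat" where
  "batch_len p j = nat \<lceil>growth p j * real (exploit_len p)\<rceil>"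

definition departures :: "(nat \<Rightarrow> real) \<Rightarrow> (nat \<Rightarrow> real) \<Rightarrow> nat \<Rightarrow> nat" where
  "departures x y n = num_epochs y (epoch x (Suc n)) - num_epochs y (epoch x n)"

text \<open>Counts successful trials, including those that trigger no phase 1 because the preceding
  threshold is positive. Unlike the number of actual phases 1, this depends on the trials
  alone.\<close>

definition explorations :: "(nat \<Rightarrow> bool) \<Rightarrow> nat \<Rightarrow> nat" where
  "explorations b j = (\<Sum>i=1..j. of_bool (b i))"

text \<open>\<open>opt_le\<close> and \<open>static_iff\<close> express the optimality of
  \<open>0\<close> for sample paths: either a static genie rejects everybody, or the genie
  alternates between the thresholds \<open>0\<close> and \<open>1\<close>.\<close>

locale queue_params =
  fixes p :: params
  assumes explore_len: "1 < explore_len p"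
    and exploit_len: "explore_len p \<le> exploit_len p"
    and growth: "\<And>j. 1 \<le> j \<Longrightarrow> 1 \<le> growth p j"
    and fallback: "\<And>j x. 1 \<le> j \<Longrightarrow> fallback p j x \<le> max_threshold p j"
    and init_eq: "genie_init_queue p = init_queue p"
    and opt_le: "genie_opt p \<le> 1"
    and static_iff: "genie_static p \<longleftrightarrow> genie_opt p = 0"
begin

text \<open>The largest queue that a phase 1 can leave behind: only the compulsory first one may
  begin with customers present, and these are initial ones.\<close>

abbreviation "kstar \<equiv> init_queue p + explore_len p"

lemma batch_len_pos: "1 \<le> j \<Longrightarrow> 0 < batch_len p j"
proof -
  assume "1 \<le> j"
  then have "0 < growth p j" using growth[of j] by simp
  moreover have "0 < real (exploit_len p)" using explore_len exploit_len by simp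
  ultimately show ?thesis by (simp add: batch_len_def)
qed

lemma learned_threshold_le: "1 \<le> j \<Longrightarrow> learned_threshold p x j i st \<le> max_threshold p j"
  using fallback[of j] by (auto simp: learned_threshold_def Let_def)

lemma kstar_le_max_threshold: "kstar \<le> max_threshold p j"
  by (simp add: max_threshold_def)

end

locale queue_path = queue_params +
  fixes x y :: "nat \<Rightarrow> real" and b :: "nat \<Rightarrow> bool"
  assumes x_pos: "\<forall>n. 0 < x n" and y_regular: "regular_gaps y"
begin

abbreviation "run n \<equiv> learner_run p x y b n"
abbreviation "seen n \<equiv> learner_seen p x y b (Suc n)"
abbreviation "grun n \<equiv> genie_run p x y b n"
abbreviation "gseen n \<equiv> genie_seen p x y b (Suc n)"
abbreviation "srv n \<equiv> serve y (epoch x n) (epoch x (Suc n)) (server_of (run n))"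
abbreviation "joined n \<equiv> (if admits (seen n) then join_queue (epoch x (Suc n)) (srv n) else srv n)"
abbreviation "queue_run n \<equiv> queue (server_of (run n))"
abbreviation "queue_seen n \<equiv> queue (server_of (seen n))"
abbreviation "gqueue_run n \<equiv> queue (fst (grun n))"
abbreviation "gqueue_seen n \<equiv> queue (fst (gseen n))"

lemma seen_eq: "seen n = before_arrival p x y b (Suc n) (run n)"
  by (simp add: learner_seen_def)

lemma gseen_eq: "gseen n = genie_before_arrival p x y b (Suc n) (grun n)"
  by (simp add: genie_seen_def)

lemma run_Suc: "run (Suc n) = handle_arrival p x (Suc n) (seen n)"
  by (simp add: seen_eq)

declare learner_run.simps(2) [simp del] genie_run.simps(2) [simp del]

lemma server_seen [simp]: "server_of (seen n) = srv n"
  by (simp add: seen_eq before_arrival_def Let_def)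

text \<open>The implication in the case \<open>same\<close> records that a phase 2 of sufficient
  length is prolonged only by arrivals that find customers.\<close>

lemma seen_cases:
  obtains (same) "seen n = (run n)\<lparr>server_of := srv n\<rparr>"
      "exploiting (run n) \<Longrightarrow> batch_len p (batch (run n)) \<le> phase_arrivals (run n) \<Longrightarrow> 0 < queue (srv n)"
  | (explore) "exploiting (run n)" "batch_len p (batch (run n)) \<le> phase_arrivals (run n)"
      "queue (srv n) = 0" "threshold (run n) = 0" "b (Suc (batch (run n)))"
      "seen n = \<lparr>server_of = srv n, batch = Suc (batch (run n)), exploiting = False,
         phase_arrivals = 0, threshold = 0\<rparr>"
  | (exploit) "exploiting (run n)" "batch_len p (batch (run n)) \<le> phase_arrivals (run n)"
      "queue (srv n) = 0" "0 < threshold (run n) \<or> \<not> b (Suc (batch (run n)))"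
      "seen n = \<lparr>server_of = srv n, batch = Suc (batch (run n)), exploiting = True,
         phase_arrivals = 0,
         threshold = learned_threshold p x (Suc (batch (run n))) (Suc n) (srv n)\<rparr>"
proof (cases "exploiting (run n) \<and> batch_len p (batch (run n)) \<le> phase_arrivals (run n) \<and> queue (srv n) = 0")
  case False
  then have "seen n = (run n)\<lparr>server_of := srv n\<rparr>"
    unfolding seen_eq before_arrival_def Let_def diff_Suc_1 batch_len_def by (simp only: if_False)
  then show ?thesis using False by (intro same) auto
next
  case True
  note t = this[unfolded batch_len_def]
  have "seen n = (if threshold (run n) = 0 \<and> b (batch (run n) + 1)
      then \<lparr>server_of = srv n, batch = Suc (batch (run n)), exploiting = False,
         phase_arrivals = 0, threshold = 0\<rparr>
      else \<lparr>server_of = srv n, batch = Suc (batch (run n)), exploiting = True,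
         phase_arrivals = 0,
         threshold = learned_threshold p x (Suc (batch (run n))) (Suc n) (srv n)\<rparr>)"
    unfolding seen_eq before_arrival_def Let_def diff_Suc_1 if_P[OF t] by simp
  then show ?thesis using True explore exploit by (auto split: if_splits)
qed

lemma run_cases:
  obtains (switch) "\<not> exploiting (seen n)" "explore_len p \<le> phase_arrivals (seen n) + 1"
      "run (Suc n) = (seen n)\<lparr>server_of := joined n, exploiting := True, phase_arrivals := 0,
         threshold := learned_threshold p x (batch (seen n)) (Suc n) (joined n)\<rparr>"
  | (stay) "exploiting (seen n) \<or> phase_arrivals (seen n) + 1 < explore_len p"
      "run (Suc n) = (seen n)\<lparr>server_of := joined n, phase_arrivals := phase_arrivals (seen n) + 1\<rparr>"
proof (cases "\<not> exploiting (seen n) \<and> explore_len p \<le> phase_arrivals (seen n) + 1")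
  case True
  then have "run (Suc n) = (seen n)\<lparr>server_of := joined n, exploiting := True, phase_arrivals := 0,
         threshold := learned_threshold p x (batch (seen n)) (Suc n) (joined n)\<rparr>"
    unfolding run_Suc handle_arrival_def Let_def if_P[OF True] by simp
  then show ?thesis using True switch by simp
next
  case False
  then have "run (Suc n) = (seen n)\<lparr>server_of := joined n, phase_arrivals := phase_arrivals (seen n) + 1\<rparr>"
    unfolding run_Suc handle_arrival_def Let_def if_not_P[OF False] by simp
  then show ?thesis using False stay by auto
qed

lemma server_run_Suc: "server_of (run (Suc n)) = joined n"
  by (cases rule: run_cases[of n]) auto

lemma num_epochs_le: "num_epochs y (epoch x n) \<le> num_epochs y (epoch x (Suc n))"
  using x_pos epoch_nonneg[OF x_pos] y_regular
  by (intro num_epochs_mono) (auto simp: epoch_Suc less_imp_le)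

lemma queue_srv: "queue (srv n) = queue_run n - departures x y n"
  by (simp add: serve_queue[OF num_epochs_le] departures_def)

lemma gqueue_seen_eq: "gqueue_seen n = gqueue_run n - departures x y n"
  by (simp add: gseen_eq genie_before_arrival_def Let_def serve_queue[OF num_epochs_le] departures_def)

section \<open>Bounds on the learner's queue\<close>

definition queue_inv :: "learner \<Rightarrow> bool" where
  "queue_inv s \<longleftrightarrow> 1 \<le> batch s \<and>
    (if exploiting s then threshold s \<le> max_threshold p (batch s) \<and>
        queue (server_of s) \<le> max kstar (threshold s)
     else phase_arrivals s < explore_len p \<and>
        queue (server_of s) \<le> init_queue p + phase_arrivals s)"

lemma inv_seen: "queue_inv (run n) \<Longrightarrow> queue_inv (seen n)"
  using explore_len
  by (cases rule: seen_cases[of n]) (auto simp: queue_inv_def queue_srv learned_threshold_le)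

lemma inv_run_Suc: "queue_inv (seen n) \<Longrightarrow> queue_inv (run (Suc n))"
  by (cases rule: run_cases[of n])
    (auto simp: queue_inv_def learned_threshold_le admits_def join_queue_def split: if_splits)

text \<open>In phase 1 each arrival adds at most one customer; in phase 2 admissions stop at the
  threshold, so the queue exceeds it only by what phase 1 has left.\<close>

lemma inv_run: "queue_inv (run n)"
proof (induction n)
  case 0
  then show ?case using explore_len by (simp add: queue_inv_def init_learner_def init_server_def)
qed (rule inv_run_Suc[OF inv_seen])

lemmas inv_seen' = inv_seen[OF inv_run]

lemma batch_pos: "1 \<le> batch (run n)" "1 \<le> batch (seen n)"
  using inv_run[of n] inv_seen'[of n] by (auto simp: queue_inv_def)

lemma batch_seen: "batch (seen n) = batch (run n) \<or> batch (seen n) = Suc (batch (run n))"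
  by (cases rule: seen_cases[of n]) auto

lemma batch_run_Suc: "batch (run (Suc n)) = batch (seen n)"
  by (cases rule: run_cases[of n]) auto

lemma batch_le: "batch (run n) \<le> Suc n"
proof (induction n)
  case (Suc n)
  then show ?case using batch_seen[of n] by (auto simp: batch_run_Suc)
qed (simp add: init_learner_def)

lemma queue_le_of_overestimating:
  assumes "overestimating p x y b n"
  shows "queue_run (Suc n) \<le> max_threshold p (batch (seen n))"
  using inv_run[of "Suc n"] assms kstar_le_max_threshold[of "batch (seen n)"]
  by (cases rule: run_cases[of n]) (auto simp: queue_inv_def overestimating_def)

lemma overestimating_eq:
  assumes "\<not> exploring p x y b n" "\<not> overestimating p x y b n"
  shows "exploiting (seen n)" "threshold (seen n) \<le> genie_opt p"
  using assms by (auto simp: exploring_def overestimating_def)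

lemma queue_le_of_not_overestimating:
  assumes "\<not> overestimating p x y b n"
  shows "queue_run (Suc n) \<le> kstar"
proof (cases rule: run_cases[of n])
  \<comment> \<open>The threshold just computed may be large, but the queue was built up in phase 1,
    which bounds it by \<open>kstar\<close>.\<close>
  case switch
  then show ?thesis
    using inv_seen'[of n] by (auto simp: queue_inv_def admits_def join_queue_def split: if_splits)
next
  case stay
  show ?thesis
  proof (cases "exploiting (seen n)")
    case True
    then have "threshold (run (Suc n)) \<le> 1"
      using assms stay opt_le by (auto simp: overestimating_def)
    then show ?thesis using inv_run[of "Suc n"] stay True explore_len by (auto simp: queue_inv_def max_def split: if_splits)
  next
    case False
    then show ?thesis using inv_run[of "Suc n"] stay by (auto simp: queue_inv_def)
  qed
qed

section \<open>The coupling of learner and genie\<close>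

lemma genie_threshold: "snd (grun n) \<le> genie_opt p \<and> snd (gseen n) \<le> genie_opt p"
proof (induction n)
  case 0
  show ?case by (auto simp: gseen_eq init_genie_def genie_before_arrival_def Let_def)
next
  case (Suc n)
  then have "snd (grun (Suc n)) \<le> genie_opt p"
    by (simp add: genie_run.simps(2) Let_def gseen_eq)
  then show ?case by (auto simp: gseen_eq genie_before_arrival_def Let_def)
qed

text \<open>The genie's threshold is at most \<open>1\<close>, so it admits only into an empty
  system, where an alternating genie has just reset its threshold from the learner's state. This
  eliminates the genie's stored threshold from all later arguments.\<close>

lemma genie_admits_iff:
  "genie_admits (gseen n) \<longleftrightarrow>
     gqueue_seen n = 0 \<and> exploiting (seen n) \<and> genie_opt p \<le> threshold (seen n) \<and> genie_opt p = 1"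
proof
  assume a: "genie_admits (gseen n)"
  then have "gqueue_seen n < snd (gseen n)" by (simp add: genie_admits_def)
  with genie_threshold[of n] opt_le have *: "gqueue_seen n = 0" "genie_opt p = 1" "snd (gseen n) = 1"
    by auto
  then show "gqueue_seen n = 0 \<and> exploiting (seen n) \<and> genie_opt p \<le> threshold (seen n) \<and> genie_opt p = 1"
    using static_iff by (auto simp: gseen_eq genie_before_arrival_def Let_def split: if_splits)
next
  assume "gqueue_seen n = 0 \<and> exploiting (seen n) \<and> genie_opt p \<le> threshold (seen n) \<and> genie_opt p = 1"
  then show "genie_admits (gseen n)"
    using static_iff by (auto simp: gseen_eq genie_before_arrival_def genie_admits_def Let_def)
qed

lemma gqueue_run_Suc: "gqueue_run (Suc n) = gqueue_seen n + of_bool (genie_admits (gseen n))"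
  by (simp add: genie_run.simps(2) gseen_eq Let_def join_queue_def)

lemma queue_run_Suc: "queue_run (Suc n) = queue_seen n + of_bool (admits (seen n))"
  by (simp add: server_run_Suc join_queue_def)

text \<open>Common potential departures preserve the order. Only a genie admission at equal queue
  lengths could reverse it; then both queues are empty and the learner's threshold is positive, so
  the learner admits as well.\<close>

lemma gqueue_le_run: "gqueue_run n \<le> queue_run n"
proof (induction n)
  case 0
  show ?case by (simp add: init_learner_def init_genie_def init_eq init_server_def)
next
  case (Suc n)
  then have le: "gqueue_seen n \<le> queue_seen n" by (simp add: gqueue_seen_eq queue_srv)
  show ?case
  proof (cases "genie_admits (gseen n) \<and> gqueue_seen n = queue_seen n")
    case True
    then have "admits (seen n)" by (auto simp: genie_admits_iff admits_def)
    then show ?thesis using True by (simp add: gqueue_run_Suc queue_run_Suc del: server_seen)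
  next
    case False
    then show ?thesis using le by (auto simp: gqueue_run_Suc queue_run_Suc simp del: server_seen)
  qed
qed

lemma gqueue_le_seen: "gqueue_seen n \<le> queue_seen n"
  using gqueue_le_run[of n] by (simp add: gqueue_seen_eq queue_srv)

lemma in_step_of_queue_eq:
  assumes "\<not> exploring p x y b n" "\<not> overestimating p x y b n" "gqueue_seen n = queue_seen n"
  shows "genie_admits (gseen n) \<longleftrightarrow> admits (seen n)" "gqueue_run (Suc n) = queue_run (Suc n)"
proof -
  show "genie_admits (gseen n) \<longleftrightarrow> admits (seen n)"
    using overestimating_eq[OF assms(1,2)] opt_le assms(3)
    by (cases "genie_opt p") (auto simp: genie_admits_iff admits_def simp del: server_seen)
  then show "gqueue_run (Suc n) = queue_run (Suc n)"
    using assms(3) by (simp add: gqueue_run_Suc queue_run_Suc del: server_seen)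
qed

text \<open>The arrival finds customers, so it does not begin a new batch.\<close>

lemma lagging_of_gap:
  assumes "\<not> exploring p x y b (Suc n)" "\<not> overestimating p x y b (Suc n)"
    "gqueue_seen (Suc n) < queue_seen (Suc n)"
  shows "lagging p x y b n" "departures x y (Suc n) < kstar"
proof -
  have pos: "0 < queue (srv (Suc n))" using assms(3) by simp
  then have same: "seen (Suc n) = (run (Suc n))\<lparr>server_of := srv (Suc n)\<rparr>"
    by (cases rule: seen_cases[of "Suc n"]) auto
  have "\<not> overestimating p x y b n"
    using assms(1,2) same by (cases rule: run_cases[of n]) (auto simp: exploring_def overestimating_def)
  moreover have "gqueue_run (Suc n) < queue_run (Suc n)"
    using assms(3) by (auto simp: gqueue_seen_eq queue_srv)
  ultimately show "lagging p x y b n" by (simp add: lagging_def)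
  show "departures x y (Suc n) < kstar"
    using pos queue_le_of_not_overestimating[OF \<open>\<not> overestimating p x y b n\<close>] by (simp add: queue_srv)
qed

text \<open>Phase 1 of batch \<open>1\<close> is compulsory. Therefore a lag can be charged to
  explorations from the very first arrival on.\<close>

lemma exploring_0: "exploring p x y b 0"
  by (cases rule: seen_cases[of 0]) (auto simp: exploring_def init_learner_def)

text \<open>After \<open>kstar\<close> potential departures both queues would be empty and the
  systems in step again. With exploration as the only source of new lag, this is the recursion to
  which \<open>geometric_domination\<close> is applied.\<close>

lemma lagging_Suc:
  assumes "lagging p x y b (Suc n)" "\<not> exploring p x y b (Suc n)"
  shows "lagging p x y b n \<and> departures x y (Suc n) < kstar"
proof -
  have no: "\<not> overestimating p x y b (Suc n)" using assms by (simp add: lagging_def)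
  have "gqueue_seen (Suc n) \<noteq> queue_seen (Suc n)"
    using in_step_of_queue_eq(2)[OF assms(2) no] assms(1) by (auto simp: lagging_def)
  then have "gqueue_seen (Suc n) < queue_seen (Suc n)"
    using gqueue_le_seen[of "Suc n"] by linarith
  from lagging_of_gap[OF assms(2) no this] show ?thesis by simp
qed

text \<open>Decisions differ because the rules differ or because the queues found differ; in the
  latter case the gap was already present after the previous arrival.\<close>

lemma differ_Suc:
  assumes "genie_admits (gseen (Suc n)) \<noteq> admits (seen (Suc n))"
  shows "exploring p x y b (Suc n) \<or> overestimating p x y b (Suc n) \<or> lagging p x y b n"
  using in_step_of_queue_eq(1)[of "Suc n"] lagging_of_gap(1)[of n] gqueue_le_seen[of "Suc n"] assms
  by (cases "gqueue_seen (Suc n) = queue_seen (Suc n)") auto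

lemma queue_gap_le:
  "queue_run (Suc n) - gqueue_run (Suc n) \<le> kstar * of_bool (lagging p x y b n) +
     max_threshold p (batch (seen n)) * of_bool (overestimating p x y b n)"
  using queue_le_of_not_overestimating[of n] queue_le_of_overestimating[of n]
  by (cases "overestimating p x y b n"; cases "lagging p x y b n") (auto simp: lagging_def)

text \<open>Counting the arrivals still to come in the current phase 1 makes the bound inductive: a
  phase 1 is paid for in full when its trial succeeds. The \<open>1 +\<close> pays for the
  compulsory phase 1 of batch \<open>1\<close>.\<close>

lemma count_exploring:
  "(\<Sum>i<n. of_bool (exploring p x y b i)) + (if exploiting (run n) then 0 else explore_len p - phase_arrivals (run n))
     \<le> explore_len p * (1 + explorations b (batch (run n)))"
proof (induction n)
  case 0
  show ?case by (simp add: init_learner_def)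
next
  case (Suc n)
  have mono: "explorations b (batch (run n)) \<le> explorations b (Suc (batch (run n)))"
    by (simp add: explorations_def)
  have "(\<Sum>i<n. of_bool (exploring p x y b i)) + (if exploiting (seen n) then 0 else explore_len p - phase_arrivals (seen n))
     \<le> explore_len p * (1 + explorations b (batch (seen n)))"
    using Suc
  proof (cases rule: seen_cases[of n])
    case explore
    then have "explorations b (batch (seen n)) = explorations b (batch (run n)) + 1"
      by (simp add: explorations_def)
    then show ?thesis using explore Suc by simp
  next
    case exploit
    have "explore_len p * (1 + explorations b (batch (run n))) \<le> explore_len p * (1 + explorations b (batch (seen n)))"
      using exploit mono by (intro mult_le_mono2) simp
    moreover have "(\<Sum>i<n. of_bool (exploring p x y b i)) \<le> explore_len p * (1 + explorations b (batch (run n)))"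
      using exploit Suc by simp
    ultimately have "(\<Sum>i<n. of_bool (exploring p x y b i)) \<le> explore_len p * (1 + explorations b (batch (seen n)))"
      by (rule le_trans[rotated])
    moreover have "exploiting (seen n)" using exploit by simp
    ultimately show ?thesis by (simp only: if_True add_0_right)
  qed (auto)
  then show ?case
    using inv_seen'[of n] explore_len
    by (cases rule: run_cases[of n]) (auto simp: exploring_def queue_inv_def split: if_splits)
qed

end

section \<open>Batch starts, completed services and overestimating batches\<close>

definition new_batch :: "params \<Rightarrow> (nat \<Rightarrow> real) \<Rightarrow> (nat \<Rightarrow> real) \<Rightarrow> (nat \<Rightarrow> bool) \<Rightarrow> nat \<Rightarrow> nat \<Rightarrow> bool" where
  "new_batch p x y b j n \<longleftrightarrow>
     batch (learner_seen p x y b (Suc n)) = j \<and> batch (learner_run p x y b n) \<noteq> j"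

text \<open>The slack \<open>explore_len\<close> accounts for the services completed during phase 1.\<close>

definition deceptive_start ::
  "params \<Rightarrow> real \<Rightarrow> (nat \<Rightarrow> real) \<Rightarrow> (nat \<Rightarrow> real) \<Rightarrow> (nat \<Rightarrow> bool) \<Rightarrow> nat \<Rightarrow> nat \<Rightarrow> bool" where
  "deceptive_start p th x y b j n \<longleftrightarrow> new_batch p x y b j n \<and>
     total_service (server_of (learner_seen p x y b (Suc n)))
       \<le> th * (real (completed (server_of (learner_seen p x y b (Suc n)))) + real (explore_len p))"

definition over_at :: "params \<Rightarrow> (nat \<Rightarrow> real) \<Rightarrow> (nat \<Rightarrow> real) \<Rightarrow> (nat \<Rightarrow> bool) \<Rightarrow> nat \<Rightarrow> nat \<Rightarrow> nat \<Rightarrow> bool" where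
  "over_at p x y b j a n \<longleftrightarrow> overestimating p x y b n \<and>
     batch (learner_seen p x y b (Suc n)) = j \<and> phase_arrivals (learner_seen p x y b (Suc n)) = a"

text \<open>The waiting part of an overestimating phase 2: its minimal length is over, and only an
  arrival at an empty queue can end it.\<close>

definition overtime :: "params \<Rightarrow> (nat \<Rightarrow> real) \<Rightarrow> (nat \<Rightarrow> real) \<Rightarrow> (nat \<Rightarrow> bool) \<Rightarrow> nat \<Rightarrow> nat \<Rightarrow> bool" where
  "overtime p x y b j n \<longleftrightarrow> overestimating p x y b n \<and>
     batch (learner_seen p x y b (Suc n)) = j \<and>
     batch_len p j \<le> phase_arrivals (learner_seen p x y b (Suc n))"

text \<open>The customer in service is counted in advance, so the count grows as soon as someone
  joins an idle server. At the end of a batch the queue is empty and the count equals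
  \<open>completed\<close>.\<close>

definition busy_count :: "server \<Rightarrow> nat" where
  "busy_count st = completed st + of_bool (0 < queue st)"

context queue_path
begin

lemma srv_conserve: "completed (srv n) + queue (srv n) = completed (server_of (run n)) + queue_run n"
  by (rule serve_completed[OF num_epochs_le])

lemma srv_queue_le: "queue (srv n) \<le> queue_run n"
  by (simp add: queue_srv)

lemma busy_count_srv: "busy_count (server_of (run n)) \<le> busy_count (srv n)"
  using srv_conserve[of n] srv_queue_le[of n] by (auto simp: busy_count_def)

lemma busy_count_join: "busy_count (join_queue t st) = busy_count st + of_bool (queue st = 0)"
  by (auto simp: busy_count_def join_queue_def)

lemma busy_count_joined:
  "busy_count (joined n) = busy_count (srv n) + of_bool (admits (seen n) \<and> queue (srv n) = 0)"
  by (simp add: busy_count_join)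

text \<open>Each unit of \<open>busy_count\<close> is worth two credits: one pays for the trial of
  the current batch, the other is saved, if the current threshold is positive, for the next trial,
  which then has no effect. The alternatives after the disjunctions describe the moment before the
  first arrival of a phase has been handled.\<close>

definition work_inv :: "learner \<Rightarrow> bool" where
  "work_inv s \<longleftrightarrow> 1 \<le> batch s \<and>
    (let w = 2 * busy_count (server_of s); q = queue (server_of s)
     in if exploiting s
        then explorations b (batch s) + of_bool (0 < threshold s) \<le> w \<or>
          q = 0 \<and> phase_arrivals s = 0 \<and> explorations b (batch s) \<le> w
        else explorations b (batch s - 1) + 2 \<le> w \<or>
          phase_arrivals s = 0 \<and> (q = 0 \<and> explorations b (batch s - 1) \<le> w \<or> batch s = 1))"

lemma explorations_Suc: "explorations b (Suc j) = explorations b j + of_bool (b (Suc j))"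
  by (simp add: explorations_def)

lemma work_of_batch_end:
  assumes "work_inv (run n)" "exploiting (run n)" "batch_len p (batch (run n)) \<le> phase_arrivals (run n)"
    "queue (srv n) = 0"
  shows "explorations b (batch (run n)) + of_bool (0 < threshold (run n)) \<le> 2 * completed (srv n)"
proof -
  \<comment> \<open>Phase 2 contains at least one arrival, which excludes the second alternative of
    the invariant.\<close>
  have "0 < phase_arrivals (run n)" using batch_len_pos[of "batch (run n)"] batch_pos(1)[of n] assms by simp
  then have "explorations b (batch (run n)) + of_bool (0 < threshold (run n)) \<le> 2 * busy_count (server_of (run n))"
    using assms by (auto simp: work_inv_def Let_def)
  then show ?thesis using busy_count_srv[of n] assms(4) by (simp add: busy_count_def)
qed

lemma work_inv_seen:
  assumes "work_inv (run n)"
  shows "work_inv (seen n)"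
proof (cases rule: seen_cases[of n])
  case same
  show ?thesis
    using assms busy_count_srv[of n] srv_queue_le[of n] unfolding same(1)
    by (auto simp: work_inv_def Let_def split: if_splits)
next
  case explore
  show ?thesis using work_of_batch_end[OF assms explore(1-3)] explore
    by (auto simp: work_inv_def Let_def busy_count_def)
next
  case exploit
  show ?thesis using work_of_batch_end[OF assms exploit(1-3)] exploit
    by (auto simp: work_inv_def Let_def busy_count_def explorations_Suc)
qed

lemma work_inv_run_Suc:
  assumes "work_inv (seen n)"
  shows "work_inv (run (Suc n))"
proof (cases rule: run_cases[of n])
  case switch
  have "phase_arrivals (seen n) \<noteq> 0" using switch explore_len by simp
  then have "explorations b (batch (seen n) - 1) + 2 \<le> 2 * busy_count (srv n)" "1 \<le> batch (seen n)"
    using assms switch(1) by (auto simp: work_inv_def Let_def)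
  moreover have "explorations b (batch (seen n)) \<le> explorations b (batch (seen n) - 1) + 1"
    using explorations_Suc[of "batch (seen n) - 1"] \<open>1 \<le> batch (seen n)\<close> by simp
  ultimately show ?thesis
    unfolding switch(3) by (auto simp: work_inv_def Let_def busy_count_joined)
next
  case stay
  show ?thesis
  proof (cases "exploiting (seen n)")
    case True
    then show ?thesis
      using assms unfolding stay(2) work_inv_def
      by (auto simp: Let_def busy_count_join admits_def)
  next
    case False
    \<comment> \<open>Batch \<open>1\<close> may start with customers present, and then its first
      admission does not raise \<open>busy_count\<close>. A positive count suffices, as no trial
      precedes this batch.\<close>
    have e0: "explorations b 0 = 0" by (simp add: explorations_def)
    have "0 < busy_count (joined n)" using False by (auto simp: admits_def busy_count_def join_queue_def)
    then show ?thesis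
      using assms False e0 unfolding stay(2) work_inv_def
      by (auto simp: Let_def busy_count_join admits_def)
  qed
qed

lemma work_inv_run: "work_inv (run n)"
proof (induction n)
  case 0
  then show ?case by (simp add: work_inv_def init_learner_def)
qed (rule work_inv_run_Suc[OF work_inv_seen])

text \<open>At a change of batch the server is idle, so that \<open>busy_count\<close> in the
  invariant is the number of completed services; this is where the factor one half between services
  and trials arises.\<close>

lemma new_batch_completed:
  assumes "new_batch p x y b j n"
  shows "explorations b (j - 1) \<le> 2 * completed (srv n)" "queue (srv n) = 0"
proof -
  have "explorations b (j - 1) \<le> 2 * completed (srv n) \<and> queue (srv n) = 0"
  proof (cases rule: seen_cases[of n])
    case same
    then show ?thesis using assms by (simp add: new_batch_def)
  next
    case explore
    then show ?thesis
      using work_of_batch_end[OF work_inv_run explore(1-3)] assms by (auto simp: new_batch_def)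
  next
    case exploit
    then show ?thesis
      using work_of_batch_end[OF work_inv_run exploit(1-3)] assms by (auto simp: new_batch_def)
  qed
  then show "explorations b (j - 1) \<le> 2 * completed (srv n)" "queue (srv n) = 0" by auto
qed

lemma service_start_le: "service_start (server_of (run n)) \<le> epoch x n"
proof (induction n)
  case 0
  show ?case by (simp add: init_learner_def init_server_def)
next
  case (Suc n)
  have "service_start (srv n) \<le> epoch x (Suc n)"
    using x_pos epoch_nonneg[OF x_pos] Suc
    by (intro serve_total_mono(2) y_regular) (auto simp: epoch_Suc less_imp_le)
  then show ?case by (auto simp: server_run_Suc join_queue_def)
qed

lemma total_srv: "total_service (server_of (run n)) \<le> total_service (srv n)"
  using x_pos epoch_nonneg[OF x_pos] service_start_le[of n]
  by (intro serve_total_mono(1) y_regular) (auto simp: epoch_Suc less_imp_le)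

lemma completed_srv: "completed (server_of (run n)) \<le> completed (srv n)"
  using srv_conserve[of n] srv_queue_le[of n] by linarith

text \<open>Traces an arrival of phase 1 back to the start \<open>m\<close> of its batch. Needed
  because the threshold is computed at the end of phase 1, whereas the martingale is stopped at the
  start of the batch.\<close>

lemma exploration_start:
  assumes "\<not> exploiting (seen n)" "batch (seen n) = j" "1 < j"
  shows "\<exists>m. m + phase_arrivals (seen n) = n \<and> new_batch p x y b j m \<and>
    total_service (srv m) \<le> total_service (srv n) \<and> completed (srv m) \<le> completed (srv n) \<and>
    completed (srv n) + queue (srv n) \<le> completed (srv m) + phase_arrivals (seen n)"
  using assms
proof (induction n)
  case 0
  then show ?case by (cases rule: seen_cases[of 0]) (auto simp: init_learner_def)
next
  case (Suc n)
  show ?case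
  proof (cases rule: seen_cases[of "Suc n"])
    case same
    then have r: "\<not> exploiting (run (Suc n))" "batch (run (Suc n)) = j" "1 < j"
      and pa: "phase_arrivals (seen (Suc n)) = phase_arrivals (run (Suc n))" using Suc.prems by auto
    show ?thesis
    proof (cases rule: run_cases[of n])
      case switch
      then show ?thesis using r by simp
    next
      case stay
      have "\<not> exploiting (seen n)" "batch (seen n) = j" using r stay by auto
      from Suc.IH[OF this r(3)] obtain m where m: "m + phase_arrivals (seen n) = n" "new_batch p x y b j m"
        "total_service (srv m) \<le> total_service (srv n)" "completed (srv m) \<le> completed (srv n)"
        "completed (srv n) + queue (srv n) \<le> completed (srv m) + phase_arrivals (seen n)" by blast
      have "total_service (srv n) \<le> total_service (srv (Suc n))"
        using total_srv[of "Suc n"] by (simp add: server_run_Suc join_queue_def split: if_splits)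
      moreover have "completed (srv n) \<le> completed (srv (Suc n))"
        using completed_srv[of "Suc n"] by (simp add: server_run_Suc join_queue_def split: if_splits)
      moreover have "completed (srv (Suc n)) + queue (srv (Suc n)) \<le> completed (srv n) + queue (srv n) + 1"
        using srv_conserve[of "Suc n"] by (simp add: server_run_Suc join_queue_def split: if_splits)
      moreover have "phase_arrivals (seen (Suc n)) = phase_arrivals (seen n) + 1"
        unfolding pa stay(2) by simp
      ultimately show ?thesis using m by (intro exI[of _ m]) auto
    qed
  next
    case explore
    then show ?thesis using Suc.prems
      by (intro exI[of _ "Suc n"]) (auto simp: new_batch_def)
  next
    case exploit
    then show ?thesis using Suc.prems by simp
  qed
qed

text \<open>The threshold is computed at the first arrival of the batch or, after a phase 1,
  \<open>explore_len p\<close> arrivals later. In the second case the small empirical mean is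
  carried back to the start: the total service time can only have grown, and the services added in
  phase 1 are covered by the slack.\<close>

lemma over_at_0_imp_deceptive_start:
  assumes "over_at p x y b j 0 n" "1 < j" "b 1" "0 < th"
    and th: "\<And>m v. genie_opt p < crit_threshold (reward p) (hold_cost p) (1 / m) (1 / v) \<Longrightarrow> m \<le> th"
  shows "\<exists>m. (m = n \<or> m + explore_len p = n) \<and> deceptive_start p th x y b j m"
proof -
  have a: "exploiting (seen n)" "genie_opt p < threshold (seen n)" "batch (seen n) = j" "phase_arrivals (seen n) = 0"
    using assms(1) by (auto simp: over_at_def overestimating_def)
  have short: "total_service st \<le> th * real (completed st)"
    if "genie_opt p < learned_threshold p x j i st" "completed st \<noteq> 0" for i st
  proof -
    have "total_service st / real (completed st) \<le> th"
      by (rule th[of _ "(\<Sum>k<i. x k) / real i"])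
        (use that in \<open>auto simp: learned_threshold_def Let_def\<close>)
    then show ?thesis using that(2) by (simp add: divide_le_eq)
  qed
  \<comment> \<open>The trial of batch \<open>1\<close> succeeds, so at least one service is
    complete when batch \<open>j\<close> starts, and the fallback value is not in use.\<close>
  have comp: "completed (srv m) \<noteq> 0" if "new_batch p x y b j m" for m
  proof -
    have "1 \<in> {1..j - 1}" using assms(2) by auto
    then have "of_bool (b 1) \<le> explorations b (j - 1)"
      unfolding explorations_def by (intro member_le_sum) auto
    then show ?thesis using new_batch_completed(1)[OF that] assms(3) by auto
  qed
  show ?thesis
  proof (cases rule: seen_cases[of n])
    case same
    then have r: "exploiting (run n)" "phase_arrivals (run n) = 0" "threshold (run n) = threshold (seen n)"
      "batch (run n) = j" using a by auto
    then obtain n' where n: "n = Suc n'" by (cases n) (auto simp: init_learner_def)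
    show ?thesis
    proof (cases rule: run_cases[of n'])
      case switch
      have pa: "phase_arrivals (seen n') + 1 = explore_len p"
        using switch(1,2) inv_seen'[of n'] by (auto simp: queue_inv_def)
      have "batch (seen n') = j" using r(4) unfolding n switch(3) by simp
      from exploration_start[OF switch(1) this assms(2)] obtain m where m:
        "m + phase_arrivals (seen n') = n'" "new_batch p x y b j m"
        "total_service (srv m) \<le> total_service (srv n')" "completed (srv m) \<le> completed (srv n')"
        "completed (srv n') + queue (srv n') \<le> completed (srv m) + phase_arrivals (seen n')" by blast
      have j: "total_service (joined n') = total_service (srv n')" "completed (joined n') = completed (srv n')"
        by (auto simp: join_queue_def)
      have "total_service (joined n') \<le> th * real (completed (joined n'))"
      proof (rule short)
        show "genie_opt p < learned_threshold p x j (Suc n') (joined n')"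
          using a(2) r(3,4) unfolding n switch(3) by simp
        show "completed (joined n') \<noteq> 0" using comp[OF m(2)] m(4) j by simp
      qed
      then have "total_service (srv m) \<le> th * real (completed (srv n'))" using m(3) j by simp
      also have "\<dots> \<le> th * (real (completed (srv m)) + real (explore_len p))"
        using m(5) pa assms(4) by (intro mult_left_mono) linarith+
      finally show ?thesis using m(1,2) pa n
        by (intro exI[of _ m]) (auto simp: deceptive_start_def)
    next
      case stay
      then show ?thesis using r n by simp
    qed
  next
    case explore
    then show ?thesis using a by simp
  next
    case exploit
    have nb: "new_batch p x y b j n" using exploit a by (auto simp: new_batch_def)
    have "total_service (srv n) \<le> th * real (completed (srv n))"
    proof (rule short)
      show "genie_opt p < learned_threshold p x j (Suc n) (srv n)"
        using a(2,3) unfolding exploit(5) by simp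
      show "completed (srv n) \<noteq> 0" by (rule comp[OF nb])
    qed
    also have "\<dots> \<le> th * (real (completed (srv n)) + real (explore_len p))"
      using assms(4) by (intro mult_left_mono) auto
    finally show ?thesis using nb by (intro exI[of _ n]) (auto simp: deceptive_start_def)
  qed
qed

text \<open>A deceptive start at \<open>m\<close> is charged at most twice: for a phase 2 that
  begins at \<open>m\<close>, and for one that begins \<open>explore_len p\<close> arrivals
  later.\<close>

lemma sum_over_at_0_le:
  assumes "1 < j" "b 1" "0 < th"
    and "\<And>m v. genie_opt p < crit_threshold (reward p) (hold_cost p) (1 / m) (1 / v) \<Longrightarrow> m \<le> th"
  shows "(\<Sum>n<N. of_bool (over_at p x y b j 0 n)) \<le> 2 * (\<Sum>n<N. of_bool (deceptive_start p th x y b j n) :: nat)"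
proof -
  let ?f = "\<lambda>n. of_bool (deceptive_start p th x y b j n) :: nat"
  let ?l = "explore_len p"
  have "(\<Sum>n<N. of_bool (over_at p x y b j 0 n)) \<le> (\<Sum>n<N. ?f n + (if ?l \<le> n then ?f (n - ?l) else 0))"
  proof (rule sum_mono)
    fix n
    show "of_bool (over_at p x y b j 0 n) \<le> ?f n + (if ?l \<le> n then ?f (n - ?l) else 0)"
      using over_at_0_imp_deceptive_start[OF _ assms(1-4), of n]
      by (cases "over_at p x y b j 0 n") fastforce+
  qed
  also have "\<dots> = (\<Sum>n<N. ?f n) + (\<Sum>n\<in>{n\<in>{..<N}. ?l \<le> n}. ?f (n - ?l))"
    by (simp only: sum.distrib sum.inter_filter finite_lessThan)
  also have "(\<Sum>n\<in>{n\<in>{..<N}. ?l \<le> n}. ?f (n - ?l)) = (\<Sum>n\<in>(\<lambda>n. n - ?l) ` {n\<in>{..<N}. ?l \<le> n}. ?f n)"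
    by (subst sum.reindex) (auto simp: inj_on_def)
  also have "\<dots> \<le> (\<Sum>n<N. ?f n)"
    by (rule sum_mono2) auto
  finally show ?thesis by simp
qed

lemma first_batch_phase_arrivals:
  "batch (run n) = 1 \<Longrightarrow> phase_arrivals (run n) + (if exploiting (run n) then explore_len p else 0) = n"
proof (induction n)
  case 0
  then show ?case by (simp add: init_learner_def)
next
  case (Suc n)
  then have "batch (seen n) = 1" by (simp add: batch_run_Suc)
  then have "batch (run n) = 1" "seen n = (run n)\<lparr>server_of := srv n\<rparr>"
    using batch_pos(1)[of n] by (cases rule: seen_cases[of n]; auto)+
  then have "phase_arrivals (seen n) + (if exploiting (seen n) then explore_len p else 0) = n"
    using Suc.IH by simp
  then show ?case
    using inv_seen'[of n] by (cases rule: run_cases[of n]) (auto simp: queue_inv_def split: if_splits)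
qed

text \<open>The threshold of batch \<open>1\<close> may be a fallback value, from which nothing can
  be inferred about service times. Its phase 2 begins at arrival \<open>explore_len p\<close> and
  nowhere else, hence the bound \<open>1\<close>.\<close>

lemma sum_over_at_0_first: "(\<Sum>n<N. of_bool (over_at p x y b 1 0 n)) \<le> (1::nat)"
proof -
  have "n = explore_len p" if "over_at p x y b 1 0 n" for n
  proof -
    have a: "exploiting (seen n)" "batch (seen n) = 1" "phase_arrivals (seen n) = 0"
      using that by (auto simp: over_at_def overestimating_def)
    then have "batch (run n) = 1" "seen n = (run n)\<lparr>server_of := srv n\<rparr>"
      using batch_pos(1)[of n] by (cases rule: seen_cases[of n]; auto)+
    then show ?thesis using first_batch_phase_arrivals[of n] a by simp
  qed
  then have "(\<Sum>n<N. of_bool (over_at p x y b 1 0 n)) \<le> (\<Sum>n<N. of_bool (n = explore_len p) :: nat)"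
    by (intro sum_mono) auto
  also have "\<dots> \<le> 1" by (simp add: card_le_Suc0_iff_eq)
  finally show ?thesis .
qed

lemma over_at_Suc:
  assumes "over_at p x y b j (Suc a) n"
  shows "\<exists>n'. n = Suc n' \<and> over_at p x y b j a n'"
proof -
  have a: "exploiting (seen n)" "genie_opt p < threshold (seen n)" "batch (seen n) = j"
    "phase_arrivals (seen n) = Suc a"
    using assms by (auto simp: over_at_def overestimating_def)
  then have "seen n = (run n)\<lparr>server_of := srv n\<rparr>" by (cases rule: seen_cases[of n]) auto
  then have r: "exploiting (run n)" "genie_opt p < threshold (run n)" "batch (run n) = j"
    "phase_arrivals (run n) = Suc a" using a by auto
  then obtain n' where n: "n = Suc n'" by (cases n) (auto simp: init_learner_def)
  have "over_at p x y b j a n'"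
    using r unfolding n over_at_def overestimating_def by (cases rule: run_cases[of n']) auto
  then show ?thesis using n by blast
qed

text \<open>Position \<open>Suc a\<close> of a phase is occupied by the arrival directly after the
  one at position \<open>a\<close>, so the count cannot increase with the position.\<close>

lemma sum_over_at_le:
  "(\<Sum>n<N. of_bool (over_at p x y b j a n)) \<le> (\<Sum>n<N. of_bool (over_at p x y b j 0 n) :: nat)"
proof (induction a)
  case (Suc a)
  have "(\<Sum>n<N. of_bool (over_at p x y b j (Suc a) n)) \<le> (\<Sum>n<N. of_bool (over_at p x y b j a n) :: nat)"
  proof (cases N)
    case (Suc N')
    have 0: "\<not> over_at p x y b j (Suc a) 0" using over_at_Suc by blast
    have "(\<Sum>n<N. of_bool (over_at p x y b j (Suc a) n)) = (\<Sum>n<N'. of_bool (over_at p x y b j (Suc a) (Suc n)) :: nat)"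
      unfolding Suc sum.lessThan_Suc_shift using 0 by simp
    also have "\<dots> \<le> (\<Sum>n<N'. of_bool (over_at p x y b j a n))"
      using over_at_Suc by (intro sum_mono) auto
    also have "\<dots> \<le> (\<Sum>n<N. of_bool (over_at p x y b j a n))"
      unfolding Suc by simp
    finally show ?thesis .
  qed simp
  then show ?case using Suc by linarith
qed simp

text \<open>Waiting goes on only if the queue, at most \<open>max_threshold p j\<close>, is not
  emptied before the next arrival. This is the analogue of \<open>lagging_Suc\<close>, with the
  first arrival beyond the minimal length as source.\<close>

lemma overtime_Suc:
  assumes "overtime p x y b j (Suc n)"
  shows "over_at p x y b j (batch_len p j) (Suc n) \<or>
    overtime p x y b j n \<and> departures x y (Suc n) < max_threshold p j"
proof (cases "phase_arrivals (seen (Suc n)) = batch_len p j")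
  case True
  then show ?thesis using assms by (auto simp: over_at_def overtime_def)
next
  case False
  have a: "exploiting (seen (Suc n))" "genie_opt p < threshold (seen (Suc n))" "batch (seen (Suc n)) = j"
    "batch_len p j < phase_arrivals (seen (Suc n))"
    using assms False by (auto simp: overtime_def overestimating_def)
  then have s: "seen (Suc n) = (run (Suc n))\<lparr>server_of := srv (Suc n)\<rparr>" "0 < queue (srv (Suc n))"
    by (cases rule: seen_cases[of "Suc n"]; auto)+
  then have r: "exploiting (run (Suc n))" "genie_opt p < threshold (run (Suc n))" "batch (run (Suc n)) = j"
    "batch_len p j < phase_arrivals (run (Suc n))" using a by auto
  have o: "overtime p x y b j n"
    using r unfolding overtime_def overestimating_def by (cases rule: run_cases[of n]) auto
  then have "queue_run (Suc n) \<le> max_threshold p j"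
    using queue_le_of_overestimating[of n] by (auto simp: overtime_def)
  then have "departures x y (Suc n) < max_threshold p j" using s(2) by (simp add: queue_srv)
  then show ?thesis using o by simp
qed

lemma not_overtime_0: "\<not> overtime p x y b j 0"
  using exploring_0 by (auto simp: overtime_def overestimating_def exploring_def)

text \<open>Splits an overestimating phase 2 into its guaranteed arrivals, each no more frequent
  than the first one, and the wait for an empty queue.\<close>

lemma sum_overestimating_le:
  "(\<Sum>n<N. of_bool (overestimating p x y b n \<and> batch (seen n) = j)) \<le>
     batch_len p j * (\<Sum>n<N. of_bool (over_at p x y b j 0 n)) + (\<Sum>n<N. of_bool (overtime p x y b j n) :: nat)"
proof -
  have "(\<Sum>n<N. of_bool (overestimating p x y b n \<and> batch (seen n) = j)) \<le>
    (\<Sum>n<N. (\<Sum>a<batch_len p j. of_bool (over_at p x y b j a n)) + of_bool (overtime p x y b j n) :: nat)"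
  proof (rule sum_mono)
    fix n
    show "of_bool (overestimating p x y b n \<and> batch (seen n) = j) \<le>
      (\<Sum>a<batch_len p j. of_bool (over_at p x y b j a n)) + (of_bool (overtime p x y b j n) :: nat)"
    proof (cases "overestimating p x y b n \<and> batch (seen n) = j \<and> \<not> overtime p x y b j n")
      case True
      then have "phase_arrivals (seen n) \<in> {..<batch_len p j}"
        "over_at p x y b j (phase_arrivals (seen n)) n" by (auto simp: overtime_def over_at_def)
      then have "1 \<le> (\<Sum>a<batch_len p j. of_bool (over_at p x y b j a n) :: nat)"
        using member_le_sum[of "phase_arrivals (seen n)" "{..<batch_len p j}" "\<lambda>a. of_bool (over_at p x y b j a n) :: nat"]
        by simp
      then show ?thesis using True by simp
    qed (auto simp: overtime_def)
  qed
  also have "\<dots> = (\<Sum>a<batch_len p j. \<Sum>n<N. of_bool (over_at p x y b j a n)) + (\<Sum>n<N. of_bool (overtime p x y b j n))"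
    unfolding sum.distrib by (subst sum.swap) simp
  also have "(\<Sum>a<batch_len p j. \<Sum>n<N. of_bool (over_at p x y b j a n)) \<le>
      (\<Sum>a<batch_len p j. \<Sum>n<N. of_bool (over_at p x y b j 0 n) :: nat)"
    by (intro sum_mono sum_over_at_le)
  finally show ?thesis by simp
qed

lemma overestimating_split:
  fixes f :: "nat \<Rightarrow> real"
  assumes "n < N"
  shows "f (batch (seen n)) * of_bool (overestimating p x y b n) =
      (\<Sum>j=1..Suc N. f j * of_bool (overestimating p x y b n \<and> batch (seen n) = j))"
proof -
  \<comment> \<open>Batch numbers start at \<open>1\<close> and grow by at most one per arrival,
    which gives the range of the sum.\<close>
  have "batch (seen n) \<in> {1..Suc N}"
    using batch_pos(2)[of n] batch_le[of "Suc n"] assms by (simp add: batch_run_Suc)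
  then show ?thesis
    by (subst sum.remove[of _ "batch (seen n)"]) (auto intro!: sum.neutral)
qed

end

section \<open>Measurability\<close>

lemma pred_less_nat [measurable (raw)]:
  fixes f g :: "'w \<Rightarrow> nat"
  assumes "f \<in> measurable N (count_space UNIV)" "g \<in> measurable N (count_space UNIV)"
  shows "Measurable.pred N (\<lambda>\<omega>. f \<omega> < g \<omega>)"
  by (rule measurable_compose_countable[where f="\<lambda>i \<omega>. i < g \<omega>" and g=f])
    (use assms in \<open>auto intro: measurable_compose[OF assms(2)]\<close>)

text \<open>Records carry no sigma-algebra, so measurability is stated field by field and updates
  reduce to functions with values in \<open>real\<close> and \<open>nat\<close>.\<close>

definition measurable_server :: "'w measure \<Rightarrow> ('w \<Rightarrow> server) \<Rightarrow> bool" where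
  "measurable_server N st \<longleftrightarrow>
     (\<lambda>\<omega>. queue (st \<omega>)) \<in> measurable N (count_space UNIV) \<and>
     (\<lambda>\<omega>. completed (st \<omega>)) \<in> measurable N (count_space UNIV) \<and>
     (\<lambda>\<omega>. total_service (st \<omega>)) \<in> borel_measurable N \<and>
     (\<lambda>\<omega>. service_start (st \<omega>)) \<in> borel_measurable N"

definition measurable_learner :: "'w measure \<Rightarrow> ('w \<Rightarrow> learner) \<Rightarrow> bool" where
  "measurable_learner N s \<longleftrightarrow>
     measurable_server N (\<lambda>\<omega>. server_of (s \<omega>)) \<and>
     (\<lambda>\<omega>. batch (s \<omega>)) \<in> measurable N (count_space UNIV) \<and>
     Measurable.pred N (\<lambda>\<omega>. exploiting (s \<omega>)) \<and>
     (\<lambda>\<omega>. phase_arrivals (s \<omega>)) \<in> measurable N (count_space UNIV) \<and>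
     (\<lambda>\<omega>. threshold (s \<omega>)) \<in> measurable N (count_space UNIV)"

lemma measurable_serverD [measurable_dest]:
  assumes "measurable_server N st"
  shows "(\<lambda>\<omega>. queue (st \<omega>)) \<in> measurable N (count_space UNIV)"
    "(\<lambda>\<omega>. completed (st \<omega>)) \<in> measurable N (count_space UNIV)"
    "(\<lambda>\<omega>. total_service (st \<omega>)) \<in> borel_measurable N"
    "(\<lambda>\<omega>. service_start (st \<omega>)) \<in> borel_measurable N"
  using assms by (simp_all add: measurable_server_def)

lemma measurable_learnerD:
  assumes "measurable_learner N s"
  shows "measurable_server N (\<lambda>\<omega>. server_of (s \<omega>))"
    "(\<lambda>\<omega>. batch (s \<omega>)) \<in> measurable N (count_space UNIV)"
    "Measurable.pred N (\<lambda>\<omega>. exploiting (s \<omega>))"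
    "(\<lambda>\<omega>. phase_arrivals (s \<omega>)) \<in> measurable N (count_space UNIV)"
    "(\<lambda>\<omega>. threshold (s \<omega>)) \<in> measurable N (count_space UNIV)"
  using assms by (simp_all add: measurable_learner_def)

lemma measurable_server_If:
  assumes "Measurable.pred N P" "measurable_server N f" "measurable_server N g"
  shows "measurable_server N (\<lambda>\<omega>. if P \<omega> then f \<omega> else g \<omega>)"
proof -
  note [measurable] = assms(1) measurable_serverD[OF assms(2)] measurable_serverD[OF assms(3)]
  show ?thesis
    unfolding measurable_server_def if_distrib[where f=queue] if_distrib[where f=completed]
      if_distrib[where f=total_service] if_distrib[where f=service_start]
    by (intro conjI; measurable)
qed

lemma measurable_learner_If:
  assumes "Measurable.pred N P" "measurable_learner N f" "measurable_learner N g"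
  shows "measurable_learner N (\<lambda>\<omega>. if P \<omega> then f \<omega> else g \<omega>)"
proof -
  note [measurable] = assms(1) measurable_learnerD(2-)[OF assms(2)] measurable_learnerD(2-)[OF assms(3)]
  note s = measurable_server_If[OF assms(1) measurable_learnerD(1)[OF assms(2)] measurable_learnerD(1)[OF assms(3)]]
  show ?thesis
    unfolding measurable_learner_def if_distrib[where f=batch] if_distrib[where f=exploiting]
      if_distrib[where f=phase_arrivals] if_distrib[where f=threshold] if_distrib[where f=server_of]
    by (intro conjI s; measurable)
qed

lemma measurable_server_compose:
  fixes k :: "'w \<Rightarrow> nat"
  assumes "k \<in> measurable N (count_space UNIV)" "\<And>i. measurable_server N (f i)"
  shows "measurable_server N (\<lambda>\<omega>. f (k \<omega>) \<omega>)"
proof -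
  note m = measurable_serverD[OF assms(2)]
  show ?thesis
    unfolding measurable_server_def
    by (intro conjI measurable_compose_countable[where g=k, OF m(1)] measurable_compose_countable[where g=k, OF m(2)]
      measurable_compose_countable[where g=k, OF m(3)] measurable_compose_countable[where g=k, OF m(4)] assms(1))
qed

lemma measurable_potential_departure:
  assumes [measurable]: "s \<in> borel_measurable N" and st: "measurable_server N st"
  shows "measurable_server N (\<lambda>\<omega>. potential_departure (s \<omega>) (st \<omega>))"
  unfolding potential_departure_def
proof (rule measurable_server_If)
  note [measurable] = measurable_serverD[OF st]
  show "Measurable.pred N (\<lambda>\<omega>. queue (st \<omega>) = 0)" by measurable
  show "measurable_server N st" by fact
  show "measurable_server N (\<lambda>\<omega>. st \<omega>\<lparr>queue := queue (st \<omega>) - 1, completed := completed (st \<omega>) + 1,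
      total_service := total_service (st \<omega>) + (s \<omega> - service_start (st \<omega>)), service_start := s \<omega>\<rparr>)"
    unfolding measurable_server_def by (intro conjI; simp; measurable)
qed

lemma measurable_join_queue:
  assumes [measurable]: "s \<in> borel_measurable N" and st: "measurable_server N st"
  shows "measurable_server N (\<lambda>\<omega>. join_queue (s \<omega>) (st \<omega>))"
proof -
  note [measurable] = measurable_serverD[OF st]
  show ?thesis unfolding join_queue_def measurable_server_def by (intro conjI; simp; measurable)
qed

lemma measurable_epoch:
  assumes [measurable]: "\<And>n. (\<lambda>\<omega>. x \<omega> n) \<in> borel_measurable N"
  shows "(\<lambda>\<omega>. epoch (x \<omega>) n) \<in> borel_measurable N"
  unfolding epoch_def by measurable

lemma measurable_num_epochs:
  assumes x: "\<And>n. (\<lambda>\<omega>. x \<omega> n) \<in> borel_measurable N" and [measurable]: "t \<in> borel_measurable N"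
  shows "(\<lambda>\<omega>. num_epochs (x \<omega>) (t \<omega>)) \<in> measurable N (count_space UNIV)"
proof -
  note [measurable] = measurable_epoch[OF x]
  show ?thesis unfolding num_epochs_def by measurable
qed

lemma measurable_serve:
  assumes y: "\<And>n. (\<lambda>\<omega>. y \<omega> n) \<in> borel_measurable N"
    and s: "s \<in> borel_measurable N" and t: "t \<in> borel_measurable N" and st: "measurable_server N st"
  shows "measurable_server N (\<lambda>\<omega>. serve (y \<omega>) (s \<omega>) (t \<omega>) (st \<omega>))"
proof -
  have "measurable_server N (\<lambda>\<omega>. fold (\<lambda>k. potential_departure (epoch (y \<omega>) k)) ks (st \<omega>))" for ks
    using st
  proof (induction ks arbitrary: st)
    case (Cons k ks)
    show ?case
      unfolding fold.simps comp_def
      by (rule Cons.IH) (intro measurable_potential_departure measurable_epoch y Cons.prems)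
  qed simp
  then show ?thesis
    unfolding serve_def
    by (intro measurable_server_compose[where k="\<lambda>\<omega>. num_epochs (y \<omega>) (s \<omega>)" and
          f="\<lambda>a \<omega>. fold (\<lambda>k. potential_departure (epoch (y \<omega>) k)) [Suc a..<Suc (num_epochs (y \<omega>) (t \<omega>))] (st \<omega>)"]
        measurable_server_compose[where k="\<lambda>\<omega>. num_epochs (y \<omega>) (t \<omega>)" and
          f="\<lambda>c \<omega>. fold (\<lambda>k. potential_departure (epoch (y \<omega>) k)) [Suc a..<Suc c] (st \<omega>)" for a]
        measurable_num_epochs y s t)
qed

lemma measurable_queue_at:
  assumes x: "\<And>n. (\<lambda>\<omega>. x \<omega> n) \<in> borel_measurable N"
    and y: "\<And>n. (\<lambda>\<omega>. y \<omega> n) \<in> borel_measurable N"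
    and run: "\<And>i. measurable_server N (\<lambda>\<omega>. run \<omega> i)" and t: "t \<in> borel_measurable N"
  shows "(\<lambda>\<omega>. queue_at (x \<omega>) (y \<omega>) (run \<omega>) (t \<omega>)) \<in> measurable N (count_space UNIV)"
  unfolding queue_at_def Let_def
  by (intro measurable_serverD(1) measurable_server_compose[where k="\<lambda>\<omega>. num_epochs (x \<omega>) (t \<omega>)" and
    f="\<lambda>i \<omega>. serve (y \<omega>) (epoch (x \<omega>) i) (t \<omega>) (run \<omega> i)"] measurable_num_epochs x measurable_serve y
    measurable_epoch run t)

lemma measurable_server_const: "measurable_server N (\<lambda>_. st)"
  by (simp add: measurable_server_def)

text \<open>Instantiated twice: with the inputs as random variables on \<open>M\<close>, and with
  the coordinates of the product of their laws, where \<open>one_step\<close> asks for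
  measurability.\<close>

locale measurable_paths =
  fixes p :: params and N :: "'w measure" and x y :: "'w \<Rightarrow> nat \<Rightarrow> real" and b :: "'w \<Rightarrow> nat \<Rightarrow> bool"
  assumes x [measurable]: "\<And>n. (\<lambda>\<omega>. x \<omega> n) \<in> borel_measurable N"
    and y [measurable]: "\<And>n. (\<lambda>\<omega>. y \<omega> n) \<in> borel_measurable N"
    and b [measurable]: "\<And>n. Measurable.pred N (\<lambda>\<omega>. b \<omega> n)"
    and ratio_nonneg: "0 \<le> reward p / hold_cost p"
    and fallback_measurable:
      "\<And>j. 1 \<le> j \<Longrightarrow> fallback p j \<in> measurable (\<Pi>\<^sub>M k\<in>UNIV. borel) (count_space UNIV)"
begin

lemmas epoch_x [measurable] = measurable_epoch[OF x]

lemma measurable_learned_threshold: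
  assumes j: "j \<in> measurable N (count_space UNIV)" "\<And>\<omega>. 1 \<le> j \<omega>" and st: "measurable_server N st"
  shows "(\<lambda>\<omega>. learned_threshold p (x \<omega>) (j \<omega>) i (st \<omega>)) \<in> measurable N (count_space UNIV)"
proof -
  note [measurable] = measurable_serverD[OF st]
  have 1: "(\<lambda>\<omega>. fallback p (Suc k) (\<lambda>k. if k < i then x \<omega> k else 0)) \<in> measurable N (count_space UNIV)" for k
    by (rule measurable_compose[OF _ fallback_measurable]) (auto intro!: measurable_PiM_single')
  have [measurable]: "(\<lambda>\<omega>. crit_threshold (reward p) (hold_cost p) (1 / (total_service (st \<omega>) / real (completed (st \<omega>))))
      (1 / ((\<Sum>k<i. x \<omega> k) / real i))) \<in> measurable N (count_space UNIV)"
    by (intro measurable_crit_threshold ratio_nonneg) measurable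
  note [measurable] = 1
  have 2: "(\<lambda>\<omega>. learned_threshold p (x \<omega>) (Suc k) i (st \<omega>)) \<in> measurable N (count_space UNIV)" for k
    unfolding learned_threshold_def Let_def by measurable
  \<comment> \<open>The fallback is known to be measurable only for batches from \<open>1\<close>
    on, so the countable case distinction runs over the predecessor of the batch number.\<close>
  have "(\<lambda>\<omega>. learned_threshold p (x \<omega>) (Suc (j \<omega> - 1)) i (st \<omega>)) \<in> measurable N (count_space UNIV)"
    by (rule measurable_compose_countable[where g="\<lambda>\<omega>. j \<omega> - 1", OF 2]) (use j in measurable)
  moreover have "Suc (j \<omega> - 1) = j \<omega>" for \<omega> using j(2)[of \<omega>] by simp
  ultimately show ?thesis by simp
qed

lemma measurable_learner_update:
  assumes "measurable_learner N s" "measurable_server N st"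
  shows "measurable_learner N (\<lambda>\<omega>. (s \<omega>)\<lparr>server_of := st \<omega>\<rparr>)"
  using assms by (simp add: measurable_learner_def)

lemma batch_before_arrival: "1 \<le> batch s \<Longrightarrow> 1 \<le> batch (before_arrival p xs ys bs i s)"
  by (simp add: before_arrival_def Let_def)

lemma batch_handle_arrival: "batch (handle_arrival p xs i s) = batch s"
  by (simp add: handle_arrival_def Let_def)

lemma measurable_before_arrival:
  assumes s: "measurable_learner N s"
  shows "measurable_learner N (\<lambda>\<omega>. before_arrival p (x \<omega>) (y \<omega>) (b \<omega>) i (s \<omega>))"
proof -
  note [measurable] = measurable_learnerD(2-)[OF s]
  have st: "measurable_server N (\<lambda>\<omega>. serve (y \<omega>) (epoch (x \<omega>) (i - 1)) (epoch (x \<omega>) i) (server_of (s \<omega>)))"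
    by (intro measurable_serve y epoch_x measurable_learnerD[OF s])
  note [measurable] = measurable_serverD[OF st]
  have bb: "Measurable.pred N (\<lambda>\<omega>. b \<omega> (batch (s \<omega>) + 1))"
    by (rule measurable_compose_countable[where f="\<lambda>i \<omega>. b \<omega> (i + 1)"]) measurable
  have len: "(\<lambda>\<omega>. nat \<lceil>growth p (batch (s \<omega>)) * real (exploit_len p)\<rceil>) \<in> measurable N (count_space UNIV)"
    by (rule measurable_compose_countable[where f="\<lambda>i \<omega>. nat \<lceil>growth p i * real (exploit_len p)\<rceil>"]) measurable
  note [measurable] = bb len
  note [measurable] = measurable_learned_threshold[OF _ _ st, of "\<lambda>\<omega>. batch (s \<omega>) + 1" i, simplified]
  show ?thesis
    unfolding before_arrival_def Let_def
  proof (intro measurable_learner_If measurable_learner_update s st)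
    show "measurable_learner N (\<lambda>\<omega>. \<lparr>server_of = serve (y \<omega>) (epoch (x \<omega>) (i - 1)) (epoch (x \<omega>) i) (server_of (s \<omega>)),
        batch = batch (s \<omega>) + 1, exploiting = False, phase_arrivals = 0, threshold = 0\<rparr>)"
      unfolding measurable_learner_def by (intro conjI; simp add: st[simplified]; measurable)
    show "measurable_learner N (\<lambda>\<omega>. \<lparr>server_of = serve (y \<omega>) (epoch (x \<omega>) (i - 1)) (epoch (x \<omega>) i) (server_of (s \<omega>)),
        batch = batch (s \<omega>) + 1, exploiting = True, phase_arrivals = 0,
        threshold = learned_threshold p (x \<omega>) (batch (s \<omega>) + 1) i
          (serve (y \<omega>) (epoch (x \<omega>) (i - 1)) (epoch (x \<omega>) i) (server_of (s \<omega>)))\<rparr>)"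
      unfolding measurable_learner_def by (intro conjI; simp add: st[simplified]; measurable)
    show "Measurable.pred N (\<lambda>\<omega>. exploiting (s \<omega>) \<and>
        nat \<lceil>growth p (batch (s \<omega>)) * real (exploit_len p)\<rceil> \<le> phase_arrivals (s \<omega>) \<and>
        queue (serve (y \<omega>) (epoch (x \<omega>) (i - 1)) (epoch (x \<omega>) i) (server_of (s \<omega>))) = 0)"
    proof (intro pred_intros_logic)
      show "Measurable.pred N (\<lambda>\<omega>. exploiting (s \<omega>))" by measurable
      show "Measurable.pred N (\<lambda>\<omega>. nat \<lceil>growth p (batch (s \<omega>)) * real (exploit_len p)\<rceil> \<le> phase_arrivals (s \<omega>))"
        unfolding not_less[symmetric] by (intro pred_intros_logic pred_less_nat len measurable_learnerD(4)[OF s])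
      show "Measurable.pred N (\<lambda>\<omega>. queue (serve (y \<omega>) (epoch (x \<omega>) (i - 1)) (epoch (x \<omega>) i) (server_of (s \<omega>))) = 0)"
        by (rule measurable_compose[OF measurable_serverD(1)[OF st], of "\<lambda>q. q = 0"]) simp
    qed
    show "Measurable.pred N (\<lambda>\<omega>. threshold (s \<omega>) = 0 \<and> b \<omega> (batch (s \<omega>) + 1))"
      using bb by measurable
  qed
qed

lemma measurable_admits:
  assumes s: "measurable_learner N s"
  shows "Measurable.pred N (\<lambda>\<omega>. admits (s \<omega>))"
proof -
  note [measurable] = measurable_learnerD[OF s] measurable_serverD[OF measurable_learnerD(1)[OF s]]
  show ?thesis unfolding admits_def by measurable
qed

lemma measurable_handle_arrival:
  assumes s: "measurable_learner N s" "\<And>\<omega>. 1 \<le> batch (s \<omega>)"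
  shows "measurable_learner N (\<lambda>\<omega>. handle_arrival p (x \<omega>) i (s \<omega>))"
proof -
  note [measurable] = measurable_learnerD(2-)[OF s(1)] measurable_admits[OF s(1)]
  have st: "measurable_server N (\<lambda>\<omega>. if admits (s \<omega>) then join_queue (epoch (x \<omega>) i) (server_of (s \<omega>)) else server_of (s \<omega>))"
    by (intro measurable_server_If measurable_join_queue measurable_learnerD[OF s(1)]) measurable
  note [measurable] = measurable_learned_threshold[OF _ s(2) st]
  show ?thesis
    unfolding handle_arrival_def Let_def
  proof (intro measurable_learner_If)
    let ?j = "\<lambda>\<omega>. if admits (s \<omega>) then join_queue (epoch (x \<omega>) i) (server_of (s \<omega>)) else server_of (s \<omega>)"
    show "measurable_learner N (\<lambda>\<omega>. s \<omega>\<lparr>server_of := ?j \<omega>, exploiting := True, phase_arrivals := 0,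
       threshold := learned_threshold p (x \<omega>) (batch (s \<omega>)) i (?j \<omega>)\<rparr>)"
      unfolding measurable_learner_def by (intro conjI; simp add: st; measurable)
    show "measurable_learner N (\<lambda>\<omega>. s \<omega>\<lparr>server_of := ?j \<omega>, phase_arrivals := phase_arrivals (s \<omega>) + 1\<rparr>)"
      unfolding measurable_learner_def by (intro conjI; simp add: st; measurable)
  qed measurable
qed

lemma measurable_run:
  "measurable_learner N (\<lambda>\<omega>. learner_run p (x \<omega>) (y \<omega>) (b \<omega>) i) \<and> (\<forall>\<omega>. 1 \<le> batch (learner_run p (x \<omega>) (y \<omega>) (b \<omega>) i))"
proof (induction i)
  case 0
  show ?case by (simp add: measurable_learner_def init_learner_def measurable_server_const)
next
  case (Suc i)
  then show ?case
    by (auto intro!: measurable_handle_arrival measurable_before_arrival batch_before_arrival[simplified]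
      simp: batch_handle_arrival)
qed

lemmas measurable_learner_run = measurable_run[THEN conjunct1]

lemma measurable_learner_seen:
  "measurable_learner N (\<lambda>\<omega>. learner_seen p (x \<omega>) (y \<omega>) (b \<omega>) i)"
  unfolding learner_seen_def by (intro measurable_before_arrival measurable_learner_run)

lemma measurable_genie_before_arrival:
  assumes "measurable_server N (\<lambda>\<omega>. fst (g \<omega>))" "(\<lambda>\<omega>. snd (g \<omega>)) \<in> measurable N (count_space UNIV)"
  shows "measurable_server N (\<lambda>\<omega>. fst (genie_before_arrival p (x \<omega>) (y \<omega>) (b \<omega>) i (g \<omega>)))"
    "(\<lambda>\<omega>. snd (genie_before_arrival p (x \<omega>) (y \<omega>) (b \<omega>) i (g \<omega>))) \<in> measurable N (count_space UNIV)"
proof -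
  have st: "measurable_server N (\<lambda>\<omega>. serve (y \<omega>) (epoch (x \<omega>) (i - 1)) (epoch (x \<omega>) i) (fst (g \<omega>)))"
    by (intro measurable_serve y epoch_x assms)
  then show "measurable_server N (\<lambda>\<omega>. fst (genie_before_arrival p (x \<omega>) (y \<omega>) (b \<omega>) i (g \<omega>)))"
    by (simp add: genie_before_arrival_def Let_def)
  note [measurable] = assms(2) measurable_serverD[OF st] measurable_learnerD(2-)[OF measurable_learner_seen[of i]]
  show "(\<lambda>\<omega>. snd (genie_before_arrival p (x \<omega>) (y \<omega>) (b \<omega>) i (g \<omega>))) \<in> measurable N (count_space UNIV)"
    unfolding genie_before_arrival_def Let_def snd_conv by measurable
qed

lemma measurable_genie_admits:
  assumes "measurable_server N (\<lambda>\<omega>. fst (g \<omega>))" "(\<lambda>\<omega>. snd (g \<omega>)) \<in> measurable N (count_space UNIV)"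
  shows "Measurable.pred N (\<lambda>\<omega>. genie_admits (g \<omega>))"
proof -
  note [measurable] = assms(2) measurable_serverD[OF assms(1)]
  show ?thesis unfolding genie_admits_def by measurable
qed

lemma measurable_grun:
  "measurable_server N (\<lambda>\<omega>. fst (genie_run p (x \<omega>) (y \<omega>) (b \<omega>) i)) \<and>
   (\<lambda>\<omega>. snd (genie_run p (x \<omega>) (y \<omega>) (b \<omega>) i)) \<in> measurable N (count_space UNIV)"
proof (induction i)
  case 0
  show ?case by (simp add: init_genie_def measurable_server_const)
next
  case (Suc i)
  note m = measurable_genie_before_arrival[OF Suc[THEN conjunct1] Suc[THEN conjunct2], of "Suc i"]
  show ?case
    unfolding genie_run.simps Let_def fst_conv snd_conv
    by (intro conjI measurable_server_If measurable_join_queue measurable_genie_admits m epoch_x)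
qed

lemmas measurable_genie_run = measurable_grun[THEN conjunct1]

lemma measurable_genie_seen:
  "measurable_server N (\<lambda>\<omega>. fst (genie_seen p (x \<omega>) (y \<omega>) (b \<omega>) i))"
  "(\<lambda>\<omega>. snd (genie_seen p (x \<omega>) (y \<omega>) (b \<omega>) i)) \<in> measurable N (count_space UNIV)"
  unfolding genie_seen_def
  using measurable_genie_before_arrival[OF measurable_grun[THEN conjunct1] measurable_grun[THEN conjunct2]]
  by auto

lemma measurable_exploring [measurable]: "Measurable.pred N (\<lambda>\<omega>. exploring p (x \<omega>) (y \<omega>) (b \<omega>) n)"
  and measurable_overestimating [measurable]: "Measurable.pred N (\<lambda>\<omega>. overestimating p (x \<omega>) (y \<omega>) (b \<omega>) n)"
  and measurable_over_at [measurable]: "Measurable.pred N (\<lambda>\<omega>. over_at p (x \<omega>) (y \<omega>) (b \<omega>) j a n)"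
  and measurable_overtime [measurable]: "Measurable.pred N (\<lambda>\<omega>. overtime p (x \<omega>) (y \<omega>) (b \<omega>) j n)"
  and measurable_new_batch [measurable]: "Measurable.pred N (\<lambda>\<omega>. new_batch p (x \<omega>) (y \<omega>) (b \<omega>) j n)"
  and measurable_deceptive_start [measurable]: "Measurable.pred N (\<lambda>\<omega>. deceptive_start p th (x \<omega>) (y \<omega>) (b \<omega>) j n)"
  and measurable_lagging [measurable]: "Measurable.pred N (\<lambda>\<omega>. lagging p (x \<omega>) (y \<omega>) (b \<omega>) n)"
proof -
  note [measurable] = measurable_learnerD(2-)[OF measurable_learner_seen] measurable_learnerD(2-)[OF measurable_learner_run]
    measurable_serverD[OF measurable_learnerD(1)[OF measurable_learner_seen]]
    measurable_serverD[OF measurable_learnerD(1)[OF measurable_learner_run]]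
    measurable_serverD[OF measurable_genie_run]
  show "Measurable.pred N (\<lambda>\<omega>. exploring p (x \<omega>) (y \<omega>) (b \<omega>) n)"
    unfolding exploring_def by measurable
  show 1 [measurable]: "Measurable.pred N (\<lambda>\<omega>. overestimating p (x \<omega>) (y \<omega>) (b \<omega>) n)" for n
    unfolding overestimating_def by measurable
  show "Measurable.pred N (\<lambda>\<omega>. over_at p (x \<omega>) (y \<omega>) (b \<omega>) j a n)"
    unfolding over_at_def by measurable
  show "Measurable.pred N (\<lambda>\<omega>. overtime p (x \<omega>) (y \<omega>) (b \<omega>) j n)"
    unfolding overtime_def by measurable
  show 2 [measurable]: "Measurable.pred N (\<lambda>\<omega>. new_batch p (x \<omega>) (y \<omega>) (b \<omega>) j n)" for n
    unfolding new_batch_def by measurable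
  show "Measurable.pred N (\<lambda>\<omega>. deceptive_start p th (x \<omega>) (y \<omega>) (b \<omega>) j n)"
    unfolding deceptive_start_def by measurable
  show "Measurable.pred N (\<lambda>\<omega>. lagging p (x \<omega>) (y \<omega>) (b \<omega>) n)"
    unfolding lagging_def by measurable
qed

end

section \<open>The profit gap along a sample path\<close>

lemma num_joined_epoch:
  assumes "\<forall>n. 0 < x n"
  shows "real (num_joined x adm (epoch x N)) = (\<Sum>n<N. of_bool (adm (Suc n)))"
proof -
  have "{i. 1 \<le> i \<and> epoch x i \<le> epoch x N \<and> adm i} = Suc ` {n. n < N \<and> adm (Suc n)}"
  proof (intro set_eqI iffI)
    fix i assume "i \<in> {i. 1 \<le> i \<and> epoch x i \<le> epoch x N \<and> adm i}"
    then show "i \<in> Suc ` {n. n < N \<and> adm (Suc n)}"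
      using epoch_le_iff[OF assms, of i N] by (cases i) auto
  next
    fix i assume "i \<in> Suc ` {n. n < N \<and> adm (Suc n)}"
    then show "i \<in> {i. 1 \<le> i \<and> epoch x i \<le> epoch x N \<and> adm i}"
      using epoch_le_iff[OF assms, of i N] by auto
  qed
  then have "num_joined x adm (epoch x N) = card {n. n < N \<and> adm (Suc n)}"
    unfolding num_joined_def by (simp add: card_image)
  then show ?thesis
    by (simp add: lessThan_def Int_def)
qed

context queue_path
begin

lemma queue_at_interval:
  assumes "epoch x n \<le> u" "u < epoch x (Suc n)"
  shows "queue_at x y r u = queue (r n) - (num_epochs y u - num_epochs y (epoch x n))"
proof -
  have n: "num_epochs x u = n" by (rule num_epochs_eq[OF x_pos assms])
  have "num_epochs y (epoch x n) \<le> num_epochs y u"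
    by (rule num_epochs_mono[OF y_regular epoch_nonneg[OF x_pos] assms(1)])
  then show ?thesis by (simp add: queue_at_def n serve_queue)
qed

lemma ex_arrival_interval: "0 \<le> u \<Longrightarrow> u < epoch x N \<Longrightarrow> \<exists>n<N. epoch x n \<le> u \<and> u < epoch x (Suc n)"
proof (induction N)
  case (Suc N)
  then show ?case by (cases "u < epoch x N") (auto simp: not_less intro: less_SucI)
qed simp

abbreviation "area N r \<equiv> set_lebesgue_integral lborel {0..epoch x N} (\<lambda>u. real (queue_at x y r u))"

lemma integrable_queue_at:
  "integrable lborel (\<lambda>u. indicator {0..epoch x N} u * real (queue_at x y r u))"
proof -
  define B where "B = (\<Sum>n\<le>N. real (queue (r n)))"
  have [measurable]: "(\<lambda>u. queue_at x y r u) \<in> measurable borel (count_space UNIV)"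
    by (rule measurable_queue_at) (auto simp: measurable_server_const)
  have le: "real (queue_at x y r u) \<le> B" if u: "0 \<le> u" "u \<le> epoch x N" for u
  proof -
    have "u < epoch x (Suc N)" using u x_pos by (simp add: epoch_Suc add.commute add_strict_increasing)
    then obtain n where n: "n < Suc N" "epoch x n \<le> u" "u < epoch x (Suc n)"
      using ex_arrival_interval[OF u(1)] by blast
    then have "real (queue_at x y r u) \<le> real (queue (r n))" by (simp add: queue_at_interval)
    also have "\<dots> \<le> B" unfolding B_def using n(1) by (intro member_le_sum) auto
    finally show ?thesis .
  qed
  show ?thesis
  proof (rule Bochner_Integration.integrable_bound[of _ "\<lambda>u. B * indicator {0..epoch x N} u"])
    show "integrable lborel (\<lambda>u. B * indicator {0..epoch x N} u)"
      by (intro integrable_mult_right integrable_real_indicator) (auto simp: emeasure_lborel_Icc_eq)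
    show "AE u in lborel. norm (indicator {0..epoch x N} u * real (queue_at x y r u)) \<le> norm (B * indicator {0..epoch x N} u)"
    proof (rule AE_I2)
      fix u
      have "0 \<le> B" by (simp add: B_def sum_nonneg)
      then show "norm (indicator {0..epoch x N} u * real (queue_at x y r u)) \<le> norm (B * indicator {0..epoch x N} u)"
        using le[of u] by (cases "u \<in> {0..epoch x N}") auto
    qed
  qed measurable
qed

text \<open>Between two arrivals both systems see the same potential departures and the genie's
  queue is the shorter one, so their distance never exceeds its value right after the last
  arrival.\<close>

lemma queue_integral_gap:
  "\<bar>area N (\<lambda>i. fst (grun i)) - area N (\<lambda>i. server_of (run i))\<bar>
   \<le> (\<Sum>n<N. real (queue_run n - gqueue_run n) * x n)"
proof -
  let ?q = "\<lambda>u. real (queue_at x y (\<lambda>i. server_of (run i)) u)"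
  let ?g = "\<lambda>u. real (queue_at x y (\<lambda>i. fst (grun i)) u)"
  let ?I = "indicator {0..epoch x N} :: real \<Rightarrow> real"
  let ?h = "\<lambda>u. \<Sum>n<N. real (queue_run n - gqueue_run n) * indicator {epoch x n..<epoch x (Suc n)} u"
  have h_ge: "\<bar>?g u - ?q u\<bar> \<le> ?h u" if u: "0 \<le> u" "u < epoch x N" for u
  proof -
    obtain n where n: "n < N" "epoch x n \<le> u" "u < epoch x (Suc n)" using ex_arrival_interval[OF u] by blast
    have "\<bar>?g u - ?q u\<bar> \<le> real (queue_run n - gqueue_run n)"
    proof -
      have "(a::nat) \<le> c \<Longrightarrow> \<bar>real (a - m) - real (c - m)\<bar> \<le> real (c - a)" for a c m by linarith
      from this[OF gqueue_le_run[of n]] show ?thesis unfolding queue_at_interval[OF n(2,3)] .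
    qed
    also have "\<dots> = real (queue_run n - gqueue_run n) * indicator {epoch x n..<epoch x (Suc n)} u"
      using n by simp
    also have "\<dots> \<le> ?h u"
      by (rule member_le_sum[where f="\<lambda>n. real (queue_run n - gqueue_run n) * indicator {epoch x n..<epoch x (Suc n)} u"])
        (use n(1) in simp_all)
    finally show ?thesis .
  qed
  have ih: "integrable lborel ?h"
    using x_pos by (intro Bochner_Integration.integrable_sum integrable_mult_right integrable_real_indicator)
      (auto simp: epoch_Suc less_imp_le)
  have eq: "area N (\<lambda>i. fst (grun i)) - area N (\<lambda>i. server_of (run i)) = (\<integral>u. ?I u * ?g u - ?I u * ?q u \<partial>lborel)"
    unfolding set_lebesgue_integral_def real_scaleR_def
    by (rule Bochner_Integration.integral_diff[OF integrable_queue_at integrable_queue_at, symmetric])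
  have "\<bar>area N (\<lambda>i. fst (grun i)) - area N (\<lambda>i. server_of (run i))\<bar> \<le> (\<integral>u. \<bar>?I u * ?g u - ?I u * ?q u\<bar> \<partial>lborel)"
    unfolding eq by (rule integral_abs_bound)
  also have "\<dots> \<le> (\<integral>u. ?h u \<partial>lborel)"
  proof (rule integral_mono_AE[OF _ ih])
    show "integrable lborel (\<lambda>u. \<bar>?I u * ?g u - ?I u * ?q u\<bar>)"
      by (intro integrable_abs Bochner_Integration.integrable_diff integrable_queue_at)
    \<comment> \<open>The end point \<open>epoch x N\<close> lies in none of the half-open intervals
      behind \<open>?h\<close>, but it is a null set.\<close>
    show "AE u in lborel. \<bar>?I u * ?g u - ?I u * ?q u\<bar> \<le> ?h u"
      using AE_lborel_singleton[of "epoch x N"]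
    proof eventually_elim
      case (elim u)
      show ?case
      proof (cases "0 \<le> u \<and> u \<le> epoch x N")
        case True
        then have "\<bar>?g u - ?q u\<bar> \<le> ?h u" "?I u = 1"
          using elim h_ge[of u] by (simp_all only: indicator_simps atLeastAtMost_iff less_le simp_thms)
        then show ?thesis by (simp only: mult_1)
      next
        case False
        then have "?I u = 0" by auto
        then show ?thesis by (simp only: mult_zero_left diff_self abs_zero) (intro sum_nonneg mult_nonneg_nonneg, auto)
      qed
    qed
  qed
  also have "\<dots> = (\<Sum>n<N. real (queue_run n - gqueue_run n) * x n)"
  proof (subst Bochner_Integration.integral_sum)
    show "integrable lborel (\<lambda>u. real (queue_run n - gqueue_run n) * indicator {epoch x n..<epoch x (Suc n)} u)" for n
      using x_pos by (intro integrable_mult_right integrable_real_indicator) (auto simp: epoch_Suc less_imp_le)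
    have "epoch x n \<le> epoch x (Suc n)" for n using epoch_le_iff[OF x_pos] by simp
    then have "(\<integral>u. indicator {epoch x n..<epoch x (Suc n)} u \<partial>lborel) = x n" for n
      by (simp add: epoch_Suc)
    then show "(\<Sum>n<N. \<integral>u. real (queue_run n - gqueue_run n) * indicator {epoch x n..<epoch x (Suc n)} u \<partial>lborel) =
        (\<Sum>n<N. real (queue_run n - gqueue_run n) * x n)"
      by (simp only: Bochner_Integration.integral_mult_right_zero)
  qed
  finally show ?thesis .
qed

text \<open>The distance of the queues after arrival \<open>n\<close> is multiplied by the following
  gap \<open>x (Suc n)\<close>, which is independent of the history up to that arrival, so
  expectations factorise later. The time before the first arrival contributes nothing because the
  initial queues agree.\<close>

lemma profit_gap_le:
  assumes "0 \<le> reward p" "0 \<le> hold_cost p"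
  shows "\<bar>profit_gap p x y b (epoch x N)\<bar> \<le>
    reward p * (\<Sum>n<N. of_bool (exploring p x y b n) + of_bool (overestimating p x y b n) + of_bool (lagging p x y b n)) +
    hold_cost p * (\<Sum>n<N. (real kstar * of_bool (lagging p x y b n) +
       real (max_threshold p (batch (seen n))) * of_bool (overestimating p x y b n)) * x (Suc n))"
    (is "_ \<le> _ * (\<Sum>n<N. ?e n + ?o n + ?l n) + _ * (\<Sum>n<N. ?d n * x (Suc n))")
proof -
  let ?D = "\<lambda>n. of_bool (genie_admits (gseen n) \<noteq> admits (seen n)) :: real"
  have 1: "\<bar>(\<Sum>n<N. of_bool (genie_admits (gseen n))) - (\<Sum>n<N. of_bool (admits (seen n)))\<bar> \<le> (\<Sum>n<N. ?D n)"
    unfolding sum_subtractf[symmetric] by (intro sum_abs[THEN order_trans] sum_mono) auto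
  also have "\<dots> \<le> (\<Sum>n<N. ?e n + ?o n + ?l n)"
  proof (cases N)
    case (Suc N')
    have s: "?D (Suc n) \<le> ?e (Suc n) + ?o (Suc n) + ?l n" for n
      using differ_Suc[of n] by (cases "?D (Suc n) = 0") auto
    have "(\<Sum>n<N. ?D n) = ?D 0 + (\<Sum>n<N'. ?D (Suc n))"
      unfolding Suc by (rule sum.lessThan_Suc_shift)
    also have "\<dots> \<le> ?e 0 + (\<Sum>n<N'. ?e (Suc n) + ?o (Suc n) + ?l n)"
      using exploring_0 by (intro add_mono sum_mono s) auto
    also have "\<dots> \<le> (?e 0 + (\<Sum>n<N'. ?e (Suc n))) + (?o 0 + (\<Sum>n<N'. ?o (Suc n))) + ((\<Sum>n<N'. ?l n) + ?l N')"
      by (simp add: sum.distrib)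
    also have "\<dots> = (\<Sum>n<N. ?e n) + (\<Sum>n<N. ?o n) + (\<Sum>n<N. ?l n)"
      unfolding Suc sum.lessThan_Suc_shift[of ?e] sum.lessThan_Suc_shift[of ?o] by simp
    finally show ?thesis by (simp add: sum.distrib)
  qed simp
  finally have adm: "\<bar>(\<Sum>n<N. of_bool (genie_admits (gseen n))) - (\<Sum>n<N. of_bool (admits (seen n)))\<bar>
      \<le> (\<Sum>n<N. ?e n + ?o n + ?l n)" .
  have d0: "0 \<le> ?d n * x (Suc n)" for n
    using x_pos by (intro mult_nonneg_nonneg) (auto simp: less_imp_le)
  have "(\<Sum>n<N. real (queue_run n - gqueue_run n) * x n) \<le> (\<Sum>n<N. ?d n * x (Suc n))"
  proof (cases N)
    case (Suc N')
    have "(\<Sum>n<N. real (queue_run n - gqueue_run n) * x n) = (\<Sum>n<N'. real (queue_run (Suc n) - gqueue_run (Suc n)) * x (Suc n))"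
      unfolding Suc sum.lessThan_Suc_shift
      by (simp add: init_learner_def init_genie_def init_server_def init_eq)
    also have "\<dots> \<le> (\<Sum>n<N'. ?d n * x (Suc n))"
    proof (intro sum_mono mult_right_mono)
      fix n
      have "real (queue_run (Suc n) - gqueue_run (Suc n)) \<le> real (kstar * of_bool (lagging p x y b n) +
         max_threshold p (batch (seen n)) * of_bool (overestimating p x y b n))"
        using queue_gap_le[of n] by (simp only: of_nat_le_iff)
      then show "real (queue_run (Suc n) - gqueue_run (Suc n)) \<le> ?d n" by simp
      show "0 \<le> x (Suc n)" using x_pos by (simp add: less_imp_le)
    qed
    also have "\<dots> \<le> (\<Sum>n<N. ?d n * x (Suc n))" unfolding Suc using d0[of N'] by simp
    finally show ?thesis .
  qed simp
  with queue_integral_gap[of N] have int: "\<bar>area N (\<lambda>i. fst (grun i)) - area N (\<lambda>i. server_of (run i))\<bar> \<le> (\<Sum>n<N. ?d n * x (Suc n))"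
    by linarith
  have eq: "profit_gap p x y b (epoch x N) =
    reward p * ((\<Sum>n<N. of_bool (genie_admits (gseen n))) - (\<Sum>n<N. of_bool (admits (seen n)))) -
    hold_cost p * (area N (\<lambda>i. fst (grun i)) - area N (\<lambda>i. server_of (run i)))"
    unfolding profit_gap_def profit_def num_joined_epoch[OF x_pos] by (simp add: right_diff_distrib)
  show ?thesis
    unfolding eq
    using mult_left_mono[OF adm assms(1)] mult_left_mono[OF int assms(2)] assms
    by (intro abs_triangle_ineq4[THEN order_trans] add_mono) (simp_all only: abs_mult abs_of_nonneg)
qed

end

context measurable_paths
begin

lemma measurable_profit:
  assumes run: "\<And>i. measurable_server N (\<lambda>\<omega>. run \<omega> i)" and t: "t \<in> borel_measurable N"
    and adm: "\<And>i. Measurable.pred N (\<lambda>\<omega>. adm \<omega> i)"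
  shows "(\<lambda>\<omega>. profit p (x \<omega>) (y \<omega>) (run \<omega>) (adm \<omega>) (t \<omega>)) \<in> borel_measurable N"
proof -
  note [measurable] = t adm
  have "(\<lambda>w. queue_at (x (fst w)) (y (fst w)) (run (fst w)) (snd w)) \<in> measurable (N \<Otimes>\<^sub>M borel) (count_space UNIV)"
  proof (rule measurable_queue_at)
    show "measurable_server (N \<Otimes>\<^sub>M borel) (\<lambda>w. run (fst w) i)" for i
      using run[of i] unfolding measurable_server_def
      by (auto intro: measurable_compose[OF measurable_fst])
  qed measurable
  then have q: "(\<lambda>w. real (queue_at (x (fst w)) (y (fst w)) (run (fst w)) (snd w))) \<in> borel_measurable (N \<Otimes>\<^sub>M borel)"
    by measurable
  have "(\<lambda>(\<omega>, u). indicator {0..t \<omega>} u *\<^sub>R real (queue_at (x \<omega>) (y \<omega>) (run \<omega>) u)) \<in> borel_measurable (N \<Otimes>\<^sub>M lborel)"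
    unfolding split_beta' using q by (simp add: indicator_def split: if_splits cong: if_cong) measurable
  from lborel.borel_measurable_lebesgue_integral[OF this]
  have area: "(\<lambda>\<omega>. set_lebesgue_integral lborel {0..t \<omega>} (\<lambda>u. real (queue_at (x \<omega>) (y \<omega>) (run \<omega>) u))) \<in> borel_measurable N"
    unfolding set_lebesgue_integral_def by simp
  have "(\<lambda>\<omega>. num_joined (x \<omega>) (adm \<omega>) (t \<omega>)) \<in> measurable N (count_space UNIV)"
    unfolding num_joined_def by measurable
  then have "(\<lambda>\<omega>. real (num_joined (x \<omega>) (adm \<omega>) (t \<omega>))) \<in> borel_measurable N"
    by measurable
  then show ?thesis
    unfolding profit_def by (intro borel_measurable_diff borel_measurable_times borel_measurable_const area)
qed

lemma measurable_profit_gap: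
  assumes "t \<in> borel_measurable N"
  shows "(\<lambda>\<omega>. profit_gap p (x \<omega>) (y \<omega>) (b \<omega>) (t \<omega>)) \<in> borel_measurable N"
  unfolding profit_gap_def
proof (rule borel_measurable_diff)
  show "(\<lambda>\<omega>. profit p (x \<omega>) (y \<omega>) (\<lambda>i. fst (genie_run p (x \<omega>) (y \<omega>) (b \<omega>) i))
      (\<lambda>i. genie_admits (genie_seen p (x \<omega>) (y \<omega>) (b \<omega>) i)) (t \<omega>)) \<in> borel_measurable N"
    by (rule measurable_profit[OF measurable_genie_run assms measurable_genie_admits[OF measurable_genie_seen]])
  show "(\<lambda>\<omega>. profit p (x \<omega>) (y \<omega>) (\<lambda>i. server_of (learner_run p (x \<omega>) (y \<omega>) (b \<omega>) i))
      (\<lambda>i. admits (learner_seen p (x \<omega>) (y \<omega>) (b \<omega>) i)) (t \<omega>)) \<in> borel_measurable N"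
    by (rule measurable_profit[OF measurable_learnerD(1)[OF measurable_learner_run] assms measurable_admits[OF measurable_learner_seen]])
qed

end

section \<open>Memorylessness\<close>

definition count_cylinder :: "nat \<Rightarrow> real \<Rightarrow> (nat \<Rightarrow> real) set" where
  "count_cylinder k t = {y. regular_gaps y \<and> epoch y k \<le> t \<and> t < epoch y (Suc k)}"

text \<open>Dependence on the process up to time \<open>t\<close> without a filtration: the number
  \<open>k\<close> of points and the first \<open>k\<close> gaps determine the value, and the
  unfinished gap matters only in that it reaches beyond \<open>t\<close>.\<close>

definition past_only :: "real \<Rightarrow> ((nat \<Rightarrow> real) \<Rightarrow> 'b) \<Rightarrow> bool" where
  "past_only t f \<longleftrightarrow> (\<forall>k. \<forall>y\<in>count_cylinder k t. \<forall>y'\<in>count_cylinder k t. (\<forall>n<k. y n = y' n) \<longrightarrow> f y = f y')"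

lemma num_epochs_count_cylinder: "y \<in> count_cylinder k t \<Longrightarrow> num_epochs y t = k"
  by (auto simp: count_cylinder_def regular_gaps_def intro: num_epochs_eq)

locale exponential_sequence =
  fixes l :: real
  assumes l_pos: "0 < l"
begin

abbreviation "E \<equiv> density lborel (exponential_density l)"

end

sublocale exponential_sequence \<subseteq> E: prob_space E
  using l_pos by (rule prob_space_exponential_density)

sublocale exponential_sequence \<subseteq> sequence_space E
  by unfold_locales

context exponential_sequence
begin

lemma component_measurable: "(\<lambda>y. y n) \<in> borel_measurable S"
proof -
  have "(\<lambda>y. y n) \<in> measurable S E" by (rule measurable_component_singleton) simp
  then show ?thesis by simp
qed

lemma measurable_into_S:
  assumes "\<And>n. (\<lambda>w. f w n) \<in> borel_measurable N"
  shows "f \<in> measurable N S"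
  by (rule measurable_PiM_single') (use assms in auto)

lemma measurable_case_nat_S [measurable (raw)]:
  assumes "f \<in> borel_measurable N" "g \<in> measurable N S"
  shows "(\<lambda>w. case_nat (f w) (g w)) \<in> measurable N S"
proof (rule measurable_into_S)
  fix n show "(\<lambda>w. case n of 0 \<Rightarrow> f w | Suc m \<Rightarrow> g w m) \<in> borel_measurable N"
    using assms by (cases n) (auto intro: measurable_compose[OF assms(2) component_measurable])
qed

text \<open>Prefixing an independent gap preserves the law of the sequence; the inductions along the
  gaps below integrate over the first gap in this way.\<close>

lemma nn_integral_S:
  assumes [measurable]: "f \<in> borel_measurable S"
  shows "(\<integral>\<^sup>+y. f y \<partial>S) = (\<integral>\<^sup>+s. \<integral>\<^sup>+y. f (case_nat s y) \<partial>S \<partial>E)"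
proof -
  have m: "(\<lambda>(s, y). case_nat s y) \<in> measurable (E \<Otimes>\<^sub>M S) S"
    unfolding split_beta' by (rule measurable_case_nat_S) measurable
  have "(\<integral>\<^sup>+y. f y \<partial>S) = (\<integral>\<^sup>+y. f y \<partial>distr (E \<Otimes>\<^sub>M S) S (\<lambda>(s, y). case_nat s y))"
    by (simp only: PiM_iter)
  also have "\<dots> = (\<integral>\<^sup>+w. f (case_prod case_nat w) \<partial>(E \<Otimes>\<^sub>M S))"
    using m by (subst nn_integral_distr) (auto simp: split_beta')
  also have "\<dots> = (\<integral>\<^sup>+s. \<integral>\<^sup>+y. f (case_nat s y) \<partial>S \<partial>E)"
    using measurable_compose[OF m assms] by (subst P.nn_integral_fst[symmetric]) auto
  finally show ?thesis .
qed

lemma AE_E_pos: "AE s in E. 0 < s"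
proof -
  have "AE s in lborel. s \<noteq> (0::real)" by (rule AE_lborel_singleton)
  then have "AE s in lborel. 0 < ennreal (exponential_density l s) \<longrightarrow> 0 < s"
    by eventually_elim (auto simp: exponential_density_def split: if_splits)
  then show ?thesis by (subst AE_density) auto
qed

text \<open>Memorylessness of a single gap: the density at \<open>t + s\<close> is
  \<open>exp (- l * t)\<close> times the density at \<open>s\<close>.\<close>

lemma exponential_shift:
  assumes [measurable]: "h \<in> borel_measurable borel" and t: "0 \<le> t"
  shows "(\<integral>\<^sup>+s. h (s - t) * indicator {t<..} s \<partial>E) = ennreal (exp (- l * t)) * (\<integral>\<^sup>+s. h s \<partial>E)"
proof -
  have "(\<integral>\<^sup>+s. h (s - t) * indicator {t<..} s \<partial>E) =
      (\<integral>\<^sup>+s. ennreal (exponential_density l s) * (h (s - t) * indicator {t<..} s) \<partial>lborel)"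
    by (subst nn_integral_density) auto
  also have "\<dots> = (\<integral>\<^sup>+s. ennreal (exponential_density l (t + s)) * (h s * indicator {0<..} s) \<partial>lborel)"
    by (subst nn_integral_real_affine[where c=1 and t=t])
      (auto intro!: nn_integral_cong simp: indicator_def)
  also have "\<dots> = (\<integral>\<^sup>+s. ennreal (exp (- l * t)) * (ennreal (exponential_density l s) * h s) \<partial>lborel)"
  proof (rule nn_integral_cong_AE)
    show "AE s in lborel. ennreal (exponential_density l (t + s)) * (h s * indicator {0<..} s) =
        ennreal (exp (- l * t)) * (ennreal (exponential_density l s) * h s)"
      using AE_lborel_singleton[of 0]
    proof eventually_elim
      case (elim s)
      show ?case
      proof (cases "0 < s")
        case True
        then have "exponential_density l (t + s) = exp (- l * t) * exponential_density l s"
          using t by (simp add: exponential_density_def algebra_simps mult_exp_exp)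
        then show ?thesis using True by (simp add: ennreal_mult' mult.assoc)
      next
        case False
        then show ?thesis using elim by (simp add: exponential_density_def)
      qed
    qed
  qed
  also have "\<dots> = ennreal (exp (- l * t)) * (\<integral>\<^sup>+s. h s \<partial>E)"
    by (subst nn_integral_cmult) (auto simp: nn_integral_density)
  finally show ?thesis .
qed

text \<open>Exponential tilting: multiplying the density of rate \<open>l\<close> by
  \<open>exp (- a * s)\<close> gives \<open>l / (l + a)\<close> times the density of rate
  \<open>l + a\<close>.\<close>

lemma exponential_Laplace:
  assumes "0 \<le> a"
  shows "(\<integral>\<^sup>+s. ennreal (exp (- a * s)) \<partial>E) = ennreal (l / (l + a))"
proof -
  have la: "0 < l + a" using assms l_pos by simp
  interpret E': prob_space "density lborel (exponential_density (l + a))"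
    by (rule prob_space_exponential_density[OF la])
  have "(\<integral>\<^sup>+s. ennreal (exp (- a * s)) \<partial>E) = (\<integral>\<^sup>+s. ennreal (exponential_density l s) * ennreal (exp (- a * s)) \<partial>lborel)"
    by (subst nn_integral_density) auto
  also have "\<dots> = (\<integral>\<^sup>+s. ennreal (l / (l + a)) * ennreal (exponential_density (l + a) s) \<partial>lborel)"
  proof (rule nn_integral_cong)
    fix s
    have "exponential_density l s * exp (- a * s) = l / (l + a) * exponential_density (l + a) s"
    proof -
      have "exp (- s * l) * exp (- a * s) = exp (- s * (l + a))"
        by (simp add: mult_exp_exp algebra_simps)
      then show ?thesis using la by (simp add: exponential_density_def)
    qed
    then show "ennreal (exponential_density l s) * ennreal (exp (- a * s)) = ennreal (l / (l + a)) * ennreal (exponential_density (l + a) s)"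
      using l_pos la by (simp add: ennreal_mult'[symmetric] exponential_density_nonneg)
  qed
  also have "\<dots> = ennreal (l / (l + a))"
  proof -
    have "(\<integral>\<^sup>+s. ennreal (exponential_density (l + a) s) \<partial>lborel) = 1"
      using E'.emeasure_space_1 by (simp add: emeasure_density)
    then show ?thesis by (subst nn_integral_cmult) simp_all
  qed
  finally show ?thesis .
qed

lemma epoch_measurable [measurable]: "(\<lambda>y. epoch y n) \<in> borel_measurable S"
  by (rule measurable_epoch component_measurable)+

lemma epoch_Laplace:
  assumes "0 \<le> a"
  shows "(\<integral>\<^sup>+y. ennreal (exp (- a * epoch y n)) \<partial>S) = ennreal ((l / (l + a)) ^ n)"
proof (induction n)
  case 0
  then show ?case using P.emeasure_space_1 by simp
next
  case (Suc n)
  have "(\<integral>\<^sup>+y. ennreal (exp (- a * epoch y (Suc n))) \<partial>S) =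
    (\<integral>\<^sup>+s. \<integral>\<^sup>+y. ennreal (exp (- a * s)) * ennreal (exp (- a * epoch y n)) \<partial>S \<partial>E)"
    by (subst nn_integral_S) (auto simp: epoch_case_nat algebra_simps mult_exp_exp ennreal_mult'[symmetric])
  also have "\<dots> = (\<integral>\<^sup>+s. ennreal (exp (- a * s)) * ennreal ((l / (l + a)) ^ n) \<partial>E)"
    by (subst nn_integral_cmult, measurable) (simp only: Suc)
  also have "\<dots> = (\<integral>\<^sup>+s. ennreal (exp (- a * s)) \<partial>E) * ennreal ((l / (l + a)) ^ n)"
    by (rule nn_integral_multc) measurable
  also have "\<dots> = ennreal ((l / (l + a)) ^ Suc n)"
    unfolding exponential_Laplace[OF assms] using assms l_pos by (simp add: ennreal_mult'[symmetric])
  finally show ?case .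
qed

lemma pred_regular_gaps [measurable]: "Measurable.pred S regular_gaps"
  unfolding regular_gaps_def[abs_def] by measurable

lemma AE_regular_gaps: "AE y in S. regular_gaps y"
proof -
  have 1: "AE y in S. \<forall>n. 0 < y n"
    unfolding AE_all_countable
    by (intro allI AE_PiM_component E.prob_space_axioms AE_E_pos) auto
  have 2: "AE y in S. \<exists>n. real m < epoch y n" for m :: nat
  proof -
    let ?B = "{y \<in> space S. \<not> (\<exists>n. real m < epoch y n)}"
    have [measurable]: "?B \<in> sets S" by measurable
    define r where "r = l / (l + 1)"
    have r: "0 \<le> r" "r < 1" using l_pos by (auto simp: r_def)
    \<comment> \<open>Markov's inequality for \<open>exp (- epoch y n)\<close>: on \<open>?B\<close>
      all points stay below \<open>m\<close>, while the Laplace transform of the \<open>n\<close>-th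
      point at \<open>1\<close> tends to \<open>0\<close>.\<close>
    have le: "ennreal (exp (- real m)) * emeasure S ?B \<le> ennreal (r ^ n)" for n
    proof -
      have "ennreal (exp (- real m)) * emeasure S ?B = (\<integral>\<^sup>+y. ennreal (exp (- real m)) * indicator ?B y \<partial>S)"
        by (subst nn_integral_cmult_indicator) auto
      also have "\<dots> \<le> (\<integral>\<^sup>+y. ennreal (exp (- 1 * epoch y n)) \<partial>S)"
        by (intro nn_integral_mono) (auto simp: indicator_def not_less intro!: ennreal_leI)
      also have "\<dots> = ennreal (r ^ n)" unfolding r_def by (rule epoch_Laplace) simp
      finally show ?thesis .
    qed
    have "(\<lambda>n. ennreal (r ^ n)) \<longlonglongrightarrow> ennreal 0"
      using r by (intro tendsto_ennrealI LIMSEQ_realpow_zero) auto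
    then have "ennreal (exp (- real m)) * emeasure S ?B \<le> ennreal 0"
      by (rule LIMSEQ_le_const) (use le in auto)
    then have "emeasure S ?B = 0" by simp
    then show ?thesis by (subst AE_iff_measurable[OF _ refl]) auto
  qed
  have "AE y in S. \<forall>m::nat. \<exists>n. real m < epoch y n"
    unfolding AE_all_countable using 2 by blast
  with 1 show ?thesis by eventually_elim (auto simp: regular_gaps_def)
qed

lemma count_cylinder_measurable [measurable]: "Measurable.pred S (\<lambda>y. y \<in> count_cylinder k t)"
  unfolding count_cylinder_def by measurable

lemma case_nat_count_cylinder_Suc:
  "case_nat s y \<in> count_cylinder (Suc k) t \<longleftrightarrow> 0 < s \<and> s \<le> t \<and> y \<in> count_cylinder k (t - s)"
proof
  assume a: "case_nat s y \<in> count_cylinder (Suc k) t"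
  then have "0 < s" "regular_gaps y" by (auto simp: count_cylinder_def regular_gaps_case_nat)
  moreover from this have "0 \<le> epoch y k" by (intro epoch_nonneg) (auto simp: regular_gaps_def)
  ultimately show "0 < s \<and> s \<le> t \<and> y \<in> count_cylinder k (t - s)"
    using a by (auto simp: count_cylinder_def epoch_case_nat)
qed (auto simp: count_cylinder_def regular_gaps_case_nat epoch_case_nat)

lemma case_nat_count_cylinder_0:
  "0 \<le> t \<Longrightarrow> case_nat s y \<in> count_cylinder 0 t \<longleftrightarrow> t < s \<and> regular_gaps y"
  by (auto simp: count_cylinder_def regular_gaps_case_nat epoch_case_nat)

lemma residual_measurable [measurable]:
  assumes "f \<in> borel_measurable N" "g \<in> measurable N S"
  shows "(\<lambda>w. residual_gaps (f w) (g w)) \<in> measurable N S"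
proof (rule measurable_into_S)
  fix n
  note [measurable] = assms
  have g [measurable]: "(\<lambda>w. g w m) \<in> borel_measurable N" for m
    by (rule measurable_compose[OF assms(2) component_measurable])
  have k: "(\<lambda>w. num_epochs (g w) (f w)) \<in> measurable N (count_space UNIV)"
    by (rule measurable_num_epochs) measurable
  have 1: "(\<lambda>w. epoch (g w) (Suc (num_epochs (g w) (f w)))) \<in> borel_measurable N"
    by (rule measurable_compose_countable[where f="\<lambda>k w. epoch (g w) (Suc k)", OF measurable_epoch k]) measurable
  have 2: "(\<lambda>w. g w (num_epochs (g w) (f w) + n)) \<in> borel_measurable N"
    by (rule measurable_compose_countable[where f="\<lambda>k w. g w (k + n)", OF _ k]) measurable
  show "(\<lambda>w. residual_gaps (f w) (g w) n) \<in> borel_measurable N"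
    unfolding residual_gaps_def using 1 2 by simp
qed

lemma residual_0:
  assumes [measurable]: "g \<in> borel_measurable S" and t: "0 \<le> t"
  shows "(\<integral>\<^sup>+y. indicator (count_cylinder 0 t) y * g (residual_gaps t y) \<partial>S) = ennreal (exp (- l * t)) * (\<integral>\<^sup>+y. g y \<partial>S)"
proof -
  have "(\<integral>\<^sup>+y. indicator (count_cylinder 0 t) y * g (residual_gaps t y) \<partial>S) =
    (\<integral>\<^sup>+s. \<integral>\<^sup>+y. indicator (count_cylinder 0 t) (case_nat s y) * g (residual_gaps t (case_nat s y)) \<partial>S \<partial>E)"
    by (subst nn_integral_S) auto
  also have "\<dots> = (\<integral>\<^sup>+s. (\<integral>\<^sup>+y. g (case_nat (s - t) y) \<partial>S) * indicator {t<..} s \<partial>E)"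
  proof (rule nn_integral_cong)
    fix s
    show "(\<integral>\<^sup>+y. indicator (count_cylinder 0 t) (case_nat s y) * g (residual_gaps t (case_nat s y)) \<partial>S) =
      (\<integral>\<^sup>+y. g (case_nat (s - t) y) \<partial>S) * indicator {t<..} s"
    proof (cases "t < s")
      case True
      have "(\<integral>\<^sup>+y. indicator (count_cylinder 0 t) (case_nat s y) * g (residual_gaps t (case_nat s y)) \<partial>S) =
        (\<integral>\<^sup>+y. g (case_nat (s - t) y) \<partial>S)"
      proof (rule nn_integral_cong_AE)
        show "AE y in S. indicator (count_cylinder 0 t) (case_nat s y) * g (residual_gaps t (case_nat s y)) = g (case_nat (s - t) y)"
          using AE_regular_gaps
        proof eventually_elim
          case (elim y)
          have i: "case_nat s y \<in> count_cylinder 0 t" using True elim t by (simp add: case_nat_count_cylinder_0)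
          have "residual_gaps t (case_nat s y) = case_nat (s - t) y"
            by (rule ext) (auto simp: residual_gaps_def num_epochs_count_cylinder[OF i] epoch_case_nat split: nat.split)
          then show ?case using i by simp
        qed
      qed
      then show ?thesis using True by simp
    next
      case False
      then show ?thesis using t by (simp add: case_nat_count_cylinder_0)
    qed
  qed
  also have "\<dots> = ennreal (exp (- l * t)) * (\<integral>\<^sup>+s. \<integral>\<^sup>+y. g (case_nat s y) \<partial>S \<partial>E)"
    by (rule exponential_shift[OF _ t]) measurable
  finally show ?thesis by (subst nn_integral_S) auto
qed

text \<open>Induction on the number of points up to \<open>t\<close>: after a first gap
  \<open>s \<le> t\<close> there is one point less to see up to \<open>t - s\<close>, and the
  residual process is unchanged by \<open>residual_gaps_case_nat\<close>. Without points,
  \<open>f\<close> is constant and the first gap is memoryless.\<close>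

lemma residual_independent_count_cylinder:
  assumes [measurable]: "f \<in> borel_measurable S" "g \<in> borel_measurable S" and "0 \<le> t"
    and "\<forall>y\<in>count_cylinder k t. \<forall>y'\<in>count_cylinder k t. (\<forall>n<k. y n = y' n) \<longrightarrow> f y = f y'"
  shows "(\<integral>\<^sup>+y. f y * indicator (count_cylinder k t) y * g (residual_gaps t y) \<partial>S) =
    (\<integral>\<^sup>+y. f y * indicator (count_cylinder k t) y \<partial>S) * (\<integral>\<^sup>+y. g y \<partial>S)"
  using assms(1,3,4)
proof (induction k arbitrary: t f)
  case 0
  note [measurable] = 0(1)
  \<comment> \<open>Any member of the cylinder serves to name the constant value of
    \<open>f\<close>; constant gaps \<open>t + 1\<close> are one.\<close>
  define c where "c = f (\<lambda>_. t + 1)"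
  have epc: "epoch (\<lambda>_. t + 1) n = real n * (t + 1)" for n by (simp add: epoch_def)
  have "regular_gaps (\<lambda>_. t + 1)"
    unfolding regular_gaps_def epc
  proof (intro conjI allI)
    show "\<exists>n. real m < real n * (t + 1)" for m :: nat
      using 0(2) ex_less_of_nat_mult[of "t + 1" "real m"] by auto
  qed (use 0(2) in auto)
  then have i: "(\<lambda>_. t + 1) \<in> count_cylinder 0 t" using 0(2) unfolding count_cylinder_def by (simp add: epc)
  have f: "f y * indicator (count_cylinder 0 t) y = c * indicator (count_cylinder 0 t) y" for y
  proof (cases "y \<in> count_cylinder 0 t")
    case True
    then have "f y = c" unfolding c_def using 0(3)[rule_format, OF True i] by simp
    then show ?thesis by simp
  qed simp
  have "(\<integral>\<^sup>+y. f y * indicator (count_cylinder 0 t) y * g (residual_gaps t y) \<partial>S) = c * (ennreal (exp (- l * t)) * (\<integral>\<^sup>+y. g y \<partial>S))"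
    unfolding f mult.assoc by (subst nn_integral_cmult) (auto simp: residual_0 0(2))
  moreover have "(\<integral>\<^sup>+y. f y * indicator (count_cylinder 0 t) y \<partial>S) = c * ennreal (exp (- l * t))"
    unfolding f using residual_0[of "\<lambda>_. 1" t] P.emeasure_space_1 0(2)
    by (subst nn_integral_cmult) auto
  ultimately show ?case by (simp add: mult.assoc)
next
  case (Suc k)
  note [measurable] = Suc.prems(1)
  let ?G = "\<integral>\<^sup>+y. g y \<partial>S"
  have ind: "indicator (count_cylinder (Suc k) t) (case_nat s y) = (indicator {0<..t} s * indicator (count_cylinder k (t - s)) y :: ennreal)" for s y
    by (auto simp: indicator_def case_nat_count_cylinder_Suc)
  have "(\<integral>\<^sup>+y. f y * indicator (count_cylinder (Suc k) t) y * g (residual_gaps t y) \<partial>S) =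
    (\<integral>\<^sup>+s. \<integral>\<^sup>+y. f (case_nat s y) * indicator (count_cylinder (Suc k) t) (case_nat s y) * g (residual_gaps t (case_nat s y)) \<partial>S \<partial>E)"
    by (subst nn_integral_S) auto
  also have "\<dots> = (\<integral>\<^sup>+s. (\<integral>\<^sup>+y. f (case_nat s y) * indicator (count_cylinder (Suc k) t) (case_nat s y) \<partial>S) * ?G \<partial>E)"
  proof (rule nn_integral_cong)
    fix s
    show "(\<integral>\<^sup>+y. f (case_nat s y) * indicator (count_cylinder (Suc k) t) (case_nat s y) * g (residual_gaps t (case_nat s y)) \<partial>S) =
      (\<integral>\<^sup>+y. f (case_nat s y) * indicator (count_cylinder (Suc k) t) (case_nat s y) \<partial>S) * ?G"
    proof (cases "0 < s \<and> s \<le> t")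
      case True
      have "(\<integral>\<^sup>+y. f (case_nat s y) * indicator (count_cylinder (Suc k) t) (case_nat s y) * g (residual_gaps t (case_nat s y)) \<partial>S) =
        (\<integral>\<^sup>+y. f (case_nat s y) * indicator (count_cylinder k (t - s)) y * g (residual_gaps (t - s) y) \<partial>S)"
        using True unfolding ind
        by (intro nn_integral_cong) (auto simp: indicator_def count_cylinder_def residual_gaps_case_nat)
      also have "\<dots> = (\<integral>\<^sup>+y. f (case_nat s y) * indicator (count_cylinder k (t - s)) y \<partial>S) * ?G"
      proof (rule Suc.IH)
        show "(\<lambda>y. f (case_nat s y)) \<in> borel_measurable S" by measurable
        show "0 \<le> t - s" using True by simp
        show "\<forall>y\<in>count_cylinder k (t - s). \<forall>y'\<in>count_cylinder k (t - s). (\<forall>n<k. y n = y' n) \<longrightarrow> f (case_nat s y) = f (case_nat s y')"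
        proof (intro ballI impI)
          fix y y' assume "y \<in> count_cylinder k (t - s)" "y' \<in> count_cylinder k (t - s)" "\<forall>n<k. y n = y' n"
          then show "f (case_nat s y) = f (case_nat s y')"
            using True by (intro Suc.prems(3)[rule_format]) (auto simp: case_nat_count_cylinder_Suc split: nat.split)
        qed
      qed
      finally show ?thesis unfolding ind using True by simp
    next
      case False
      then have "indicator {0<..t} s = (0 :: ennreal)" by (auto simp: indicator_def)
      then show ?thesis unfolding ind by simp
    qed
  qed
  also have "\<dots> = (\<integral>\<^sup>+s. \<integral>\<^sup>+y. f (case_nat s y) * indicator (count_cylinder (Suc k) t) (case_nat s y) \<partial>S \<partial>E) * ?G"
    by (rule nn_integral_multc) measurable
  also have "(\<integral>\<^sup>+s. \<integral>\<^sup>+y. f (case_nat s y) * indicator (count_cylinder (Suc k) t) (case_nat s y) \<partial>S \<partial>E) =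
      (\<integral>\<^sup>+y. f y * indicator (count_cylinder (Suc k) t) y \<partial>S)"
    by (rule nn_integral_S[symmetric]) measurable
  finally show ?case .
qed

lemma suminf_indicator_count_cylinder:
  assumes "regular_gaps y" "0 \<le> t"
  shows "(\<Sum>k. indicator (count_cylinder k t) y :: ennreal) = 1"
proof -
  have mem: "y \<in> count_cylinder (num_epochs y t) t"
    using num_epochs_bounds[OF assms] assms(1) by (simp add: count_cylinder_def)
  have i: "indicator (count_cylinder k t) y = (if k = num_epochs y t then 1 else 0 :: ennreal)" for k
  proof (cases "k = num_epochs y t")
    case True
    then show ?thesis using mem by simp
  next
    case False
    then have "y \<notin> count_cylinder k t" using num_epochs_count_cylinder by blast
    then show ?thesis using False by simp
  qed
  show ?thesis
    unfolding i by (rule sums_unique[OF sums_single[of "num_epochs y t" "\<lambda>_. 1"], symmetric])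
qed

text \<open>Sums the statement on cylinders over the number of points up to \<open>t\<close>, which
  is almost surely finite.\<close>

lemma residual_independent:
  assumes [measurable]: "f \<in> borel_measurable S" "g \<in> borel_measurable S" and t: "0 \<le> t" and past: "past_only t f"
  shows "(\<integral>\<^sup>+y. f y * g (residual_gaps t y) \<partial>S) = (\<integral>\<^sup>+y. f y \<partial>S) * (\<integral>\<^sup>+y. g y \<partial>S)"
proof -
  have split: "(\<integral>\<^sup>+y. h y \<partial>S) = (\<Sum>k. \<integral>\<^sup>+y. h y * indicator (count_cylinder k t) y \<partial>S)"
    if [measurable]: "h \<in> borel_measurable S" for h
  proof -
    have "(\<integral>\<^sup>+y. h y \<partial>S) = (\<integral>\<^sup>+y. (\<Sum>k. h y * indicator (count_cylinder k t) y) \<partial>S)"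
    proof (rule nn_integral_cong_AE)
      show "AE y in S. h y = (\<Sum>k. h y * indicator (count_cylinder k t) y)"
        using AE_regular_gaps by eventually_elim (simp add: suminf_indicator_count_cylinder t)
    qed
    also have "\<dots> = (\<Sum>k. \<integral>\<^sup>+y. h y * indicator (count_cylinder k t) y \<partial>S)"
      by (rule nn_integral_suminf) measurable
    finally show ?thesis .
  qed
  have "(\<integral>\<^sup>+y. f y * g (residual_gaps t y) \<partial>S) = (\<Sum>k. \<integral>\<^sup>+y. f y * g (residual_gaps t y) * indicator (count_cylinder k t) y \<partial>S)"
    by (rule split) measurable
  also have "\<dots> = (\<Sum>k. (\<integral>\<^sup>+y. f y * indicator (count_cylinder k t) y \<partial>S) * (\<integral>\<^sup>+y. g y \<partial>S))"
  proof (rule suminf_cong)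
    fix k
    show "(\<integral>\<^sup>+y. f y * g (residual_gaps t y) * indicator (count_cylinder k t) y \<partial>S) = (\<integral>\<^sup>+y. f y * indicator (count_cylinder k t) y \<partial>S) * (\<integral>\<^sup>+y. g y \<partial>S)"
      unfolding mult.assoc[of _ "g _"] mult.commute[of "g _"] mult.assoc[symmetric]
      by (rule residual_independent_count_cylinder[OF assms(1,2) t past[unfolded past_only_def, THEN spec, of k]])
  qed
  also have "\<dots> = (\<integral>\<^sup>+y. f y \<partial>S) * (\<integral>\<^sup>+y. g y \<partial>S)"
    by (subst split[OF assms(1)]) simp
  finally show ?thesis .
qed

text \<open>Gluing two independent copies at index \<open>i\<close> reproduces the law of the
  sequence, and \<open>x i\<close> becomes the first gap of the second copy. The condition on
  \<open>F\<close> is confined to positive sequences, which carry the full mass.\<close>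

lemma component_independent:
  assumes [measurable]: "F \<in> borel_measurable S" "h \<in> borel_measurable borel"
    and F: "\<And>x x'. (\<forall>n. 0 < x n) \<Longrightarrow> (\<forall>n. 0 < x' n) \<Longrightarrow> (\<forall>n<i. x n = x' n) \<Longrightarrow> F x = F x'"
  shows "(\<integral>\<^sup>+x. F x * h (x i) \<partial>S) = (\<integral>\<^sup>+x. F x \<partial>S) * (\<integral>\<^sup>+s. h s \<partial>E)"
proof -
  have comb: "(\<integral>\<^sup>+x. f x \<partial>S) = (\<integral>\<^sup>+x. \<integral>\<^sup>+x'. f (comb_seq i x x') \<partial>S \<partial>S)" if [measurable]: "f \<in> borel_measurable S" for f
  proof -
    have "(\<integral>\<^sup>+x. f x \<partial>S) = (\<integral>\<^sup>+x. f x \<partial>distr (S \<Otimes>\<^sub>M S) S (\<lambda>(x, x'). comb_seq i x x'))"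
      by (simp only: PiM_comb_seq)
    also have "\<dots> = (\<integral>\<^sup>+w. f (case_prod (comb_seq i) w) \<partial>(S \<Otimes>\<^sub>M S))"
      by (subst nn_integral_distr) (auto simp: split_beta' intro: measurable_comb_seq)
    also have "\<dots> = (\<integral>\<^sup>+x. \<integral>\<^sup>+x'. f (comb_seq i x x') \<partial>S \<partial>S)"
      using measurable_compose[OF measurable_comb_seq that]
      by (subst P.nn_integral_fst[symmetric]) auto
    finally show ?thesis .
  qed
  have pos: "AE x in S. \<forall>n. 0 < x n"
    using AE_regular_gaps by eventually_elim (simp add: regular_gaps_def)
  \<comment> \<open>The gaps from \<open>i\<close> on are filled with the constant \<open>1\<close>,
    which turns \<open>F\<close> into a function of the first copy alone; any positive value would
    do.\<close>
  define F' where "F' x = F (comb_seq i x (\<lambda>_. 1))" for x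
  have c: "(\<lambda>_. 1) \<in> space S" by (simp add: space_PiM)
  have [measurable]: "F' \<in> borel_measurable S" unfolding F'_def using c by measurable
  have eq: "F (comb_seq i x x') = F' x" if "\<forall>n. 0 < x n" "\<forall>n. 0 < x' n" for x x'
    unfolding F'_def using that by (intro F) (auto simp: comb_seq_def)
  have A: "(\<integral>\<^sup>+x. F x * k (x i) \<partial>S) = (\<integral>\<^sup>+x. F' x \<partial>S) * (\<integral>\<^sup>+x. k (x 0) \<partial>S)"
    if [measurable]: "k \<in> borel_measurable borel" for k :: "real \<Rightarrow> ennreal"
  proof -
    have "(\<integral>\<^sup>+x. F x * k (x i) \<partial>S) = (\<integral>\<^sup>+x. \<integral>\<^sup>+x'. F (comb_seq i x x') * k (comb_seq i x x' i) \<partial>S \<partial>S)"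
      by (rule comb) measurable
    also have "\<dots> = (\<integral>\<^sup>+x. \<integral>\<^sup>+x'. F' x * k (x' 0) \<partial>S \<partial>S)"
    proof (rule nn_integral_cong_AE)
      show "AE x in S. (\<integral>\<^sup>+x'. F (comb_seq i x x') * k (comb_seq i x x' i) \<partial>S) = (\<integral>\<^sup>+x'. F' x * k (x' 0) \<partial>S)"
        using pos
      proof eventually_elim
        case (elim x)
        show ?case
        proof (rule nn_integral_cong_AE)
          show "AE x' in S. F (comb_seq i x x') * k (comb_seq i x x' i) = F' x * k (x' 0)"
            using pos by eventually_elim (use elim in \<open>simp add: eq, simp add: comb_seq_def\<close>)
        qed
      qed
    qed
    also have "\<dots> = (\<integral>\<^sup>+x. F' x * (\<integral>\<^sup>+x'. k (x' 0) \<partial>S) \<partial>S)"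
      by (intro nn_integral_cong nn_integral_cmult) measurable
    also have "\<dots> = (\<integral>\<^sup>+x. F' x \<partial>S) * (\<integral>\<^sup>+x. k (x 0) \<partial>S)"
      by (rule nn_integral_multc) measurable
    finally show ?thesis .
  qed
  have "(\<integral>\<^sup>+x. F x \<partial>S) = (\<integral>\<^sup>+x. F' x \<partial>S)"
    using A[of "\<lambda>_. 1"] P.emeasure_space_1 by simp
  moreover have "(\<integral>\<^sup>+x. h (x 0) \<partial>S) = (\<integral>\<^sup>+s. h s \<partial>E)"
    using P.emeasure_space_1 by (subst nn_integral_S) auto
  ultimately show ?thesis using A[OF assms(2)] by simp
qed

end

text \<open>The whole sequence \<open>b\<close> of Bernoulli outcomes counts as known from the start; it is independent
  of both point processes.\<close>

definition adapted :: "nat \<Rightarrow> ((nat \<Rightarrow> real) \<Rightarrow> (nat \<Rightarrow> real) \<Rightarrow> 'b \<Rightarrow> 'c) \<Rightarrow> bool" where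
  "adapted i f \<longleftrightarrow> (\<forall>x x' y y' b k. (\<forall>n. 0 < x n) \<longrightarrow> (\<forall>n. 0 < x' n) \<longrightarrow> (\<forall>n<i. x n = x' n) \<longrightarrow>
     y \<in> count_cylinder k (epoch x i) \<longrightarrow> y' \<in> count_cylinder k (epoch x i) \<longrightarrow> (\<forall>n<k. y n = y' n) \<longrightarrow>
     f x y b = f x' y' b)"

text \<open>The Markov property of the inputs at arrival \<open>i\<close>: given the history, the
  gap \<open>x i\<close> and the departures restarted at \<open>epoch x i\<close> have their
  original laws. Departures are integrated first, while \<open>x\<close> and hence the time
  \<open>epoch x i\<close> are fixed; the gap \<open>x i\<close> comes last.\<close>

lemma one_step_product:
  fixes f :: "(nat \<Rightarrow> real) \<Rightarrow> (nat \<Rightarrow> real) \<Rightarrow> 'b \<Rightarrow> ennreal" and g :: "real \<Rightarrow> (nat \<Rightarrow> real) \<Rightarrow> ennreal"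
    and lam mu :: real and SB :: "'b measure"
  defines "Sx \<equiv> \<Pi>\<^sub>M n\<in>(UNIV::nat set). density lborel (exponential_density lam)"
    and "Sy \<equiv> \<Pi>\<^sub>M n\<in>(UNIV::nat set). density lborel (exponential_density mu)"
  assumes "0 < lam" "0 < mu" "prob_space SB"
    and f: "(\<lambda>w. f (fst w) (snd (snd w)) (fst (snd w))) \<in> borel_measurable (Sx \<Otimes>\<^sub>M (SB \<Otimes>\<^sub>M Sy))"
    and g: "(\<lambda>w. g (fst w) (snd w)) \<in> borel_measurable (borel \<Otimes>\<^sub>M Sy)"
    and adapted: "adapted i f"
  shows "(\<integral>\<^sup>+w. f (fst w) (snd (snd w)) (fst (snd w)) *
        g (fst w i) (residual_gaps (epoch (fst w) i) (snd (snd w))) \<partial>(Sx \<Otimes>\<^sub>M (SB \<Otimes>\<^sub>M Sy))) =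
    (\<integral>\<^sup>+w. f (fst w) (snd (snd w)) (fst (snd w)) \<partial>(Sx \<Otimes>\<^sub>M (SB \<Otimes>\<^sub>M Sy))) *
    (\<integral>\<^sup>+s. \<integral>\<^sup>+y. g s y \<partial>Sy \<partial>density lborel (exponential_density lam))"
proof -
  interpret X: exponential_sequence lam by unfold_locales fact
  interpret Y: exponential_sequence mu by unfold_locales fact
  interpret SB: prob_space SB by fact
  interpret BY: pair_prob_space SB Y.S by unfold_locales
  have Sx: "Sx = X.S" and Sy: "Sy = Y.S" by (simp_all add: Sx_def Sy_def)
  note [measurable] = f[unfolded Sx Sy] g[unfolded Sy]
  have iter: "(\<integral>\<^sup>+w. h w \<partial>(Sx \<Otimes>\<^sub>M (SB \<Otimes>\<^sub>M Sy))) = (\<integral>\<^sup>+x. \<integral>\<^sup>+b. \<integral>\<^sup>+y. h (x, b, y) \<partial>Y.S \<partial>SB \<partial>X.S)"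
    if h [measurable]: "h \<in> borel_measurable (X.S \<Otimes>\<^sub>M (SB \<Otimes>\<^sub>M Y.S))" for h
  proof -
    have "(\<integral>\<^sup>+w. h w \<partial>(Sx \<Otimes>\<^sub>M (SB \<Otimes>\<^sub>M Sy))) = (\<integral>\<^sup>+x. \<integral>\<^sup>+w. h (x, w) \<partial>(SB \<Otimes>\<^sub>M Y.S) \<partial>X.S)"
      unfolding Sx Sy by (rule BY.nn_integral_fst[symmetric]) (rule h)
    also have "\<dots> = (\<integral>\<^sup>+x. \<integral>\<^sup>+b. \<integral>\<^sup>+y. h (x, b, y) \<partial>Y.S \<partial>SB \<partial>X.S)"
    proof (rule nn_integral_cong)
      fix x assume "x \<in> space X.S"
      then have "(\<lambda>w. h (x, w)) \<in> borel_measurable (SB \<Otimes>\<^sub>M Y.S)" by measurable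
      from Y.P.nn_integral_fst[OF this]
      show "(\<integral>\<^sup>+w. h (x, w) \<partial>(SB \<Otimes>\<^sub>M Y.S)) = (\<integral>\<^sup>+b. \<integral>\<^sup>+y. h (x, b, y) \<partial>Y.S \<partial>SB)" by simp
    qed
    finally show ?thesis .
  qed
  define G where "G s = (\<integral>\<^sup>+y. g s y \<partial>Y.S)" for s
  have [measurable]: "G \<in> borel_measurable borel"
    unfolding G_def by (rule Y.P.borel_measurable_nn_integral) (simp add: split_beta')
  define F where "F x = (\<integral>\<^sup>+b. \<integral>\<^sup>+y. f x y b \<partial>Y.S \<partial>SB)" for x
  have f': "(\<lambda>w. f (fst (fst w)) (snd w) (snd (fst w))) \<in> borel_measurable ((X.S \<Otimes>\<^sub>M SB) \<Otimes>\<^sub>M Y.S)"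
  proof -
    have "(\<lambda>w. (fst (fst w), snd (fst w), snd w)) \<in> measurable ((X.S \<Otimes>\<^sub>M SB) \<Otimes>\<^sub>M Y.S) (X.S \<Otimes>\<^sub>M (SB \<Otimes>\<^sub>M Y.S))"
      by measurable
    from measurable_compose[OF this f[unfolded Sx Sy]] show ?thesis by simp
  qed
  have "(\<lambda>w. \<integral>\<^sup>+y. f (fst w) y (snd w) \<partial>Y.S) \<in> borel_measurable (X.S \<Otimes>\<^sub>M SB)"
    by (rule Y.P.borel_measurable_nn_integral) (use f' in \<open>simp add: split_beta'\<close>)
  then have [measurable]: "F \<in> borel_measurable X.S"
    unfolding F_def by (intro SB.borel_measurable_nn_integral) (simp add: split_beta')
  have fb: "(\<lambda>y. f x y b) \<in> borel_measurable Y.S" if "x \<in> space X.S" "b \<in> space SB" for x b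
  proof -
    have "(\<lambda>y. (x, b, y)) \<in> measurable Y.S (X.S \<Otimes>\<^sub>M (SB \<Otimes>\<^sub>M Y.S))" using that by measurable
    from measurable_compose[OF this f[unfolded Sx Sy]] show ?thesis by simp
  qed
  have pos: "AE x in X.S. \<forall>n. 0 < x n"
    using X.AE_regular_gaps by eventually_elim (simp add: regular_gaps_def)
  have "(\<lambda>w. epoch (fst w) i) \<in> borel_measurable (X.S \<Otimes>\<^sub>M (SB \<Otimes>\<^sub>M Y.S))"
    by (rule measurable_compose[OF measurable_fst X.epoch_measurable])
  then have res [measurable]: "(\<lambda>w. residual_gaps (epoch (fst w) i) (snd (snd w))) \<in> measurable (X.S \<Otimes>\<^sub>M (SB \<Otimes>\<^sub>M Y.S)) Y.S"
    by (rule Y.residual_measurable) measurable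
  have xi [measurable]: "(\<lambda>w. fst w i) \<in> borel_measurable (X.S \<Otimes>\<^sub>M (SB \<Otimes>\<^sub>M Y.S))"
    by (rule measurable_compose[OF measurable_fst X.component_measurable])
  have "(\<lambda>w. g (fst w i) (residual_gaps (epoch (fst w) i) (snd (snd w)))) \<in> borel_measurable (X.S \<Otimes>\<^sub>M (SB \<Otimes>\<^sub>M Y.S))"
    using measurable_compose[OF measurable_Pair[OF xi res] g[unfolded Sy]] by simp
  then have "(\<integral>\<^sup>+w. f (fst w) (snd (snd w)) (fst (snd w)) *
        g (fst w i) (residual_gaps (epoch (fst w) i) (snd (snd w))) \<partial>(Sx \<Otimes>\<^sub>M (SB \<Otimes>\<^sub>M Sy))) =
     (\<integral>\<^sup>+x. \<integral>\<^sup>+b. \<integral>\<^sup>+y. f x y b * g (x i) (residual_gaps (epoch x i) y) \<partial>Y.S \<partial>SB \<partial>X.S)"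
    by (subst iter) (use f[unfolded Sx Sy] in simp_all)
  also have "\<dots> = (\<integral>\<^sup>+x. F x * G (x i) \<partial>X.S)"
  proof (rule nn_integral_cong_AE)
    show "AE x in X.S. (\<integral>\<^sup>+b. \<integral>\<^sup>+y. f x y b * g (x i) (residual_gaps (epoch x i) y) \<partial>Y.S \<partial>SB) = F x * G (x i)"
      using pos AE_space
    proof eventually_elim
      case (elim x)
      have gx: "(\<lambda>y. g (x i) y) \<in> borel_measurable Y.S"
      proof -
        have "(\<lambda>y. (x i, y)) \<in> measurable Y.S (borel \<Otimes>\<^sub>M Y.S)" by measurable
        from measurable_compose[OF this g[unfolded Sy]] show ?thesis by simp
      qed
      have "(\<integral>\<^sup>+b. \<integral>\<^sup>+y. f x y b * g (x i) (residual_gaps (epoch x i) y) \<partial>Y.S \<partial>SB) =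
        (\<integral>\<^sup>+b. (\<integral>\<^sup>+y. f x y b \<partial>Y.S) * G (x i) \<partial>SB)"
      proof (rule nn_integral_cong)
        fix b assume b: "b \<in> space SB"
        show "(\<integral>\<^sup>+y. f x y b * g (x i) (residual_gaps (epoch x i) y) \<partial>Y.S) = (\<integral>\<^sup>+y. f x y b \<partial>Y.S) * G (x i)"
          unfolding G_def
        proof (rule Y.residual_independent[OF fb[OF elim(2) b] gx])
          show "0 \<le> epoch x i" by (rule epoch_nonneg[OF elim(1)])
          show "past_only (epoch x i) (\<lambda>y. f x y b)"
            unfolding past_only_def using adapted[unfolded adapted_def] elim(1) by blast
        qed
      qed
      also have "\<dots> = F x * G (x i)"
        unfolding F_def
      proof (rule nn_integral_multc)
        have "(\<lambda>y. f x (snd y) (fst y)) \<in> borel_measurable (SB \<Otimes>\<^sub>M Y.S)"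
        proof -
          have "(\<lambda>y. (x, y)) \<in> measurable (SB \<Otimes>\<^sub>M Y.S) (X.S \<Otimes>\<^sub>M (SB \<Otimes>\<^sub>M Y.S))" using elim(2) by measurable
          from measurable_compose[OF this f[unfolded Sx Sy]] show ?thesis by simp
        qed
        then show "(\<lambda>b. \<integral>\<^sup>+y. f x y b \<partial>Y.S) \<in> borel_measurable SB"
          by (intro Y.P.borel_measurable_nn_integral) (simp add: split_beta')
      qed
      finally show ?case .
    qed
  qed
  also have "\<dots> = (\<integral>\<^sup>+x. F x \<partial>X.S) * (\<integral>\<^sup>+s. G s \<partial>X.E)"
  proof (rule X.component_independent)
    fix x x' :: "nat \<Rightarrow> real"
    assume x: "\<forall>n. 0 < x n" "\<forall>n. 0 < x' n" "\<forall>n<i. x n = x' n"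
    \<comment> \<open>\<open>adapted\<close> with both departure paths equal to \<open>y\<close>:
      arrival gaps from index \<open>i\<close> on have no influence.\<close>
    have "f x y b = f x' y b" if "regular_gaps y" for y b
    proof -
      have "y \<in> count_cylinder (num_epochs y (epoch x i)) (epoch x i)"
        using num_epochs_bounds[OF that epoch_nonneg[OF x(1)]] that by (simp add: count_cylinder_def)
      then show ?thesis using adapted[unfolded adapted_def] x by blast
    qed
    then have "AE y in Y.S. f x y b = f x' y b" for b
      using Y.AE_regular_gaps by (auto elim: eventually_mono)
    then show "F x = F x'" unfolding F_def by (intro nn_integral_cong nn_integral_cong_AE) auto
  qed measurable
  also have "(\<integral>\<^sup>+x. F x \<partial>X.S) = (\<integral>\<^sup>+w. f (fst w) (snd (snd w)) (fst (snd w)) \<partial>(Sx \<Otimes>\<^sub>M (SB \<Otimes>\<^sub>M Sy)))"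
    unfolding F_def by (subst iter) (use f[unfolded Sx Sy] in simp_all)
  finally show ?thesis unfolding G_def Sy .
qed

section \<open>The joint law of arrivals, potential departures and trials\<close>

locale input_model = prob_space M for M :: "'a measure" +
  fixes X Y B :: "nat \<Rightarrow> 'a \<Rightarrow> real" and lam mu :: real
  assumes lam_pos: "0 < lam" and mu_pos: "0 < mu"
    and X_distr: "\<And>n. distributed M lborel (X n) (exponential_density lam)"
    and Y_distr: "\<And>n. distributed M lborel (Y n) (exponential_density mu)"
    and indep: "indep_vars (\<lambda>_. borel) (case_sum X (case_sum Y B)) (UNIV <+> (UNIV <+> {1..}))"
begin

definition xs :: "'a \<Rightarrow> nat \<Rightarrow> real" where "xs \<omega> n = X n \<omega>"
definition ys :: "'a \<Rightarrow> nat \<Rightarrow> real" where "ys \<omega> n = Y n \<omega>"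

text \<open>\<open>B 0\<close> is not part of the model (it need not even be measurable).\<close>

definition bs :: "'a \<Rightarrow> nat \<Rightarrow> bool" where "bs \<omega> j \<longleftrightarrow> 1 \<le> j \<and> B j \<omega> = 1"

abbreviation "Sx \<equiv> \<Pi>\<^sub>M n\<in>(UNIV::nat set). density lborel (exponential_density lam)"
abbreviation "Sy \<equiv> \<Pi>\<^sub>M n\<in>(UNIV::nat set). density lborel (exponential_density mu)"
abbreviation "Sbool \<equiv> \<Pi>\<^sub>M n\<in>(UNIV::nat set). count_space (UNIV :: bool set)"
abbreviation "SB \<equiv> distr M Sbool bs"

lemma X_rv: "X n \<in> borel_measurable M"
  using distributed_measurable[OF X_distr[of n]] by simp

lemma Y_rv: "Y n \<in> borel_measurable M"
  using distributed_measurable[OF Y_distr[of n]] by simp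

lemma indep_sub:
  assumes "\<And>j. j \<in> J \<Longrightarrow> f j \<in> UNIV <+> (UNIV <+> {1..})" "inj f"
  shows "indep_vars (\<lambda>_. borel) (\<lambda>j. case_sum X (case_sum Y B) (f j)) J"
proof -
  have "indep_vars (\<lambda>j. PiM {f j} (\<lambda>_. borel)) (\<lambda>j \<omega>. restrict (\<lambda>i. case_sum X (case_sum Y B) i \<omega>) {f j}) J"
    by (rule indep_vars_restrict[OF indep]) (use assms in \<open>auto simp: disjoint_family_on_def inj_def\<close>)
  from indep_vars_compose2[OF this, of "\<lambda>j z. z (f j)" "\<lambda>_. borel"]
  show ?thesis by simp
qed

lemma indep_X: "indep_vars (\<lambda>_. borel) X UNIV"
  using indep_sub[of UNIV Inl] by (auto simp: inj_def)

lemma indep_Y: "indep_vars (\<lambda>_. borel) Y UNIV"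
  using indep_sub[of UNIV "\<lambda>n. Inr (Inl n)"] by (auto simp: inj_def)

lemma indep_B: "indep_vars (\<lambda>_. borel) B {1..}"
  using indep_sub[of "{1..}" "\<lambda>n. Inr (Inr n)"] by (auto simp: inj_def)

lemma B_rv: "1 \<le> j \<Longrightarrow> B j \<in> borel_measurable M"
  using indep_B by (simp add: indep_vars_def)

lemma distr_seq:
  assumes d: "\<And>n. distributed M lborel (Z n) (exponential_density l)" and i: "indep_vars (\<lambda>_. borel) Z (UNIV :: nat set)"
  shows "distr M (\<Pi>\<^sub>M n\<in>UNIV. borel) (\<lambda>\<omega> n. Z n \<omega>) = (\<Pi>\<^sub>M n\<in>UNIV. density lborel (exponential_density l))"
proof -
  have rv: "Z n \<in> borel_measurable M" for n using distributed_measurable[OF d[of n]] by simp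
  have 1: "distr M (\<Pi>\<^sub>M n\<in>UNIV. borel) (\<lambda>\<omega> n. Z n \<omega>) = (\<Pi>\<^sub>M n\<in>UNIV. distr M borel (Z n))"
    using i by (subst (asm) indep_vars_iff_distr_eq_PiM) (auto simp: rv restrict_def)
  have 2: "distr M borel (Z n) = density lborel (exponential_density l)" for n
  proof -
    have "distr M borel (Z n) = distr M lborel (Z n)" by (rule distr_cong) auto
    also have "\<dots> = density lborel (exponential_density l)" by (rule distributed_distr_eq_density[OF d])
    finally show ?thesis .
  qed
  show ?thesis unfolding 1 2 ..
qed

lemma measurable_xs [measurable]: "xs \<in> measurable M (\<Pi>\<^sub>M n\<in>UNIV. borel)"
  and measurable_ys [measurable]: "ys \<in> measurable M (\<Pi>\<^sub>M n\<in>UNIV. borel)"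
  and measurable_bs [measurable]: "bs \<in> measurable M Sbool"
proof -
  show "xs \<in> measurable M (\<Pi>\<^sub>M n\<in>UNIV. borel)" "ys \<in> measurable M (\<Pi>\<^sub>M n\<in>UNIV. borel)"
    by (auto intro!: measurable_PiM_single' simp: xs_def ys_def X_rv Y_rv)
  have "Measurable.pred M (\<lambda>\<omega>. bs \<omega> j)" for j
  proof (cases "1 \<le> j")
    case True
    note [measurable] = B_rv[OF True]
    show ?thesis unfolding bs_def by measurable
  qed (simp add: bs_def)
  then show "bs \<in> measurable M Sbool"
    by (auto intro!: measurable_PiM_single')
qed

lemma distr_pair_indep:
  assumes i: "indep_var S1 r1 S2 r2" and f [measurable]: "f \<in> measurable S1 T1" and g [measurable]: "g \<in> measurable S2 T2"
  shows "distr M (T1 \<Otimes>\<^sub>M T2) (\<lambda>\<omega>. (f (r1 \<omega>), g (r2 \<omega>))) =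
    distr M T1 (\<lambda>\<omega>. f (r1 \<omega>)) \<Otimes>\<^sub>M distr M T2 (\<lambda>\<omega>. g (r2 \<omega>))"
proof -
  have r [measurable]: "r1 \<in> measurable M S1" "r2 \<in> measurable M S2"
    and eq: "distr M S1 r1 \<Otimes>\<^sub>M distr M S2 r2 = distr M (S1 \<Otimes>\<^sub>M S2) (\<lambda>x. (r1 x, r2 x))"
    using i unfolding indep_var_distribution_eq by auto
  have d: "distr M T1 (\<lambda>\<omega>. f (r1 \<omega>)) = distr (distr M S1 r1) T1 f" "distr M T2 (\<lambda>\<omega>. g (r2 \<omega>)) = distr (distr M S2 r2) T2 g"
    by (simp_all add: distr_distr comp_def)
  interpret D: prob_space "distr (distr M S2 r2) T2 g"
    unfolding d[symmetric] by (rule prob_space_distr) measurable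
  have "distr (distr M S1 r1) T1 f \<Otimes>\<^sub>M distr (distr M S2 r2) T2 g =
      distr (distr M S1 r1 \<Otimes>\<^sub>M distr M S2 r2) (T1 \<Otimes>\<^sub>M T2) (\<lambda>(x, y). (f x, g y))"
    by (rule pair_measure_distr) (auto intro: D.sigma_finite_measure_axioms)
  also have "\<dots> = distr M (T1 \<Otimes>\<^sub>M T2) (\<lambda>\<omega>. (f (r1 \<omega>), g (r2 \<omega>)))"
    unfolding eq by (subst distr_distr) (auto simp: comp_def)
  finally show ?thesis unfolding d ..
qed

text \<open>Moves expectations to a product space, where iterated integration is available. The
  index set is split in two steps, arrivals from the rest and then trials from departures; the law
  of the trials is kept abstract as \<open>SB\<close>.\<close>

lemma joint_distr:
  "distr M (Sx \<Otimes>\<^sub>M (SB \<Otimes>\<^sub>M Sy)) (\<lambda>\<omega>. (xs \<omega>, bs \<omega>, ys \<omega>)) = Sx \<Otimes>\<^sub>M (SB \<Otimes>\<^sub>M Sy)"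
proof -
  let ?P = "\<Pi>\<^sub>M n\<in>(UNIV::nat set). borel :: real measure"
  let ?Z = "case_sum X (case_sum Y B)"
  let ?b = "\<lambda>z j. 1 \<le> j \<and> z (Inr (Inr j)) = (1::real)"
  have bm: "?b \<in> measurable (PiM A (\<lambda>_. borel)) Sbool" if "Inr ` Inr ` {1..} \<subseteq> A" for A :: "(nat + nat + nat) set"
  proof (rule measurable_PiM_single')
    fix j :: nat
    show "(\<lambda>z. ?b z j) \<in> measurable (PiM A (\<lambda>_. borel)) (count_space UNIV)"
    proof (cases "1 \<le> j")
      case True
      then have "Inr (Inr j) \<in> A" using that by auto
      then have [measurable]: "(\<lambda>z. z (Inr (Inr j))) \<in> measurable (PiM A (\<lambda>_. borel)) (borel :: real measure)"
        by (rule measurable_component_singleton)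
      show ?thesis by measurable
    qed simp
  qed simp
  have ym: "(\<lambda>z n. z (Inr (Inl n))) \<in> measurable (PiM A (\<lambda>_. borel)) ?P" if "range (\<lambda>n. Inr (Inl n)) \<subseteq> A" for A :: "(nat + nat + nat) set"
    by (rule measurable_PiM_single') (use that in \<open>auto intro!: measurable_component_singleton\<close>)
  have xm: "(\<lambda>z n. z (Inl n)) \<in> measurable (PiM A (\<lambda>_. borel)) ?P" if "range Inl \<subseteq> A" for A :: "(nat + nat + nat) set"
    by (rule measurable_PiM_single') (use that in \<open>auto intro!: measurable_component_singleton\<close>)
  have i1: "indep_var (PiM (range Inl) (\<lambda>_. borel)) (\<lambda>\<omega>. restrict (\<lambda>i. ?Z i \<omega>) (range Inl))
      (PiM (Inr ` (UNIV <+> {1..})) (\<lambda>_. borel)) (\<lambda>\<omega>. restrict (\<lambda>i. ?Z i \<omega>) (Inr ` (UNIV <+> {1..})))"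
    by (rule indep_var_restrict[OF indep]) auto
  have m: "(\<lambda>z. (?b z, \<lambda>n. z (Inr (Inl n)))) \<in> (\<Pi>\<^sub>M _\<in>(Inr ` (UNIV <+> {1..}) :: (nat + nat + nat) set). borel) \<rightarrow>\<^sub>M Sbool \<Otimes>\<^sub>M ?P"
    by (rule measurable_Pair[OF bm ym]) (auto simp: Plus_def)
  have e1: "(\<lambda>\<omega> n. restrict (\<lambda>i. ?Z i \<omega>) (range Inl) (Inl n)) = xs"
    by (auto simp: fun_eq_iff xs_def)
  have e2: "(\<lambda>\<omega>. (?b (restrict (\<lambda>i. ?Z i \<omega>) (Inr ` (UNIV <+> {1..}))),
      \<lambda>n. restrict (\<lambda>i. ?Z i \<omega>) (Inr ` (UNIV <+> {1..})) (Inr (Inl n)))) = (\<lambda>\<omega>. (bs \<omega>, ys \<omega>))"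
    by (auto simp: fun_eq_iff bs_def ys_def Plus_def image_iff)
  note 1 = distr_pair_indep[OF i1 xm[OF order_refl] m, unfolded e1 e2]
  have i2: "indep_var (PiM (Inr ` Inr ` {1..}) (\<lambda>_. borel)) (\<lambda>\<omega>. restrict (\<lambda>i. ?Z i \<omega>) (Inr ` Inr ` {1..}))
      (PiM (range (\<lambda>n. Inr (Inl n))) (\<lambda>_. borel)) (\<lambda>\<omega>. restrict (\<lambda>i. ?Z i \<omega>) (range (\<lambda>n. Inr (Inl n))))"
    by (rule indep_var_restrict[OF indep]) auto
  have e3: "(\<lambda>\<omega>. ?b (restrict (\<lambda>i. ?Z i \<omega>) (Inr ` Inr ` {1..}))) = bs"
    by (auto simp: fun_eq_iff bs_def image_iff)
  have e4: "(\<lambda>\<omega> n. restrict (\<lambda>i. ?Z i \<omega>) (range (\<lambda>n. Inr (Inl n))) (Inr (Inl n))) = ys"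
    by (auto simp: fun_eq_iff ys_def)
  note 2 = distr_pair_indep[OF i2 bm[OF order_refl] ym[OF order_refl], unfolded e3 e4]
  have dx: "distr M ?P xs = Sx" unfolding xs_def[abs_def] by (rule distr_seq[OF X_distr indep_X])
  have dy: "distr M ?P ys = Sy" unfolding ys_def[abs_def] by (rule distr_seq[OF Y_distr indep_Y])
  have "distr M (?P \<Otimes>\<^sub>M (Sbool \<Otimes>\<^sub>M ?P)) (\<lambda>\<omega>. (xs \<omega>, bs \<omega>, ys \<omega>)) = Sx \<Otimes>\<^sub>M (SB \<Otimes>\<^sub>M Sy)"
    using 1 2 e1 e2 e3 e4 dx dy by (simp add: fun_eq_iff)
  moreover have "distr M (Sx \<Otimes>\<^sub>M (SB \<Otimes>\<^sub>M Sy)) (\<lambda>\<omega>. (xs \<omega>, bs \<omega>, ys \<omega>)) = distr M (?P \<Otimes>\<^sub>M (Sbool \<Otimes>\<^sub>M ?P)) (\<lambda>\<omega>. (xs \<omega>, bs \<omega>, ys \<omega>))"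
    by (intro distr_cong refl sets_pair_measure_cong sets_PiM_cong) auto
  ultimately show ?thesis by simp
qed

lemma measurable_inputs [measurable]: "(\<lambda>\<omega>. (xs \<omega>, bs \<omega>, ys \<omega>)) \<in> measurable M (Sx \<Otimes>\<^sub>M (SB \<Otimes>\<^sub>M Sy))"
proof -
  have "sets (Sx \<Otimes>\<^sub>M (SB \<Otimes>\<^sub>M Sy)) = sets ((\<Pi>\<^sub>M n\<in>UNIV. borel) \<Otimes>\<^sub>M (Sbool \<Otimes>\<^sub>M (\<Pi>\<^sub>M n\<in>UNIV. borel)))"
    by (intro sets_pair_measure_cong sets_PiM_cong) auto
  then show ?thesis by (subst measurable_cong_sets[OF refl]) measurable
qed

lemma one_step:
  fixes f :: "(nat \<Rightarrow> real) \<Rightarrow> (nat \<Rightarrow> real) \<Rightarrow> (nat \<Rightarrow> bool) \<Rightarrow> ennreal" and g :: "real \<Rightarrow> (nat \<Rightarrow> real) \<Rightarrow> ennreal"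
  assumes f: "(\<lambda>w. f (fst w) (snd (snd w)) (fst (snd w))) \<in> borel_measurable (Sx \<Otimes>\<^sub>M (SB \<Otimes>\<^sub>M Sy))"
    and g: "(\<lambda>w. g (fst w) (snd w)) \<in> borel_measurable (borel \<Otimes>\<^sub>M Sy)"
    and adapted: "adapted i f"
  shows "(\<integral>\<^sup>+\<omega>. f (xs \<omega>) (ys \<omega>) (bs \<omega>) * g (xs \<omega> i) (residual_gaps (epoch (xs \<omega>) i) (ys \<omega>)) \<partial>M) =
    (\<integral>\<^sup>+\<omega>. f (xs \<omega>) (ys \<omega>) (bs \<omega>) \<partial>M) * (\<integral>\<^sup>+s. \<integral>\<^sup>+y. g s y \<partial>Sy \<partial>density lborel (exponential_density lam))"
proof -
  let ?N = "Sx \<Otimes>\<^sub>M (SB \<Otimes>\<^sub>M Sy)"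
  interpret XX: exponential_sequence lam by unfold_locales (rule lam_pos)
  interpret YY: exponential_sequence mu by unfold_locales (rule mu_pos)
  have SB: "prob_space SB" by (rule prob_space_distr) (rule measurable_bs)
  have tr: "(\<integral>\<^sup>+\<omega>. h (xs \<omega>, bs \<omega>, ys \<omega>) \<partial>M) = (\<integral>\<^sup>+w. h w \<partial>?N)" if "h \<in> borel_measurable ?N" for h
    using nn_integral_distr[OF measurable_inputs, of h] that unfolding joint_distr by simp
  have "(\<lambda>w. epoch (fst w) i) \<in> borel_measurable ?N"
    by (rule measurable_compose[OF measurable_fst XX.epoch_measurable])
  then have res: "(\<lambda>w. residual_gaps (epoch (fst w) i) (snd (snd w))) \<in> measurable ?N Sy"
    by (rule YY.residual_measurable) measurable
  have xi: "(\<lambda>w. fst w i) \<in> borel_measurable ?N"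
    by (rule measurable_compose[OF measurable_fst XX.component_measurable])
  have gm: "(\<lambda>w. g (fst w i) (residual_gaps (epoch (fst w) i) (snd (snd w)))) \<in> borel_measurable ?N"
    using measurable_compose[OF measurable_Pair[OF xi res] g] by simp
  show ?thesis
    using one_step_product[OF lam_pos mu_pos SB f g adapted]
      tr[OF borel_measurable_times_ennreal[OF f gm]] tr[OF f] by simp
qed

end

section \<open>The martingale of the observed service times\<close>

text \<open>Two paths that look alike up to \<open>t\<close> look alike up to every earlier time;
  this carries adaptedness forward from one arrival to later ones.\<close>

lemma count_cylinder_earlier:
  assumes "y \<in> count_cylinder k t" "y' \<in> count_cylinder k t" "\<forall>n<k. y n = y' n" "0 \<le> s" "s \<le> t"
  shows "num_epochs y s \<le> k" "y \<in> count_cylinder (num_epochs y s) s" "y' \<in> count_cylinder (num_epochs y s) s"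
proof -
  let ?m = "num_epochs y s"
  have r: "regular_gaps y" "regular_gaps y'" using assms by (auto simp: count_cylinder_def)
  have k: "num_epochs y t = k" by (rule num_epochs_count_cylinder[OF assms(1)])
  show mk: "?m \<le> k" using num_epochs_mono[OF r(1) assms(4,5)] k by simp
  note b = num_epochs_bounds[OF r(1) assms(4)]
  show "y \<in> count_cylinder ?m s" using b r by (simp add: count_cylinder_def)
  have e: "epoch y j = epoch y' j" if "j \<le> k" for j
    by (rule epoch_cong) (use assms(3) that in auto)
  have "s < epoch y' (Suc ?m)"
  proof (cases "?m = k")
    case True
    then show ?thesis using assms(2,5) by (auto simp: count_cylinder_def)
  next
    case False
    then show ?thesis using b(2) e[of "Suc ?m"] mk by simp
  qed
  then show "y' \<in> count_cylinder ?m s" using b(1) e[OF mk] r by (simp add: count_cylinder_def)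
qed

lemma adapted_mono:
  assumes "adapted i f" "i \<le> i'"
  shows "adapted i' f"
  unfolding adapted_def
proof (intro allI impI)
  fix x x' y y' :: "nat \<Rightarrow> real" and b k
  assume a: "\<forall>n. 0 < x n" "\<forall>n. 0 < x' n" "\<forall>n<i'. x n = x' n"
    "y \<in> count_cylinder k (epoch x i')" "y' \<in> count_cylinder k (epoch x i')" "\<forall>n<k. y n = y' n"
  have t: "0 \<le> epoch x i" "epoch x i \<le> epoch x i'"
    using epoch_nonneg[OF a(1)] epoch_le_iff[OF a(1)] assms(2) by auto
  note c = count_cylinder_earlier[OF a(4-6) t]
  show "f x y b = f x' y' b"
    using assms(1)[unfolded adapted_def, rule_format, of x x' y "num_epochs y (epoch x i)" y' b] a c assms(2) by auto
qed

lemma adaptedD: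
  assumes "adapted i f" "\<forall>n. 0 < x n" "\<forall>n. 0 < x' n" "\<forall>n<i. x n = x' n"
    "y \<in> count_cylinder k (epoch x i)" "y' \<in> count_cylinder k (epoch x i)" "\<forall>n<k. y n = y' n"
  shows "f x y b = f x' y' b"
  using assms unfolding adapted_def by blast

lemma adapted_serve:
  assumes "\<forall>n. 0 < x n" "\<forall>n<Suc i. x n = x' n"
    "y \<in> count_cylinder k (epoch x (Suc i))" "y' \<in> count_cylinder k (epoch x (Suc i))" "\<forall>n<k. y n = y' n"
  shows "serve y (epoch x i) (epoch x (Suc i)) st = serve y' (epoch x' i) (epoch x' (Suc i)) st"
proof -
  have e: "epoch x j = epoch x' j" if "j \<le> Suc i" for j
    by (rule epoch_cong) (use assms(2) that in auto)
  have t: "0 \<le> epoch x i" "epoch x i \<le> epoch x (Suc i)"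
    using epoch_nonneg[OF assms(1)] epoch_le_iff[OF assms(1)] by auto
  note c = count_cylinder_earlier[OF assms(3-5) t]
  show ?thesis
    unfolding e[of i, simplified, symmetric] e[of "Suc i", simplified, symmetric]
  proof (rule serve_cong)
    show "num_epochs y (epoch x i) = num_epochs y' (epoch x i)"
      using num_epochs_count_cylinder[OF c(3)] by simp
    show "num_epochs y (epoch x (Suc i)) = num_epochs y' (epoch x (Suc i))"
      using num_epochs_count_cylinder[OF assms(3)] num_epochs_count_cylinder[OF assms(4)] by simp
    show "y n = y' n" if "n < num_epochs y (epoch x (Suc i))" for n
      using that assms(5) num_epochs_count_cylinder[OF assms(3)] by simp
  qed
qed

lemma learned_threshold_cong:
  assumes "\<forall>n<i. x n = x' n"
  shows "learned_threshold p x j i st = learned_threshold p x' j i st"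
proof -
  have "(\<lambda>k. if k < i then x k else 0) = (\<lambda>k. if k < i then x' k else 0)" "(\<Sum>k<i. x k) = (\<Sum>k<i. x' k)"
    using assms by auto
  then show ?thesis unfolding learned_threshold_def by simp
qed

lemma adapted_before_arrival:
  assumes "\<forall>n. 0 < x n" "\<forall>n<Suc i. x n = x' n"
    "y \<in> count_cylinder k (epoch x (Suc i))" "y' \<in> count_cylinder k (epoch x (Suc i))" "\<forall>n<k. y n = y' n"
  shows "before_arrival p x y b (Suc i) s = before_arrival p x' y' b (Suc i) s"
  unfolding before_arrival_def diff_Suc_1 adapted_serve[OF assms] learned_threshold_cong[OF assms(2)] ..

lemma adapted_learner_run: "adapted i (\<lambda>x y b. learner_run p x y b i)"
proof (induction i)
  case 0
  show ?case by (simp add: adapted_def)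
next
  case (Suc i)
  show ?case
    unfolding adapted_def
  proof (intro allI impI)
    fix x x' y y' :: "nat \<Rightarrow> real" and b k
    assume a: "\<forall>n. 0 < x n" "\<forall>n. 0 < x' n" "\<forall>n<Suc i. x n = x' n"
      "y \<in> count_cylinder k (epoch x (Suc i))" "y' \<in> count_cylinder k (epoch x (Suc i))" "\<forall>n<k. y n = y' n"
    have e: "epoch x (Suc i) = epoch x' (Suc i)" by (rule epoch_cong) (use a in auto)
    have h: "handle_arrival p x (Suc i) s = handle_arrival p x' (Suc i) s" for s
      unfolding handle_arrival_def e learned_threshold_cong[OF a(3)] ..
    have r: "learner_run p x y b i = learner_run p x' y' b i"
      by (rule adaptedD[OF adapted_mono[OF Suc le_SucI[OF order_refl]] a])
    show "learner_run p x y b (Suc i) = learner_run p x' y' b (Suc i)"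
      unfolding learner_run.simps h r adapted_before_arrival[OF a(1,3-6)] ..
  qed
qed

lemma adapted_learner_seen: "adapted (Suc i) (\<lambda>x y b. learner_seen p x y b (Suc i))"
  unfolding adapted_def
proof (intro allI impI)
  fix x x' y y' :: "nat \<Rightarrow> real" and b k
  assume a: "\<forall>n. 0 < x n" "\<forall>n. 0 < x' n" "\<forall>n<Suc i. x n = x' n"
    "y \<in> count_cylinder k (epoch x (Suc i))" "y' \<in> count_cylinder k (epoch x (Suc i))" "\<forall>n<k. y n = y' n"
  have "learner_run p x y b i = learner_run p x' y' b i"
    by (rule adaptedD[OF adapted_mono[OF adapted_learner_run le_SucI[OF order_refl]] a])
  then show "learner_seen p x y b (Suc i) = learner_seen p x' y' b (Suc i)"
    by (simp add: learner_seen_def adapted_before_arrival[OF a(1,3-6)])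
qed

lemma adapted_genie_run: "adapted i (\<lambda>x y b. genie_run p x y b i)"
proof (induction i)
  case 0
  show ?case by (simp add: adapted_def)
next
  case (Suc i)
  show ?case
    unfolding adapted_def
  proof (intro allI impI)
    fix x x' y y' :: "nat \<Rightarrow> real" and b k
    assume a: "\<forall>n. 0 < x n" "\<forall>n. 0 < x' n" "\<forall>n<Suc i. x n = x' n"
      "y \<in> count_cylinder k (epoch x (Suc i))" "y' \<in> count_cylinder k (epoch x (Suc i))" "\<forall>n<k. y n = y' n"
    have 1: "epoch x (Suc i) = epoch x' (Suc i)" by (rule epoch_cong) (use a in auto)
    have 2: "genie_run p x y b i = genie_run p x' y' b i"
      by (rule adaptedD[OF adapted_mono[OF Suc le_SucI[OF order_refl]] a])
    have 3: "learner_seen p x y b (Suc i) = learner_seen p x' y' b (Suc i)"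
      by (rule adaptedD[OF adapted_learner_seen a])
    have "genie_before_arrival p x y b (Suc i) (genie_run p x y b i) =
        genie_before_arrival p x' y' b (Suc i) (genie_run p x' y' b i)"
      unfolding genie_before_arrival_def diff_Suc_1 adapted_serve[OF a(1,3-6)] 2 3 ..
    then show "genie_run p x y b (Suc i) = genie_run p x' y' b (Suc i)"
      unfolding genie_run.simps 1 by simp
  qed
qed

lemma adapted_compose:
  assumes "adapted i f"
  shows "adapted i (\<lambda>x y b. h (f x y b))"
  using assms unfolding adapted_def by metis

lemma adapted_compose2:
  assumes "adapted i f" "adapted i g"
  shows "adapted i (\<lambda>x y b. h (f x y b) (g x y b))"
  using assms unfolding adapted_def by metis

lemma adapted_const: "adapted i (\<lambda>x y b. c b)"
  by (simp add: adapted_def)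

lemma adapted_epoch: "adapted i (\<lambda>x y b. epoch x i)"
  by (auto simp: adapted_def intro: epoch_cong)

lemma adapted_overtime: "adapted (Suc n) (\<lambda>x y b. overtime p x y b j n)"
  unfolding overtime_def overestimating_def by (rule adapted_compose[OF adapted_learner_seen])

lemma adapted_overestimating: "adapted (Suc n) (\<lambda>x y b. overestimating p x y b n)"
  unfolding overestimating_def by (rule adapted_compose[OF adapted_learner_seen])

lemma adapted_lagging: "adapted (Suc n) (\<lambda>x y b. lagging p x y b n)"
  unfolding lagging_def
  by (intro adapted_compose2[where h="(\<and>)"] adapted_compose[where h=Not] adapted_overestimating
    adapted_compose2[where h="\<lambda>g r. queue (fst g) < queue (server_of r)"] adapted_genie_run adapted_learner_run)

text \<open>The factor by which the exponential martingale of the observed service times changes while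
  no customer joins: \<open>q\<close> customers are present, the time \<open>t\<close> passes, and \<open>y\<close> are the gaps of the
  potential departures; \<open>g\<close> is the Laplace transform of a service time at \<open>a\<close>.\<close>

definition service_factor :: "real \<Rightarrow> real \<Rightarrow> nat \<Rightarrow> real \<Rightarrow> (nat \<Rightarrow> real) \<Rightarrow> real" where
  "service_factor a g q t y = exp (- a * min t (epoch y q)) * (1 / g) ^ min q (num_epochs y t)"

text \<open>The elapsed part of a service in progress is included because the process is observed at
  arrivals and not at completions of services.\<close>

definition service_martingale :: "real \<Rightarrow> real \<Rightarrow> real \<Rightarrow> server \<Rightarrow> real" where
  "service_martingale a g t st =
     exp (- a * (total_service st + (if queue st = 0 then 0 else t - service_start st))) *
     (1 / g) ^ completed st"

context queue_path
begin

lemma departures_eq: "departures x y n = num_epochs (residual_gaps (epoch x n) y) (x n)"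
  using num_epochs_residual_gaps[OF y_regular epoch_nonneg[OF x_pos], of "x n" n] x_pos
  by (simp add: departures_def epoch_Suc less_imp_le)

lemma service_martingale_joined:
  "service_martingale a g (epoch x (Suc n)) (joined n) = service_martingale a g (epoch x (Suc n)) (srv n)"
  by (simp add: service_martingale_def join_queue_def)

text \<open>Observed service time advances at unit rate while customers are present and stops with
  the departure of the last one, the \<open>q\<close>-th potential departure. This explains the
  minima in \<open>service_factor\<close>, which sees the past only through the queue
  length.\<close>

lemma service_martingale_srv:
  "service_martingale a g (epoch x (Suc n)) (srv n) =
   service_martingale a g (epoch x n) (server_of (run n)) *
   service_factor a g (queue_run n) (x n) (residual_gaps (epoch x n) y)"
proof -
  let ?q = "queue_run n" and ?c = "departures x y n" and ?k = "num_epochs y (epoch x n)"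
  let ?r = "residual_gaps (epoch x n) y" and ?st = "server_of (run n)"
  have xn: "0 < x n" using x_pos by simp
  have r: "regular_gaps ?r" by (rule regular_residual_gaps[OF y_regular epoch_nonneg[OF x_pos]])
  have c: "num_epochs ?r (x n) = ?c" by (simp add: departures_eq)
  have c_iff: "m \<le> ?c \<longleftrightarrow> epoch ?r m \<le> x n" for m
    using le_num_epochs_iff[OF r, of "x n" m] xn c by simp
  have ep: "epoch ?r m = (if m = 0 then 0 else epoch y (?k + m) - epoch x n)" for m
    by (cases m) (simp_all add: epoch_residual_gaps)
  have srv: "srv n = (if min ?c ?q = 0 then ?st
      else ?st\<lparr>queue := ?q - min ?c ?q, completed := completed ?st + min ?c ?q,
              total_service := total_service ?st + (epoch y (?k + min ?c ?q) - service_start ?st),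
              service_start := epoch y (?k + min ?c ?q)\<rparr>)"
    unfolding departures_def by (rule serve_eq[OF num_epochs_le])
  consider "?q = 0" | "?q \<noteq> 0" "?q \<le> ?c" | "0 < ?c" "?c < ?q" | "?c = 0" "?q \<noteq> 0" by linarith
  then show ?thesis
  proof cases
    case 1
    then show ?thesis unfolding srv using xn by (simp add: service_martingale_def service_factor_def)
  next
    case 2
    then have m: "min ?c ?q = ?q" "min ?q ?c = ?q" "min (x n) (epoch ?r ?q) = epoch ?r ?q"
      using c_iff[of ?q] by auto
    have "service_factor a g ?q (x n) ?r = exp (- a * (epoch y (?k + ?q) - epoch x n)) * (1 / g) ^ ?q"
      unfolding service_factor_def c m using 2 by (simp add: ep)
    then show ?thesis
      unfolding srv m using 2
      by (simp add: service_martingale_def mult_exp_exp algebra_simps power_add)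
  next
    case 3
    then have m: "min ?c ?q = ?c" "min ?q ?c = ?c" "min (x n) (epoch ?r ?q) = x n"
      using c_iff[of ?q] by auto
    have "service_factor a g ?q (x n) ?r = exp (- a * x n) * (1 / g) ^ ?c"
      unfolding service_factor_def c m ..
    then show ?thesis
      unfolding srv m using 3
      by (simp add: service_martingale_def mult_exp_exp algebra_simps power_add epoch_Suc)
  next
    case 4
    then have m: "min ?c ?q = 0" "min ?q ?c = 0" "min (x n) (epoch ?r ?q) = x n"
      using c_iff[of ?q] by auto
    have "service_factor a g ?q (x n) ?r = exp (- a * x n)"
      unfolding service_factor_def c m by simp
    then show ?thesis
      unfolding srv m using 4
      by (simp add: service_martingale_def mult_exp_exp algebra_simps epoch_Suc)
  qed
qed

end

context exponential_sequence
begin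

lemma service_factor_measurable:
  assumes "f \<in> borel_measurable N" "h \<in> measurable N S"
  shows "(\<lambda>w. service_factor a g q (f w) (h w)) \<in> borel_measurable N"
proof -
  note [measurable] = assms
  have h: "(\<lambda>w. h w m) \<in> borel_measurable N" for m
    by (rule measurable_compose[OF assms(2) component_measurable])
  note [measurable] = measurable_epoch[OF h] measurable_num_epochs[OF h assms(1)]
  show ?thesis unfolding service_factor_def by measurable
qed

text \<open>Optional stopping at the earlier of \<open>t\<close> and the \<open>q\<close>-th
  potential departure, by induction on \<open>q\<close>: the first gap either exceeds
  \<open>t\<close>, or it contributes \<open>exp (- a * s) / g\<close> and leaves the same situation
  with one customer less and the time \<open>t - s\<close>.\<close>

lemma service_factor_integral:
  assumes "0 \<le> a" "0 \<le> t"
  defines "g \<equiv> l / (l + a)"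
  shows "(\<integral>\<^sup>+y. ennreal (service_factor a g q t y) \<partial>S) = 1"
  using assms(2)
proof (induction q arbitrary: t)
  case 0
  then show ?case using P.emeasure_space_1 by (simp add: service_factor_def)
next
  case (Suc q)
  have g: "0 < g" using l_pos assms(1) by (simp add: g_def)
  have [measurable]: "(\<lambda>y. service_factor a g (Suc q) t y) \<in> borel_measurable S"
    by (rule service_factor_measurable) measurable
  have late: "service_factor a g (Suc q) t (case_nat s y) = exp (- a * t)" if "regular_gaps y" "t < s" for s y
  proof -
    have "0 < s" using that Suc.prems by simp
    then have r: "regular_gaps (case_nat s y)" using that by (simp add: regular_gaps_case_nat)
    have "num_epochs (case_nat s y) t = 0" by (rule num_epochs_less_first[OF r Suc.prems]) (use that in simp)
    moreover have "t < epoch (case_nat s y) (Suc q)"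
      using that epoch_nonneg[of y q] by (simp add: epoch_case_nat regular_gaps_def)
    ultimately show ?thesis by (simp add: service_factor_def)
  qed
  have early: "service_factor a g (Suc q) t (case_nat s y) = exp (- a * s) / g * service_factor a g q (t - s) y"
    if "regular_gaps y" "0 < s" "s \<le> t" for s y
  proof -
    have "min t (s + epoch y q) = s + min (t - s) (epoch y q)" by linarith
    then show ?thesis
      using g unfolding service_factor_def num_epochs_case_nat[OF that] epoch_case_nat
      by (simp add: algebra_simps mult_exp_exp)
  qed
  have inner: "(\<integral>\<^sup>+y. ennreal (service_factor a g (Suc q) t (case_nat s y)) \<partial>S) =
      ennreal (exp (- a * t)) * indicator {t<..} s + ennreal (exp (- a * s) / g) * indicator {..t} s" if s: "0 < s" for s
  proof (cases "t < s")
    case True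
    have "(\<integral>\<^sup>+y. ennreal (service_factor a g (Suc q) t (case_nat s y)) \<partial>S) = (\<integral>\<^sup>+y. ennreal (exp (- a * t)) \<partial>S)"
    proof (rule nn_integral_cong_AE)
      show "AE y in S. ennreal (service_factor a g (Suc q) t (case_nat s y)) = ennreal (exp (- a * t))"
        using AE_regular_gaps by eventually_elim (use True in \<open>simp add: late\<close>)
    qed
    then show ?thesis using True P.emeasure_space_1 by simp
  next
    case False
    have "(\<integral>\<^sup>+y. ennreal (service_factor a g (Suc q) t (case_nat s y)) \<partial>S) =
        (\<integral>\<^sup>+y. ennreal (exp (- a * s) / g) * ennreal (service_factor a g q (t - s) y) \<partial>S)"
    proof (rule nn_integral_cong_AE)
      show "AE y in S. ennreal (service_factor a g (Suc q) t (case_nat s y)) =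
          ennreal (exp (- a * s) / g) * ennreal (service_factor a g q (t - s) y)"
        using AE_regular_gaps
        by eventually_elim (use False s g in \<open>simp add: early ennreal_mult'[symmetric]\<close>)
    qed
    also have "\<dots> = ennreal (exp (- a * s) / g) * (\<integral>\<^sup>+y. ennreal (service_factor a g q (t - s) y) \<partial>S)"
      by (rule nn_integral_cmult) (intro measurable_compose[OF _ measurable_ennreal] service_factor_measurable, auto)
    also have "\<dots> = ennreal (exp (- a * s) / g)"
      using Suc.IH[of "t - s"] False by simp
    finally show ?thesis using False by simp
  qed
  have "(\<integral>\<^sup>+y. ennreal (service_factor a g (Suc q) t y) \<partial>S) =
      (\<integral>\<^sup>+s. \<integral>\<^sup>+y. ennreal (service_factor a g (Suc q) t (case_nat s y)) \<partial>S \<partial>E)"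
    by (rule nn_integral_S) measurable
  also have "\<dots> = (\<integral>\<^sup>+s. ennreal (exp (- a * t)) * indicator {t<..} s + ennreal (exp (- a * s) / g) * indicator {..t} s \<partial>E)"
  proof (rule nn_integral_cong_AE)
    show "AE s in E. (\<integral>\<^sup>+y. ennreal (service_factor a g (Suc q) t (case_nat s y)) \<partial>S) =
      ennreal (exp (- a * t)) * indicator {t<..} s + ennreal (exp (- a * s) / g) * indicator {..t} s"
      using AE_E_pos by eventually_elim (rule inner)
  qed
  also have "\<dots> = 1"
  proof -
    have 1: "(\<integral>\<^sup>+s. ennreal (exp (- a * t)) * indicator {t<..} s \<partial>E) = ennreal (exp (- (l + a) * t))"
      using exponential_shift[of "\<lambda>_. ennreal (exp (- a * t))" t] Suc.prems E.emeasure_space_1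
      by (simp add: ennreal_mult'[symmetric] mult_exp_exp algebra_simps)
    have "(\<integral>\<^sup>+s. ennreal (exp (- a * s) / g) \<partial>E) = 1"
    proof -
      have "(\<integral>\<^sup>+s. ennreal (exp (- a * s) / g) \<partial>E) = (\<integral>\<^sup>+s. ennreal (1 / g) * ennreal (exp (- a * s)) \<partial>E)"
        using g by (intro nn_integral_cong) (simp add: ennreal_mult'[symmetric])
      also have "\<dots> = ennreal (1 / g) * (\<integral>\<^sup>+s. ennreal (exp (- a * s)) \<partial>E)"
        by (rule nn_integral_cmult) measurable
      also have "\<dots> = ennreal (1 / g) * ennreal g"
        unfolding exponential_Laplace[OF assms(1)] g_def ..
      also have "\<dots> = 1" using g by (simp add: ennreal_mult'[symmetric])
      finally show ?thesis .
    qed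
    moreover have "(\<integral>\<^sup>+s. ennreal (exp (- a * s) / g) \<partial>E) =
      (\<integral>\<^sup>+s. ennreal (exp (- a * s) / g) * indicator {t<..} s + ennreal (exp (- a * s) / g) * indicator {..t} s \<partial>E)"
      by (intro nn_integral_cong) (auto simp: indicator_def)
    moreover have "\<dots> = (\<integral>\<^sup>+s. ennreal (exp (- a * s) / g) * indicator {t<..} s \<partial>E) +
        (\<integral>\<^sup>+s. ennreal (exp (- a * s) / g) * indicator {..t} s \<partial>E)"
      by (rule nn_integral_add) measurable
    \<comment> \<open>\<open>exp (- a * s) / g\<close> has integral \<open>1\<close>. By
      memorylessness its part beyond \<open>t\<close> equals the mass contributed by the late case,
      so the late and the early case together again give \<open>1\<close>.\<close>
    moreover have "(\<integral>\<^sup>+s. ennreal (exp (- a * s) / g) * indicator {t<..} s \<partial>E) = ennreal (exp (- (l + a) * t))"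
    proof -
      have "(\<integral>\<^sup>+s. ennreal (exp (- a * s) / g) * indicator {t<..} s \<partial>E) =
        (\<integral>\<^sup>+s. (ennreal (exp (- a * t)) * ennreal (exp (- a * (s - t)) / g)) * indicator {t<..} s \<partial>E)"
        using g by (intro nn_integral_cong) (simp add: ennreal_mult'[symmetric] mult_exp_exp algebra_simps)
      also have "\<dots> = ennreal (exp (- l * t)) * (\<integral>\<^sup>+s. ennreal (exp (- a * t)) * ennreal (exp (- a * s) / g) \<partial>E)"
        by (rule exponential_shift[OF _ Suc.prems]) measurable
      also have "(\<integral>\<^sup>+s. ennreal (exp (- a * t)) * ennreal (exp (- a * s) / g) \<partial>E) = ennreal (exp (- a * t)) * 1"
        unfolding \<open>(\<integral>\<^sup>+s. ennreal (exp (- a * s) / g) \<partial>E) = 1\<close>[symmetric] by (rule nn_integral_cmult) measurable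
      finally show ?thesis by (simp add: ennreal_mult'[symmetric] mult_exp_exp algebra_simps)
    qed
    ultimately have 2: "ennreal (exp (- (l + a) * t)) + (\<integral>\<^sup>+s. ennreal (exp (- a * s) / g) * indicator {..t} s \<partial>E) = 1"
      by simp
    show ?thesis
      by (subst nn_integral_add) (simp_all only: 1 2, auto)
  qed
  finally show ?case .
qed

end

section \<open>Expected numbers of costly arrivals\<close>

lemma exponential_mean:
  assumes "0 < l"
  shows "(\<integral>\<^sup>+s. ennreal s \<partial>density lborel (exponential_density l)) = ennreal (1 / l)"
proof -
  have "(\<integral>\<^sup>+s. ennreal s \<partial>density lborel (exponential_density l)) =
      (\<integral>\<^sup>+s. ennreal (exponential_density l s) * ennreal s \<partial>lborel)"
    by (subst nn_integral_density) auto
  also have "\<dots> = (\<integral>\<^sup>+s. ennreal (exponential_density l s * s ^ 1) \<partial>lborel)"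
    using assms by (intro nn_integral_cong) (simp add: ennreal_mult' exponential_density_nonneg)
  also have "\<dots> = ennreal (1 / l)"
    using nn_integral_erlang_ith_moment[OF assms, of 0 1] assms by (simp add: divide_ennreal)
  finally show ?thesis .
qed

lemma exponential_tail:
  assumes "0 < l" "0 \<le> c"
  shows "(\<integral>\<^sup>+s. indicator {c..} s \<partial>density lborel (exponential_density l)) = ennreal (exp (- l * c))"
proof -
  interpret exponential_sequence l by unfold_locales fact
  have "(\<integral>\<^sup>+s. indicator {c..} s \<partial>E) = (\<integral>\<^sup>+s. 1 * indicator {c<..} s \<partial>E)"
  proof (rule nn_integral_cong_AE)
    have "AE s in lborel. s \<noteq> c" by (rule AE_lborel_singleton)
    then have "AE s in E. s \<noteq> c" by (subst AE_density) (auto elim: eventually_mono)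
    then show "AE s in E. indicator {c..} s = (1 * indicator {c<..} s :: ennreal)"
      by eventually_elim (auto simp: indicator_def)
  qed
  also have "\<dots> = ennreal (exp (- l * c))"
    using exponential_shift[of "\<lambda>_. 1" c] assms E.emeasure_space_1 by simp
  finally show ?thesis .
qed

locale dispatch = input_model M X Y B "arrival_rate p" "service_rate p" + queue_params p
  for M :: "'a measure" and X Y B and p :: params +
  assumes reward_pos: "0 < reward p" and hold_cost_pos: "0 < hold_cost p"
    and fallback_measurable:
      "\<And>j. 1 \<le> j \<Longrightarrow> fallback p j \<in> measurable (\<Pi>\<^sub>M k\<in>UNIV. borel) (count_space UNIV)"
begin

abbreviation "lam \<equiv> arrival_rate p"
abbreviation "mu \<equiv> service_rate p"
abbreviation "N3 \<equiv> Sx \<Otimes>\<^sub>M (SB \<Otimes>\<^sub>M Sy)"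

sublocale XX: exponential_sequence lam by unfold_locales (rule lam_pos)
sublocale YY: exponential_sequence mu by unfold_locales (rule mu_pos)

lemma xs_component: "(\<lambda>\<omega>. xs \<omega> n) \<in> borel_measurable M"
  by (simp add: xs_def X_rv)

lemma ys_component: "(\<lambda>\<omega>. ys \<omega> n) \<in> borel_measurable M"
  by (simp add: ys_def Y_rv)

lemma bs_component: "Measurable.pred M (\<lambda>\<omega>. bs \<omega> n)"
  using measurable_compose[OF measurable_bs measurable_component_singleton[of n UNIV]] by simp

lemma ratio_nonneg: "0 \<le> reward p / hold_cost p"
  using reward_pos hold_cost_pos by simp

sublocale MM: measurable_paths p M xs ys bs
  by unfold_locales (simp_all add: xs_component ys_component bs_component ratio_nonneg fallback_measurable)

lemma SB_component: "(\<lambda>b. b n) \<in> measurable SB (count_space UNIV)"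
  using measurable_component_singleton[of n UNIV "\<lambda>_. count_space (UNIV :: bool set)"] by simp

sublocale PP: measurable_paths p N3 fst "\<lambda>w. snd (snd w)" "\<lambda>w. fst (snd w)"
proof
  show "(\<lambda>w. fst w n) \<in> borel_measurable N3" for n
    by (rule measurable_compose[OF measurable_fst XX.component_measurable])
  show "(\<lambda>w. snd (snd w) n) \<in> borel_measurable N3" for n
    by (rule measurable_compose[OF measurable_compose[OF measurable_snd measurable_snd] YY.component_measurable])
  show "Measurable.pred N3 (\<lambda>w. fst (snd w) n)" for n
    by (rule measurable_compose[OF measurable_compose[OF measurable_snd measurable_fst] SB_component])
qed (simp_all add: ratio_nonneg fallback_measurable)

lemma AE_path: "AE \<omega> in M. queue_path p (xs \<omega>) (ys \<omega>)"
proof -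
  have "AE \<omega> in M. regular_gaps (xs \<omega>)"
  proof -
    have "AE x in distr M XX.S xs. regular_gaps x"
    proof -
      have "distr M XX.S xs = distr M (\<Pi>\<^sub>M n\<in>UNIV. borel) xs"
        by (intro distr_cong refl sets_PiM_cong) auto
      also have "\<dots> = XX.S" unfolding xs_def[abs_def] by (rule distr_seq[OF X_distr indep_X])
      finally have d: "distr M XX.S xs = XX.S" .
      show ?thesis unfolding d by (rule XX.AE_regular_gaps)
    qed
    moreover have "xs \<in> measurable M XX.S"
      by (rule XX.measurable_into_S) (rule xs_component)
    ultimately show ?thesis using AE_distrD by blast
  qed
  moreover have "AE \<omega> in M. regular_gaps (ys \<omega>)"
  proof -
    have "AE y in distr M YY.S ys. regular_gaps y"
    proof -
      have "distr M YY.S ys = distr M (\<Pi>\<^sub>M n\<in>UNIV. borel) ys"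
        by (intro distr_cong refl sets_PiM_cong) auto
      also have "\<dots> = YY.S" unfolding ys_def[abs_def] by (rule distr_seq[OF Y_distr indep_Y])
      finally have d: "distr M YY.S ys = YY.S" .
      show ?thesis unfolding d by (rule YY.AE_regular_gaps)
    qed
    moreover have "ys \<in> measurable M YY.S"
      by (rule YY.measurable_into_S) (rule ys_component)
    ultimately show ?thesis using AE_distrD by blast
  qed
  ultimately show ?thesis
    by eventually_elim (unfold_locales, simp_all add: regular_gaps_def)
qed

text \<open>The probability that the next potential departure precedes the next arrival; its
  \<open>k\<close>-th power is the probability that \<open>k\<close> potential departures
  do.\<close>

definition emptying :: real where "emptying = mu / (mu + lam)"

lemma emptying: "0 < emptying" "emptying < 1"
  using lam_pos mu_pos by (auto simp: emptying_def)

text \<open>The complementary event says that the \<open>k\<close>-th potential departure is not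
  later than the arrival. Integrating the exponential arrival gap first leaves the Laplace transform
  of that departure time at \<open>lam\<close>.\<close>

lemma few_departures_integral:
  "(\<integral>\<^sup>+s. \<integral>\<^sup>+y. of_bool (num_epochs y s < k) \<partial>Sy \<partial>XX.E) = ennreal (1 - emptying ^ k)"
proof -
  let ?f = "\<lambda>s y. of_bool (num_epochs y s < k) :: ennreal" and ?h = "\<lambda>s y. of_bool (epoch y k \<le> s) :: ennreal"
  interpret XY: pair_prob_space XX.E YY.S by unfold_locales
  have [measurable]: "(\<lambda>w. num_epochs (snd w) (fst w)) \<in> measurable (XX.E \<Otimes>\<^sub>M YY.S) (count_space UNIV)"
    by (rule measurable_num_epochs)
      (auto intro: measurable_compose[OF measurable_snd YY.component_measurable])
  have [measurable]: "(\<lambda>w. epoch (snd w) k) \<in> borel_measurable (XX.E \<Otimes>\<^sub>M YY.S)"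
    by (rule measurable_compose[OF measurable_snd YY.epoch_measurable])
  have h: "(\<lambda>w. ?h (fst w) (snd w)) \<in> borel_measurable (XX.E \<Otimes>\<^sub>M YY.S)"
    unfolding of_bool_def by measurable
  have inner: "(\<integral>\<^sup>+y. ?f s y \<partial>Sy) + (\<integral>\<^sup>+y. ?h s y \<partial>Sy) = 1" if s: "0 < s" for s
  proof -
    have "(\<lambda>y. num_epochs y s) \<in> measurable YY.S (count_space UNIV)"
      by (rule measurable_num_epochs) (auto intro: YY.component_measurable)
    then have "(\<integral>\<^sup>+y. ?f s y \<partial>Sy) + (\<integral>\<^sup>+y. ?h s y \<partial>Sy) = (\<integral>\<^sup>+y. ?f s y + ?h s y \<partial>Sy)"
      by (intro nn_integral_add[symmetric]; unfold of_bool_def; measurable)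
    also have "\<dots> = (\<integral>\<^sup>+y. 1 \<partial>Sy)"
    proof (rule nn_integral_cong_AE)
      show "AE y in Sy. ?f s y + ?h s y = 1"
        using YY.AE_regular_gaps
      proof eventually_elim
        case (elim y)
        then show ?case using le_num_epochs_iff[OF elim, of s k] s by (cases "num_epochs y s < k") auto
      qed
    qed
    finally show ?thesis using YY.P.emeasure_space_1 by simp
  qed
  have "(\<integral>\<^sup>+s. \<integral>\<^sup>+y. ?h s y \<partial>Sy \<partial>XX.E) = (\<integral>\<^sup>+y. \<integral>\<^sup>+s. ?h s y \<partial>XX.E \<partial>Sy)"
    by (rule XY.Fubini'[symmetric]) (use h in \<open>simp add: split_beta'\<close>)
  also have "\<dots> = (\<integral>\<^sup>+y. ennreal (exp (- lam * epoch y k)) \<partial>Sy)"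
  proof (rule nn_integral_cong_AE)
    show "AE y in Sy. (\<integral>\<^sup>+s. ?h s y \<partial>XX.E) = ennreal (exp (- lam * epoch y k))"
      using YY.AE_regular_gaps
    proof eventually_elim
      case (elim y)
      then have "0 \<le> epoch y k" by (intro epoch_nonneg) (simp add: regular_gaps_def)
      from exponential_tail[OF lam_pos this] show ?case by (simp add: indicator_def)
    qed
  qed
  also have "\<dots> = ennreal (emptying ^ k)"
    unfolding emptying_def using lam_pos by (intro YY.epoch_Laplace) simp
  finally have H: "(\<integral>\<^sup>+s. \<integral>\<^sup>+y. ?h s y \<partial>Sy \<partial>XX.E) = ennreal (emptying ^ k)" .
  have "(\<integral>\<^sup>+s. \<integral>\<^sup>+y. ?f s y \<partial>Sy \<partial>XX.E) + (\<integral>\<^sup>+s. \<integral>\<^sup>+y. ?h s y \<partial>Sy \<partial>XX.E) =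
      (\<integral>\<^sup>+s. (\<integral>\<^sup>+y. ?f s y \<partial>Sy) + (\<integral>\<^sup>+y. ?h s y \<partial>Sy) \<partial>XX.E)"
  proof (rule nn_integral_add[symmetric])
    show "(\<lambda>s. \<integral>\<^sup>+y. ?f s y \<partial>Sy) \<in> borel_measurable XX.E"
      by (rule YY.P.borel_measurable_nn_integral) (simp add: split_beta' of_bool_def)
    show "(\<lambda>s. \<integral>\<^sup>+y. ?h s y \<partial>Sy) \<in> borel_measurable XX.E"
      by (rule YY.P.borel_measurable_nn_integral) (use h in \<open>simp add: split_beta'\<close>)
  qed
  also have "\<dots> = (\<integral>\<^sup>+s. 1 \<partial>XX.E)"
  proof (rule nn_integral_cong_AE)
    show "AE s in XX.E. (\<integral>\<^sup>+y. ?f s y \<partial>Sy) + (\<integral>\<^sup>+y. ?h s y \<partial>Sy) = 1"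
      using XX.AE_E_pos by eventually_elim (rule inner)
  qed
  finally have "(\<integral>\<^sup>+s. \<integral>\<^sup>+y. ?f s y \<partial>Sy \<partial>XX.E) + ennreal (emptying ^ k) = 1"
    unfolding H using XX.E.emeasure_space_1 by simp
  moreover have "ennreal (1 - emptying ^ k) + ennreal (emptying ^ k) = 1"
    using emptying power_le_one[of emptying k] by (subst ennreal_plus[symmetric]) auto
  ultimately show ?thesis
    by (metis ennreal_add_diff_cancel_right ennreal_neq_top infinity_ennreal_def)
qed

section \<open>Probabilities of events determined by the inputs\<close>

definition pr :: "((nat \<Rightarrow> real) \<Rightarrow> (nat \<Rightarrow> real) \<Rightarrow> (nat \<Rightarrow> bool) \<Rightarrow> bool) \<Rightarrow> real" where
  "pr \<phi> = prob {\<omega> \<in> space M. \<phi> (xs \<omega>) (ys \<omega>) (bs \<omega>)}"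

text \<open>Measurability is demanded on the product of the laws, where \<open>one_step\<close>
  works, and is pulled back to \<open>M\<close> when needed.\<close>

definition event :: "((nat \<Rightarrow> real) \<Rightarrow> (nat \<Rightarrow> real) \<Rightarrow> (nat \<Rightarrow> bool) \<Rightarrow> bool) \<Rightarrow> bool" where
  "event \<phi> \<longleftrightarrow> Measurable.pred N3 (\<lambda>w. \<phi> (fst w) (snd (snd w)) (fst (snd w)))"

lemma event_M: "event \<phi> \<Longrightarrow> Measurable.pred M (\<lambda>\<omega>. \<phi> (xs \<omega>) (ys \<omega>) (bs \<omega>))"
  unfolding event_def using measurable_compose[OF measurable_inputs, of "\<lambda>w. \<phi> (fst w) (snd (snd w)) (fst (snd w))"]
  by simp

lemma pr_nonneg: "0 \<le> pr \<phi>"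
  by (simp add: pr_def)

lemma expectation_of_bool: "event \<phi> \<Longrightarrow> expectation (\<lambda>\<omega>. of_bool (\<phi> (xs \<omega>) (ys \<omega>) (bs \<omega>))) = pr \<phi>"
proof -
  assume e: "event \<phi>"
  have [measurable]: "Measurable.pred M (\<lambda>\<omega>. \<phi> (xs \<omega>) (ys \<omega>) (bs \<omega>))" by (rule event_M[OF e])
  have "expectation (\<lambda>\<omega>. of_bool (\<phi> (xs \<omega>) (ys \<omega>) (bs \<omega>))) =
      expectation (indicator {\<omega> \<in> space M. \<phi> (xs \<omega>) (ys \<omega>) (bs \<omega>)} :: 'a \<Rightarrow> real)"
    by (intro Bochner_Integration.integral_cong) auto
  then show ?thesis by (simp add: pr_def)
qed

lemma integrable_of_bool: "event \<phi> \<Longrightarrow> integrable M (\<lambda>\<omega>. of_bool (\<phi> (xs \<omega>) (ys \<omega>) (bs \<omega>)) :: real)"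
proof (rule integrable_const_bound[where B=1])
  assume "event \<phi>"
  note [measurable] = event_M[OF this]
  show "(\<lambda>\<omega>. of_bool (\<phi> (xs \<omega>) (ys \<omega>) (bs \<omega>)) :: real) \<in> borel_measurable M"
    unfolding of_bool_def by measurable
qed auto

lemma nn_integral_of_bool: "event \<phi> \<Longrightarrow> (\<integral>\<^sup>+\<omega>. of_bool (\<phi> (xs \<omega>) (ys \<omega>) (bs \<omega>)) \<partial>M) = ennreal (pr \<phi>)"
proof -
  assume e: "event \<phi>"
  have "(\<integral>\<^sup>+\<omega>. of_bool (\<phi> (xs \<omega>) (ys \<omega>) (bs \<omega>)) \<partial>M) = (\<integral>\<^sup>+\<omega>. ennreal (of_bool (\<phi> (xs \<omega>) (ys \<omega>) (bs \<omega>))) \<partial>M)"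
    by (intro nn_integral_cong) auto
  also have "\<dots> = ennreal (expectation (\<lambda>\<omega>. of_bool (\<phi> (xs \<omega>) (ys \<omega>) (bs \<omega>))))"
    by (rule nn_integral_eq_integral[OF integrable_of_bool[OF e]]) auto
  finally show ?thesis by (simp add: expectation_of_bool[OF e])
qed

lemma pr_mono:
  assumes "event \<phi>" "event \<psi>" "\<And>x y b. queue_path p x y \<Longrightarrow> \<phi> x y b \<Longrightarrow> \<psi> x y b"
  shows "pr \<phi> \<le> pr \<psi>"
  unfolding pr_def
proof (rule finite_measure_mono_AE)
  show "AE \<omega> in M. \<omega> \<in> {\<omega> \<in> space M. \<phi> (xs \<omega>) (ys \<omega>) (bs \<omega>)} \<longrightarrow> \<omega> \<in> {\<omega> \<in> space M. \<psi> (xs \<omega>) (ys \<omega>) (bs \<omega>)}"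
    using AE_path by eventually_elim (use assms(3) in auto)
  show "{\<omega> \<in> space M. \<psi> (xs \<omega>) (ys \<omega>) (bs \<omega>)} \<in> sets M"
    using event_M[OF assms(2)] by simp
qed

lemma pr_or:
  assumes "event \<phi>" "event \<psi>"
  shows "pr (\<lambda>x y b. \<phi> x y b \<or> \<psi> x y b) \<le> pr \<phi> + pr \<psi>"
proof -
  have "{\<omega> \<in> space M. \<phi> (xs \<omega>) (ys \<omega>) (bs \<omega>) \<or> \<psi> (xs \<omega>) (ys \<omega>) (bs \<omega>)} =
    {\<omega> \<in> space M. \<phi> (xs \<omega>) (ys \<omega>) (bs \<omega>)} \<union> {\<omega> \<in> space M. \<psi> (xs \<omega>) (ys \<omega>) (bs \<omega>)}" by auto
  then show ?thesis
    unfolding pr_def using event_M[OF assms(1)] event_M[OF assms(2)] by (auto intro: measure_Un_le)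
qed

lemma sum_pr_eq:
  assumes "\<And>n. event (\<phi> n)"
  shows "integrable M (\<lambda>\<omega>. \<Sum>n<N. of_bool (\<phi> n (xs \<omega>) (ys \<omega>) (bs \<omega>)) :: real)"
    "expectation (\<lambda>\<omega>. \<Sum>n<N. of_bool (\<phi> n (xs \<omega>) (ys \<omega>) (bs \<omega>))) = (\<Sum>n<N. pr (\<phi> n))"
  using assms
  by (auto intro!: Bochner_Integration.integrable_sum integrable_of_bool
    simp: Bochner_Integration.integral_sum integrable_of_bool expectation_of_bool simp del: sum_of_bool_eq)

text \<open>Turns a pathwise counting inequality into one for sums of probabilities. Applications
  with fewer terms insert empty sums over the event \<open>False\<close>.\<close>

lemma sum_pr_le:
  assumes e: "\<And>n. event (\<phi> n)" "\<And>n. event (\<psi> n)" "\<And>n. event (\<xi> n)"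
    and "AE \<omega> in M. (\<Sum>n<N. of_bool (\<phi> n (xs \<omega>) (ys \<omega>) (bs \<omega>))) \<le>
      c * (\<Sum>n<K. of_bool (\<psi> n (xs \<omega>) (ys \<omega>) (bs \<omega>)) :: real) + (\<Sum>n<L. of_bool (\<xi> n (xs \<omega>) (ys \<omega>) (bs \<omega>))) + d"
  shows "(\<Sum>n<N. pr (\<phi> n)) \<le> c * (\<Sum>n<K. pr (\<psi> n)) + (\<Sum>n<L. pr (\<xi> n)) + d"
proof -
  have "expectation (\<lambda>\<omega>. \<Sum>n<N. of_bool (\<phi> n (xs \<omega>) (ys \<omega>) (bs \<omega>))) \<le>
    expectation (\<lambda>\<omega>. c * (\<Sum>n<K. of_bool (\<psi> n (xs \<omega>) (ys \<omega>) (bs \<omega>))) + (\<Sum>n<L. of_bool (\<xi> n (xs \<omega>) (ys \<omega>) (bs \<omega>))) + d)"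
    by (rule integral_mono_AE[OF _ _ assms(4)])
      (intro Bochner_Integration.integrable_add integrable_mult_right sum_pr_eq(1) e integrable_const)+
  also have "\<dots> = expectation (\<lambda>\<omega>. c * (\<Sum>n<K. of_bool (\<psi> n (xs \<omega>) (ys \<omega>) (bs \<omega>)))) +
      expectation (\<lambda>\<omega>. \<Sum>n<L. of_bool (\<xi> n (xs \<omega>) (ys \<omega>) (bs \<omega>))) + expectation (\<lambda>_. d)"
    by (subst Bochner_Integration.integral_add; (subst Bochner_Integration.integral_add)?;
        intro Bochner_Integration.integrable_add integrable_mult_right sum_pr_eq(1) e integrable_const refl)
  finally show ?thesis
    by (simp only: integral_mult_right_zero sum_pr_eq(2)[of \<phi>, OF e(1)] sum_pr_eq(2)[of \<psi>, OF e(2)]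
        sum_pr_eq(2)[of \<xi>, OF e(3)]) (simp add: prob_space)
qed

lemma event_exploring: "event (\<lambda>x y b. exploring p x y b n)"
  and event_lagging: "event (\<lambda>x y b. lagging p x y b n)"
  and event_over_at: "event (\<lambda>x y b. over_at p x y b j a n)"
  and event_overtime: "event (\<lambda>x y b. overtime p x y b j n)"
  and event_deceptive_start: "event (\<lambda>x y b. deceptive_start p th x y b j n)"
  unfolding event_def by measurable

lemma event_over_batch: "event (\<lambda>x y b. overestimating p x y b n \<and> batch (learner_seen p x y b (Suc n)) = j)"
proof -
  note [measurable] = measurable_learnerD(2)[OF PP.measurable_learner_seen]
  show ?thesis unfolding event_def by measurable
qed

lemma event_departures: "event (\<lambda>x y b. departures x y n < k)"
proof -
  have "(\<lambda>w. num_epochs (snd (snd w)) (epoch (fst w) m)) \<in> measurable N3 (count_space UNIV)" for m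
    by (intro measurable_num_epochs PP.y measurable_epoch PP.x)
  note [measurable] = this
  show ?thesis unfolding event_def departures_def by measurable
qed

lemma event_conj: "event \<phi> \<Longrightarrow> event \<psi> \<Longrightarrow> event (\<lambda>x y b. \<phi> x y b \<and> \<psi> x y b)"
  and event_disj: "event \<phi> \<Longrightarrow> event \<psi> \<Longrightarrow> event (\<lambda>x y b. \<phi> x y b \<or> \<psi> x y b)"
  unfolding event_def by (auto intro: pred_intros_logic)

text \<open>The departures between two arrivals are a function of the next gap and the restarted
  process, hence independent of the history \<open>\<phi>\<close>.\<close>

lemma pr_few_departures:
  assumes e: "event \<phi>" and a: "adapted n \<phi>"
  shows "pr (\<lambda>x y b. \<phi> x y b \<and> departures x y n < k) = (1 - emptying ^ k) * pr \<phi>"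
proof -
  let ?g = "\<lambda>s y. of_bool (num_epochs y s < k) :: ennreal"
  have "(\<integral>\<^sup>+\<omega>. of_bool (\<phi> (xs \<omega>) (ys \<omega>) (bs \<omega>)) * ?g (xs \<omega> n) (residual_gaps (epoch (xs \<omega>) n) (ys \<omega>)) \<partial>M) =
    (\<integral>\<^sup>+\<omega>. of_bool (\<phi> (xs \<omega>) (ys \<omega>) (bs \<omega>)) \<partial>M) * (\<integral>\<^sup>+s. \<integral>\<^sup>+y. ?g s y \<partial>Sy \<partial>XX.E)"
  proof (rule one_step)
    show "(\<lambda>w. of_bool (\<phi> (fst w) (snd (snd w)) (fst (snd w))) :: ennreal) \<in> borel_measurable N3"
      using e unfolding event_def of_bool_def by measurable
    have "(\<lambda>w. num_epochs (snd w) (fst w)) \<in> measurable (borel \<Otimes>\<^sub>M YY.S) (count_space UNIV)"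
      by (rule measurable_num_epochs)
        (auto intro: measurable_compose[OF measurable_snd YY.component_measurable])
    then show "(\<lambda>w. ?g (fst w) (snd w)) \<in> borel_measurable (borel \<Otimes>\<^sub>M Sy)"
      unfolding of_bool_def by measurable
    show "adapted n (\<lambda>x y b. of_bool (\<phi> x y b) :: ennreal)" by (rule adapted_compose[OF a])
  qed
  also have "(\<integral>\<^sup>+\<omega>. of_bool (\<phi> (xs \<omega>) (ys \<omega>) (bs \<omega>)) * ?g (xs \<omega> n) (residual_gaps (epoch (xs \<omega>) n) (ys \<omega>)) \<partial>M) =
    (\<integral>\<^sup>+\<omega>. of_bool (\<phi> (xs \<omega>) (ys \<omega>) (bs \<omega>) \<and> departures (xs \<omega>) (ys \<omega>) n < k) \<partial>M)"
  proof (rule nn_integral_cong_AE)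
    show "AE \<omega> in M. of_bool (\<phi> (xs \<omega>) (ys \<omega>) (bs \<omega>)) * ?g (xs \<omega> n) (residual_gaps (epoch (xs \<omega>) n) (ys \<omega>)) =
        (of_bool (\<phi> (xs \<omega>) (ys \<omega>) (bs \<omega>) \<and> departures (xs \<omega>) (ys \<omega>) n < k) :: ennreal)"
      using AE_path
    proof eventually_elim
      case (elim \<omega>)
      interpret queue_path p "xs \<omega>" "ys \<omega>" "bs \<omega>" by fact
      show ?case by (simp add: departures_eq of_bool_conj)
    qed
  qed
  also have "\<dots> = ennreal (pr (\<lambda>x y b. \<phi> x y b \<and> departures x y n < k))"
    by (rule nn_integral_of_bool[OF event_conj[OF e event_departures]])
  finally have "ennreal (pr (\<lambda>x y b. \<phi> x y b \<and> departures x y n < k)) = ennreal (pr \<phi> * (1 - emptying ^ k))"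
    unfolding few_departures_integral nn_integral_of_bool[OF e]
    using emptying power_le_one[of emptying k] by (simp add: ennreal_mult' pr_nonneg)
  then show ?thesis
    using emptying power_le_one[of emptying k] by (simp add: pr_nonneg mult.commute)
qed

end

text \<open>Each unit fed in through \<open>e\<close> survives a step with a factor of at most
  \<open>1 - d\<close>, so its total contribution to the sum of \<open>u\<close> is at most
  \<open>1 / d\<close>.\<close>

lemma geometric_domination:
  fixes u e :: "nat \<Rightarrow> real"
  assumes "u 0 \<le> e 0" "\<And>n. u (Suc n) \<le> e (Suc n) + (1 - d) * u n" "\<And>n. 0 \<le> u n" "d \<le> 1"
  shows "d * (\<Sum>n<N. u n) \<le> (\<Sum>n<N. e n)"
proof (cases N)
  case (Suc K)
  have "(\<Sum>n<N. u n) = u 0 + (\<Sum>n<K. u (Suc n))"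
    unfolding Suc by (rule sum.lessThan_Suc_shift)
  also have "\<dots> \<le> e 0 + (\<Sum>n<K. e (Suc n) + (1 - d) * u n)"
    by (intro add_mono sum_mono assms)
  also have "\<dots> = (\<Sum>n<N. e n) + (1 - d) * (\<Sum>n<K. u n)"
    unfolding Suc sum.lessThan_Suc_shift by (simp add: sum.distrib sum_distrib_left)
  also have "\<dots> \<le> (\<Sum>n<N. e n) + (1 - d) * (\<Sum>n<N. u n)"
    using assms(3)[of K] assms(4) unfolding Suc by (intro add_left_mono mult_left_mono) auto
  finally show ?thesis by (simp add: algebra_simps)
qed simp

lemma suminf_of_bool_eq: "(\<Sum>q. h q * of_bool (Q = q)) = (h Q :: ennreal)"
proof -
  have "(\<lambda>q. h q * of_bool (Q = q)) = (\<lambda>q. if q = Q then h q else 0)" by auto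
  then show ?thesis using sums_unique[OF sums_single[of Q h]] by simp
qed

context dispatch
begin

lemma sum_lagging: "emptying ^ kstar * (\<Sum>n<N. pr (\<lambda>x y b. lagging p x y b n)) \<le> (\<Sum>n<N. pr (\<lambda>x y b. exploring p x y b n))"
proof (rule geometric_domination)
  show "pr (\<lambda>x y b. lagging p x y b 0) \<le> pr (\<lambda>x y b. exploring p x y b 0)"
    by (rule pr_mono[OF event_lagging event_exploring]) (rule queue_path.exploring_0)
  show "pr (\<lambda>x y b. lagging p x y b (Suc n)) \<le>
      pr (\<lambda>x y b. exploring p x y b (Suc n)) + (1 - emptying ^ kstar) * pr (\<lambda>x y b. lagging p x y b n)" for n
  proof -
    let ?\<psi> = "\<lambda>x y b. lagging p x y b n \<and> departures x y (Suc n) < kstar"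
    have e: "event ?\<psi>" by (intro event_conj event_lagging event_departures)
    have "pr (\<lambda>x y b. lagging p x y b (Suc n)) \<le> pr (\<lambda>x y b. exploring p x y b (Suc n) \<or> ?\<psi> x y b)"
      by (rule pr_mono[OF event_lagging event_disj[OF event_exploring e]])
        (use queue_path.lagging_Suc in blast)
    also have "\<dots> \<le> pr (\<lambda>x y b. exploring p x y b (Suc n)) + pr ?\<psi>"
      by (rule pr_or[OF event_exploring e])
    also have "pr ?\<psi> = (1 - emptying ^ kstar) * pr (\<lambda>x y b. lagging p x y b n)"
      by (rule pr_few_departures[OF event_lagging adapted_lagging])
    finally show ?thesis .
  qed
  show "emptying ^ kstar \<le> 1" using emptying by (simp add: power_le_one)
qed (rule pr_nonneg)

lemma sum_overtime:
  "emptying ^ max_threshold p j * (\<Sum>n<N. pr (\<lambda>x y b. overtime p x y b j n)) \<le>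
     (\<Sum>n<N. pr (\<lambda>x y b. over_at p x y b j (batch_len p j) n))"
proof (rule geometric_domination)
  show "pr (\<lambda>x y b. overtime p x y b j 0) \<le> pr (\<lambda>x y b. over_at p x y b j (batch_len p j) 0)"
    by (rule pr_mono[OF event_overtime event_over_at]) (use queue_path.not_overtime_0 in blast)
  show "pr (\<lambda>x y b. overtime p x y b j (Suc n)) \<le>
      pr (\<lambda>x y b. over_at p x y b j (batch_len p j) (Suc n)) +
      (1 - emptying ^ max_threshold p j) * pr (\<lambda>x y b. overtime p x y b j n)" for n
  proof -
    let ?\<psi> = "\<lambda>x y b. overtime p x y b j n \<and> departures x y (Suc n) < max_threshold p j"
    have e: "event ?\<psi>" by (intro event_conj event_overtime event_departures)
    have "pr (\<lambda>x y b. overtime p x y b j (Suc n)) \<le> pr (\<lambda>x y b. over_at p x y b j (batch_len p j) (Suc n) \<or> ?\<psi> x y b)"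
      by (rule pr_mono[OF event_overtime event_disj[OF event_over_at e]])
        (use queue_path.overtime_Suc in blast)
    also have "\<dots> \<le> pr (\<lambda>x y b. over_at p x y b j (batch_len p j) (Suc n)) + pr ?\<psi>"
      by (rule pr_or[OF event_over_at e])
    also have "pr ?\<psi> = (1 - emptying ^ max_threshold p j) * pr (\<lambda>x y b. overtime p x y b j n)"
      by (rule pr_few_departures[OF event_overtime adapted_overtime])
    finally show ?thesis .
  qed
  show "emptying ^ max_threshold p j \<le> 1" using emptying by (simp add: power_le_one)
qed (rule pr_nonneg)

text \<open>A batch has only one phase 2, so this is the probability that batch \<open>j\<close> has
  begun to overestimate within the first \<open>N\<close> arrivals.\<close>

definition over_starts :: "nat \<Rightarrow> nat \<Rightarrow> real" where
  "over_starts N j = (\<Sum>n<N. pr (\<lambda>x y b. over_at p x y b j 0 n))"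

lemma event_False: "event (\<lambda>x y b. False)"
  by (simp add: event_def)

lemma pr_False: "pr (\<lambda>x y b. False) = 0"
  by (simp add: pr_def)

text \<open>An overestimating phase 2 costs its guaranteed length plus an expected wait of at most
  \<open>1 / emptying ^ max_threshold p j\<close> arrivals for an empty queue.\<close>

lemma sum_over_batch:
  "(\<Sum>n<N. pr (\<lambda>x y b. overestimating p x y b n \<and> batch (learner_seen p x y b (Suc n)) = j)) \<le>
     (real (batch_len p j) + 1 / emptying ^ max_threshold p j) * over_starts N j"
proof -
  have 1: "(\<Sum>n<N. pr (\<lambda>x y b. overestimating p x y b n \<and> batch (learner_seen p x y b (Suc n)) = j)) \<le>
    real (batch_len p j) * (\<Sum>n<N. pr (\<lambda>x y b. over_at p x y b j 0 n)) + (\<Sum>n<N. pr (\<lambda>x y b. overtime p x y b j n)) + 0"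
  proof (rule sum_pr_le[OF event_over_batch event_over_at event_overtime])
    show "AE \<omega> in M. (\<Sum>n<N. of_bool (overestimating p (xs \<omega>) (ys \<omega>) (bs \<omega>) n \<and> batch (learner_seen p (xs \<omega>) (ys \<omega>) (bs \<omega>) (Suc n)) = j)) \<le>
      real (batch_len p j) * (\<Sum>n<N. of_bool (over_at p (xs \<omega>) (ys \<omega>) (bs \<omega>) j 0 n)) +
      (\<Sum>n<N. of_bool (overtime p (xs \<omega>) (ys \<omega>) (bs \<omega>) j n)) + (0 :: real)"
      using AE_path
    proof eventually_elim
      case (elim \<omega>)
      have "real (\<Sum>n<N. of_bool (overestimating p (xs \<omega>) (ys \<omega>) (bs \<omega>) n \<and> batch (learner_seen p (xs \<omega>) (ys \<omega>) (bs \<omega>) (Suc n)) = j)) \<le>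
        real (batch_len p j * (\<Sum>n<N. of_bool (over_at p (xs \<omega>) (ys \<omega>) (bs \<omega>) j 0 n)) + (\<Sum>n<N. of_bool (overtime p (xs \<omega>) (ys \<omega>) (bs \<omega>) j n)))"
        unfolding of_nat_le_iff by (rule queue_path.sum_overestimating_le[OF elim])
      then show ?case by (simp only: of_nat_add of_nat_mult of_nat_sum of_nat_of_bool add_0_right)
    qed
  qed
  have 2: "(\<Sum>n<N. pr (\<lambda>x y b. over_at p x y b j (batch_len p j) n)) \<le> 1 * over_starts N j + (\<Sum>n<0. pr (\<lambda>x y b. False)) + 0"
    unfolding over_starts_def
  proof (rule sum_pr_le[OF event_over_at event_over_at event_False])
    show "AE \<omega> in M. (\<Sum>n<N. of_bool (over_at p (xs \<omega>) (ys \<omega>) (bs \<omega>) j (batch_len p j) n)) \<le>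
      1 * (\<Sum>n<N. of_bool (over_at p (xs \<omega>) (ys \<omega>) (bs \<omega>) j 0 n)) + (\<Sum>n<0. of_bool False) + (0 :: real)"
      using AE_path
    proof eventually_elim
      case (elim \<omega>)
      have "real (\<Sum>n<N. of_bool (over_at p (xs \<omega>) (ys \<omega>) (bs \<omega>) j (batch_len p j) n)) \<le>
        real (\<Sum>n<N. of_bool (over_at p (xs \<omega>) (ys \<omega>) (bs \<omega>) j 0 n))"
        unfolding of_nat_le_iff by (rule queue_path.sum_over_at_le[OF elim])
      then show ?case by (simp only: of_nat_sum of_nat_of_bool) simp
    qed
  qed
  have d: "0 < emptying ^ max_threshold p j" using emptying by simp
  have "(\<Sum>n<N. pr (\<lambda>x y b. overtime p x y b j n)) * emptying ^ max_threshold p j \<le> over_starts N j"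
    using sum_overtime[of j N] 2 by (simp add: mult.commute pr_False)
  then have "(\<Sum>n<N. pr (\<lambda>x y b. overtime p x y b j n)) \<le> 1 / emptying ^ max_threshold p j * over_starts N j"
    using d by (simp add: le_divide_eq)
  then show ?thesis
    using 1 unfolding over_starts_def[symmetric] by (simp add: distrib_right)
qed

lemma over_starts_1: "over_starts N 1 \<le> 1"
proof -
  have "over_starts N 1 \<le> 0 * (\<Sum>n<0. pr (\<lambda>x y b. False)) + (\<Sum>n<0. pr (\<lambda>x y b. False)) + 1"
    unfolding over_starts_def
  proof (rule sum_pr_le[OF event_over_at event_False event_False])
    show "AE \<omega> in M. (\<Sum>n<N. of_bool (over_at p (xs \<omega>) (ys \<omega>) (bs \<omega>) 1 0 n)) \<le>
      0 * (\<Sum>n<0. of_bool False) + (\<Sum>n<0. of_bool False) + (1 :: real)"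
      using AE_path
    proof eventually_elim
      case (elim \<omega>)
      have "real (\<Sum>n<N. of_bool (over_at p (xs \<omega>) (ys \<omega>) (bs \<omega>) 1 0 n)) \<le> real 1"
        unfolding of_nat_le_iff by (rule queue_path.sum_over_at_0_first[OF elim])
      then show ?case by (simp only: of_nat_sum of_nat_of_bool) simp
    qed
  qed
  then show ?thesis by (simp add: pr_False)
qed

lemma event_bs: "event (\<lambda>x y b. b i)"
  unfolding event_def by (rule PP.b)

text \<open>The number of batches reached by arrival \<open>N\<close> is random but at most
  \<open>Suc N\<close>; counting the trials of all these batches makes the bound independent of the
  learner's progress.\<close>

lemma sum_exploring:
  "(\<Sum>n<N. pr (\<lambda>x y b. exploring p x y b n)) \<le> real (explore_len p) * (1 + (\<Sum>i=1..Suc N. pr (\<lambda>x y b. b i)))"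
proof -
  have "(\<Sum>n<N. pr (\<lambda>x y b. exploring p x y b n)) \<le>
    real (explore_len p) * (\<Sum>i<Suc N. pr (\<lambda>x y b. b (Suc i))) + (\<Sum>n<0. pr (\<lambda>x y b. False)) + real (explore_len p)"
  proof (rule sum_pr_le[OF event_exploring event_bs event_False])
    show "AE \<omega> in M. (\<Sum>n<N. of_bool (exploring p (xs \<omega>) (ys \<omega>) (bs \<omega>) n)) \<le>
      real (explore_len p) * (\<Sum>i<Suc N. of_bool (bs \<omega> (Suc i))) + (\<Sum>n<0. of_bool False) + real (explore_len p)"
      using AE_path
    proof eventually_elim
      case (elim \<omega>)
      interpret queue_path p "xs \<omega>" "ys \<omega>" "bs \<omega>" by fact
      have "(\<Sum>n<N. of_bool (exploring p (xs \<omega>) (ys \<omega>) (bs \<omega>) n)) \<le> explore_len p * (1 + explorations (bs \<omega>) (batch (run N)))"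
        using count_exploring[of N] by linarith
      also have "explorations (bs \<omega>) (batch (run N)) \<le> explorations (bs \<omega>) (Suc N)"
        unfolding explorations_def using batch_le[of N] by (intro sum_mono2) auto
      also have "explorations (bs \<omega>) (Suc N) = (\<Sum>i<Suc N. of_bool (bs \<omega> (Suc i)))"
        unfolding explorations_def by (rule sum.reindex_bij_witness[of _ Suc "\<lambda>i. i - 1"]) auto
      finally have "(\<Sum>n<N. of_bool (exploring p (xs \<omega>) (ys \<omega>) (bs \<omega>) n)) \<le> explore_len p * (1 + (\<Sum>i<Suc N. of_bool (bs \<omega> (Suc i))))"
        by simp
      then have "real (\<Sum>n<N. of_bool (exploring p (xs \<omega>) (ys \<omega>) (bs \<omega>) n)) \<le> real (explore_len p * (1 + (\<Sum>i<Suc N. of_bool (bs \<omega> (Suc i)))))"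
        unfolding of_nat_le_iff .
      then show ?case
        by (simp only: of_nat_add of_nat_mult of_nat_sum of_nat_of_bool of_nat_1 distrib_left) simp
    qed
  qed
  also have "(\<Sum>i<Suc N. pr (\<lambda>x y b. b (Suc i))) = (\<Sum>i=1..Suc N. pr (\<lambda>x y b. b i))"
    by (rule sum.reindex_bij_witness[of _ "\<lambda>i. i - 1" Suc]) auto
  finally show ?thesis by (simp add: distrib_left pr_False)
qed

section \<open>Stopping the martingale at the start of a batch\<close>

definition martingale_run :: "real \<Rightarrow> real \<Rightarrow> nat \<Rightarrow> (nat \<Rightarrow> real) \<Rightarrow> (nat \<Rightarrow> real) \<Rightarrow> (nat \<Rightarrow> bool) \<Rightarrow> real" where
  "martingale_run a g n x y b = service_martingale a g (epoch x n) (server_of (learner_run p x y b n))"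

definition martingale_seen :: "real \<Rightarrow> real \<Rightarrow> nat \<Rightarrow> (nat \<Rightarrow> real) \<Rightarrow> (nat \<Rightarrow> real) \<Rightarrow> (nat \<Rightarrow> bool) \<Rightarrow> real" where
  "martingale_seen a g n x y b = service_martingale a g (epoch x (Suc n)) (server_of (learner_seen p x y b (Suc n)))"

lemma measurable_service_martingale:
  assumes "measurable_server N st" "t \<in> borel_measurable N"
  shows "(\<lambda>w. service_martingale a g (t w) (st w)) \<in> borel_measurable N"
proof -
  note [measurable] = measurable_serverD[OF assms(1)] assms(2)
  show ?thesis unfolding service_martingale_def by measurable
qed

lemma measurable_martingale:
  "(\<lambda>w. martingale_run a g n (fst w) (snd (snd w)) (fst (snd w))) \<in> borel_measurable N3"
  "(\<lambda>\<omega>. martingale_run a g n (xs \<omega>) (ys \<omega>) (bs \<omega>)) \<in> borel_measurable M"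
  "(\<lambda>\<omega>. martingale_seen a g n (xs \<omega>) (ys \<omega>) (bs \<omega>)) \<in> borel_measurable M"
  unfolding martingale_run_def martingale_seen_def
  by (intro measurable_service_martingale measurable_learnerD(1) PP.measurable_learner_run MM.measurable_learner_run
    MM.measurable_learner_seen PP.epoch_x MM.epoch_x)+

text \<open>The weight \<open>F\<close> may depend on all trials, past and future, because
  adaptedness treats the trial sequence as known; the indicator keeps only paths on which batch
  \<open>j\<close> has not begun.\<close>

lemma martingale_step:
  fixes F :: "(nat \<Rightarrow> bool) \<Rightarrow> ennreal"
  assumes F [measurable]: "F \<in> borel_measurable Sbool" and a: "0 \<le> a"
  defines "g \<equiv> mu / (mu + a)"
  shows "(\<integral>\<^sup>+\<omega>. F (bs \<omega>) * ennreal (martingale_seen a g n (xs \<omega>) (ys \<omega>) (bs \<omega>)) *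
        of_bool (batch (learner_run p (xs \<omega>) (ys \<omega>) (bs \<omega>) n) < j) \<partial>M) =
    (\<integral>\<^sup>+\<omega>. F (bs \<omega>) * ennreal (martingale_run a g n (xs \<omega>) (ys \<omega>) (bs \<omega>)) *
        of_bool (batch (learner_run p (xs \<omega>) (ys \<omega>) (bs \<omega>) n) < j) \<partial>M)"
proof -
  let ?r = "\<lambda>x y b. learner_run p x y b n"
  let ?f = "\<lambda>x y b. F b * ennreal (martingale_run a g n x y b) * of_bool (batch (?r x y b) < j)"
  let ?q = "\<lambda>x y b. queue (server_of (?r x y b))"
  let ?w = "\<lambda>q s y. ennreal (service_factor a g q s y)"
  have g0: "0 < g" using mu_pos a by (simp add: g_def)
  have mart0: "0 \<le> martingale_run a g n x y b" for x y b
    using g0 by (simp add: martingale_run_def service_martingale_def)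
  have Fm: "(\<lambda>w. F (fst (snd w))) \<in> borel_measurable N3"
  proof -
    have "F \<in> borel_measurable SB" using F by simp
    then show ?thesis by (rule measurable_compose[OF measurable_compose[OF measurable_snd measurable_fst]])
  qed
  note [measurable] = Fm measurable_martingale(1) measurable_learnerD(2)[OF PP.measurable_learner_run]
    measurable_serverD(1)[OF measurable_learnerD(1)[OF PP.measurable_learner_run]]
  have f_q: "(\<lambda>w. ?f (fst w) (snd (snd w)) (fst (snd w)) * of_bool (?q (fst w) (snd (snd w)) (fst (snd w)) = q)) \<in> borel_measurable N3" for q
    unfolding of_bool_def by measurable
  have f_M: "(\<lambda>\<omega>. ?f (xs \<omega>) (ys \<omega>) (bs \<omega>) * of_bool (?q (xs \<omega>) (ys \<omega>) (bs \<omega>) = q)) \<in> borel_measurable M" for q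
    using measurable_compose[OF measurable_inputs f_q[of q]] by simp
  have adm: "adapted n (\<lambda>x y b. martingale_run a g n x y b)"
    unfolding martingale_run_def
    by (rule adapted_compose2[OF adapted_epoch adapted_learner_run, where h="\<lambda>t s. service_martingale a g t (server_of s)"])
  have ad: "adapted n (\<lambda>x y b. ?f x y b * of_bool (?q x y b = q))" for q
  proof -
    have 1: "adapted n (\<lambda>x y b. F b * ennreal (martingale_run a g n x y b))"
      by (rule adapted_compose2[OF adapted_const[of n F] adm, where h="\<lambda>c m. c * ennreal m"])
    have "adapted n (\<lambda>x y b. (F b * ennreal (martingale_run a g n x y b)) *
        (of_bool (batch (?r x y b) < j) * of_bool (?q x y b = q)))"
      by (rule adapted_compose2[OF 1 adapted_learner_run[of n p],
        where h="\<lambda>c r. c * (of_bool (batch r < j) * of_bool (queue (server_of r) = q))"])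
    then show ?thesis by (simp add: mult.assoc)
  qed
  have res: "(\<lambda>\<omega>. residual_gaps (epoch (xs \<omega>) n) (ys \<omega>)) \<in> measurable M YY.S"
    by (rule YY.residual_measurable[OF MM.epoch_x YY.measurable_into_S]) (rule ys_component)
  have wm: "(\<lambda>\<omega>. ?w q (xs \<omega> n) (residual_gaps (epoch (xs \<omega>) n) (ys \<omega>))) \<in> borel_measurable M" for q
    by (intro measurable_compose[OF _ measurable_ennreal] YY.service_factor_measurable xs_component res)
  have one: "(\<integral>\<^sup>+s. \<integral>\<^sup>+y. ?w q s y \<partial>Sy \<partial>XX.E) = 1" for q
  proof -
    have "(\<integral>\<^sup>+s. \<integral>\<^sup>+y. ?w q s y \<partial>Sy \<partial>XX.E) = (\<integral>\<^sup>+s. 1 \<partial>XX.E)"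
    proof (rule nn_integral_cong_AE)
      show "AE s in XX.E. (\<integral>\<^sup>+y. ?w q s y \<partial>Sy) = 1"
        using XX.AE_E_pos unfolding g_def
        by eventually_elim (rule YY.service_factor_integral[OF a], simp)
    qed
    then show ?thesis using XX.E.emeasure_space_1 by simp
  qed
  have step: "(\<integral>\<^sup>+\<omega>. ?f (xs \<omega>) (ys \<omega>) (bs \<omega>) * of_bool (?q (xs \<omega>) (ys \<omega>) (bs \<omega>) = q) * ?w q (xs \<omega> n) (residual_gaps (epoch (xs \<omega>) n) (ys \<omega>)) \<partial>M) =
    (\<integral>\<^sup>+\<omega>. ?f (xs \<omega>) (ys \<omega>) (bs \<omega>) * of_bool (?q (xs \<omega>) (ys \<omega>) (bs \<omega>) = q) \<partial>M)" for q
  proof -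
    have "(\<lambda>w. ?w q (fst w) (snd w)) \<in> borel_measurable (borel \<Otimes>\<^sub>M Sy)"
      by (intro measurable_compose[OF _ measurable_ennreal] YY.service_factor_measurable measurable_fst measurable_snd)
    from one_step[OF f_q this ad] show ?thesis by (simp add: one)
  qed
  \<comment> \<open>\<open>one_step\<close> needs a new factor free of the history, but
    \<open>service_factor\<close> depends on the current queue length; hence the decomposition by
    its value \<open>q\<close>.\<close>
  have "(\<integral>\<^sup>+\<omega>. F (bs \<omega>) * ennreal (martingale_seen a g n (xs \<omega>) (ys \<omega>) (bs \<omega>)) * of_bool (batch (?r (xs \<omega>) (ys \<omega>) (bs \<omega>)) < j) \<partial>M) =
    (\<integral>\<^sup>+\<omega>. (\<Sum>q. ?f (xs \<omega>) (ys \<omega>) (bs \<omega>) * of_bool (?q (xs \<omega>) (ys \<omega>) (bs \<omega>) = q) * ?w q (xs \<omega> n) (residual_gaps (epoch (xs \<omega>) n) (ys \<omega>))) \<partial>M)"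
  proof (rule nn_integral_cong_AE)
    show "AE \<omega> in M. F (bs \<omega>) * ennreal (martingale_seen a g n (xs \<omega>) (ys \<omega>) (bs \<omega>)) * of_bool (batch (?r (xs \<omega>) (ys \<omega>) (bs \<omega>)) < j) =
      (\<Sum>q. ?f (xs \<omega>) (ys \<omega>) (bs \<omega>) * of_bool (?q (xs \<omega>) (ys \<omega>) (bs \<omega>) = q) * ?w q (xs \<omega> n) (residual_gaps (epoch (xs \<omega>) n) (ys \<omega>)))"
      using AE_path
    proof eventually_elim
      case (elim \<omega>)
      interpret queue_path p "xs \<omega>" "ys \<omega>" "bs \<omega>" by fact
      let ?R = "residual_gaps (epoch (xs \<omega>) n) (ys \<omega>)"
      have "martingale_seen a g n (xs \<omega>) (ys \<omega>) (bs \<omega>) =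
        martingale_run a g n (xs \<omega>) (ys \<omega>) (bs \<omega>) * service_factor a g (queue_run n) (xs \<omega> n) ?R"
        unfolding martingale_seen_def martingale_run_def server_seen by (rule service_martingale_srv)
      then have "F (bs \<omega>) * ennreal (martingale_seen a g n (xs \<omega>) (ys \<omega>) (bs \<omega>)) * of_bool (batch (run n) < j) =
        ?f (xs \<omega>) (ys \<omega>) (bs \<omega>) * ?w (queue_run n) (xs \<omega> n) ?R"
        using mart0 by (simp add: ennreal_mult' ac_simps)
      also have "\<dots> = (\<Sum>q. (?f (xs \<omega>) (ys \<omega>) (bs \<omega>) * ?w q (xs \<omega> n) ?R) * of_bool (queue_run n = q))"
        by (rule suminf_of_bool_eq[symmetric])
      also have "\<dots> = (\<Sum>q. ?f (xs \<omega>) (ys \<omega>) (bs \<omega>) * of_bool (queue_run n = q) * ?w q (xs \<omega> n) ?R)"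
        by (intro suminf_cong) (simp only: ac_simps)
      finally show ?case .
    qed
  qed
  also have "\<dots> = (\<Sum>q. \<integral>\<^sup>+\<omega>. ?f (xs \<omega>) (ys \<omega>) (bs \<omega>) * of_bool (?q (xs \<omega>) (ys \<omega>) (bs \<omega>) = q) * ?w q (xs \<omega> n) (residual_gaps (epoch (xs \<omega>) n) (ys \<omega>)) \<partial>M)"
    by (rule nn_integral_suminf) (intro borel_measurable_times_ennreal f_M wm)
  also have "\<dots> = (\<integral>\<^sup>+\<omega>. (\<Sum>q. ?f (xs \<omega>) (ys \<omega>) (bs \<omega>) * of_bool (?q (xs \<omega>) (ys \<omega>) (bs \<omega>) = q)) \<partial>M)"
    unfolding step by (rule nn_integral_suminf[symmetric]) (rule f_M)
  finally show ?thesis unfolding suminf_of_bool_eq .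
qed

text \<open>Optional stopping in summed form: as long as batch \<open>j\<close> has not begun, the
  weighted mean is preserved, and an arrival that opens it moves the mass of its paths from the
  first term to the sum for good.\<close>

lemma martingale_bound:
  fixes F :: "(nat \<Rightarrow> bool) \<Rightarrow> ennreal"
  assumes F: "F \<in> borel_measurable Sbool" and a: "0 \<le> a" and j: "1 < j"
  defines "g \<equiv> mu / (mu + a)"
  shows "(\<integral>\<^sup>+\<omega>. F (bs \<omega>) * ennreal (martingale_run a g n (xs \<omega>) (ys \<omega>) (bs \<omega>)) *
        of_bool (batch (learner_run p (xs \<omega>) (ys \<omega>) (bs \<omega>) n) < j) \<partial>M) +
     (\<Sum>m<n. \<integral>\<^sup>+\<omega>. F (bs \<omega>) * ennreal (martingale_seen a g m (xs \<omega>) (ys \<omega>) (bs \<omega>)) *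
        of_bool (new_batch p (xs \<omega>) (ys \<omega>) (bs \<omega>) j m) \<partial>M) \<le> (\<integral>\<^sup>+\<omega>. F (bs \<omega>) \<partial>M)"
proof (induction n)
  case 0
  show ?case using j by (simp add: martingale_run_def service_martingale_def init_learner_def init_server_def)
next
  case (Suc n)
  have FM: "(\<lambda>\<omega>. F (bs \<omega>)) \<in> borel_measurable M" by (rule measurable_compose[OF measurable_bs F])
  note [measurable] = FM measurable_martingale(2,3) measurable_learnerD(2)[OF MM.measurable_learner_run] MM.measurable_new_batch
  let ?s = "\<lambda>\<omega>. F (bs \<omega>) * ennreal (martingale_seen a g n (xs \<omega>) (ys \<omega>) (bs \<omega>))"
  have "(\<integral>\<^sup>+\<omega>. F (bs \<omega>) * ennreal (martingale_run a g (Suc n) (xs \<omega>) (ys \<omega>) (bs \<omega>)) *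
        of_bool (batch (learner_run p (xs \<omega>) (ys \<omega>) (bs \<omega>) (Suc n)) < j) \<partial>M) +
      (\<integral>\<^sup>+\<omega>. ?s \<omega> * of_bool (new_batch p (xs \<omega>) (ys \<omega>) (bs \<omega>) j n) \<partial>M) =
    (\<integral>\<^sup>+\<omega>. F (bs \<omega>) * ennreal (martingale_run a g (Suc n) (xs \<omega>) (ys \<omega>) (bs \<omega>)) *
        of_bool (batch (learner_run p (xs \<omega>) (ys \<omega>) (bs \<omega>) (Suc n)) < j) +
      ?s \<omega> * of_bool (new_batch p (xs \<omega>) (ys \<omega>) (bs \<omega>) j n) \<partial>M)"
    by (rule nn_integral_add[symmetric]; unfold of_bool_def; measurable)
  also have "\<dots> \<le> (\<integral>\<^sup>+\<omega>. ?s \<omega> * of_bool (batch (learner_run p (xs \<omega>) (ys \<omega>) (bs \<omega>) n) < j) \<partial>M)"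
  proof (rule nn_integral_mono_AE)
    show "AE \<omega> in M. F (bs \<omega>) * ennreal (martingale_run a g (Suc n) (xs \<omega>) (ys \<omega>) (bs \<omega>)) *
        of_bool (batch (learner_run p (xs \<omega>) (ys \<omega>) (bs \<omega>) (Suc n)) < j) +
      ?s \<omega> * of_bool (new_batch p (xs \<omega>) (ys \<omega>) (bs \<omega>) j n) \<le>
      ?s \<omega> * of_bool (batch (learner_run p (xs \<omega>) (ys \<omega>) (bs \<omega>) n) < j)"
      using AE_path
    proof eventually_elim
      case (elim \<omega>)
      interpret queue_path p "xs \<omega>" "ys \<omega>" "bs \<omega>" by fact
      have m: "martingale_run a g (Suc n) (xs \<omega>) (ys \<omega>) (bs \<omega>) = martingale_seen a g n (xs \<omega>) (ys \<omega>) (bs \<omega>)"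
        unfolding martingale_run_def martingale_seen_def server_run_Suc server_seen by (rule service_martingale_joined)
      show ?case
        using batch_seen[of n] unfolding m batch_run_Suc
        by (cases "batch (run n) < j"; cases "new_batch p (xs \<omega>) (ys \<omega>) (bs \<omega>) j n") (auto simp: new_batch_def)
    qed
  qed
  also have "\<dots> = (\<integral>\<^sup>+\<omega>. F (bs \<omega>) * ennreal (martingale_run a g n (xs \<omega>) (ys \<omega>) (bs \<omega>)) *
        of_bool (batch (learner_run p (xs \<omega>) (ys \<omega>) (bs \<omega>) n) < j) \<partial>M)"
    unfolding g_def by (rule martingale_step[OF F a])
  finally show ?case
    using Suc unfolding sum.lessThan_Suc
    by (smt (verit, ccfv_threshold) add.assoc add.commute add_mono_thms_linordered_semiring(3) order_trans)
qed

end

text \<open>A Chernoff exponent: \<open>mu / (mu + a)\<close> is the inverse of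
  \<open>1 + a / mu\<close>, and since \<open>th < 1 / mu\<close>, this outgrows
  \<open>exp (a * th)\<close> to first order in \<open>a\<close>.\<close>

lemma exp_tilt:
  fixes th mu :: real
  assumes "0 < mu" "0 < th" "th < 1 / mu"
  shows "\<exists>a>0. exp (a * th) * (mu / (mu + a)) < 1"
proof -
  \<comment> \<open>The first entry gives \<open>a * th \<le> 1\<close>, the range of the quadratic
    bound on \<open>exp\<close>; the second, with a factor \<open>2\<close> to spare for strictness,
    keeps the quadratic term below the first-order gain \<open>a * (1 / mu - th)\<close>.\<close>
  define a where "a = min (1 / th) ((1 / mu - th) / (2 * th\<^sup>2))"
  have a: "0 < a" "a * th \<le> 1" "a * th\<^sup>2 < 1 / mu - th"
  proof -
    show "0 < a" using assms by (simp add: a_def)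
    have "a \<le> 1 / th" by (simp add: a_def)
    then show "a * th \<le> 1" using assms by (simp add: field_simps)
    have "a \<le> (1 / mu - th) / (2 * th\<^sup>2)" by (simp add: a_def)
    then have "2 * (a * th\<^sup>2) \<le> 1 / mu - th" using assms(2) by (simp add: pos_le_divide_eq algebra_simps)
    moreover have "0 < a * th\<^sup>2" using \<open>0 < a\<close> assms by simp
    ultimately show "a * th\<^sup>2 < 1 / mu - th" by linarith
  qed
  have "exp (a * th) \<le> 1 + a * th + (a * th)\<^sup>2"
    using a assms by (intro exp_bound) auto
  also have "\<dots> = 1 + a * (th + a * th\<^sup>2)" by (simp add: algebra_simps power2_eq_square)
  also have "\<dots> < 1 + a * (1 / mu)" using a by (intro add_strict_left_mono mult_strict_left_mono) auto
  also have "\<dots> = (mu + a) / mu" using assms by (simp add: field_simps)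
  finally have "exp (a * th) < (mu + a) / mu" .
  then have "exp (a * th) * (mu / (mu + a)) < 1" using assms a(1) by (simp add: field_simps)
  then show ?thesis using a(1) by blast
qed

context queue_path
begin

text \<open>At a deceptive start the martingale has grown at least like a constant times
  \<open>exp (a * th) * g\<close> to the power of minus the completed services. These are at least
  half the successful trials, so the weight \<open>s\<close>, a square root, to the power of the
  trials does not outweigh this growth.\<close>

lemma deceptive_start_bound:
  assumes d: "deceptive_start p th x y b j n" and a: "0 < a" and g: "0 < g"
    and lt: "exp (a * th) * g < 1"
  defines "s \<equiv> sqrt (exp (a * th) * g)"
  shows "1 \<le> exp (a * th * real (explore_len p)) *
    (s ^ explorations b (j - 1) * service_martingale a g (epoch x (Suc n)) (srv n))"
proof -
  let ?c = "completed (srv n)" and ?t = "total_service (srv n)" and ?l = "real (explore_len p)"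
  have nb: "new_batch p x y b j n" and t: "?t \<le> th * (real ?c + ?l)"
    using d by (auto simp: deceptive_start_def)
  note c = new_batch_completed[OF nb]
  have s: "0 < s" "s \<le> 1" "s ^ 2 = exp (a * th) * g"
    using g lt by (auto simp: s_def)
  have "exp (a * th) ^ ?c * g ^ ?c = s ^ (2 * ?c)"
    by (simp add: power_mult s(3) power_mult_distrib)
  also have "\<dots> \<le> s ^ explorations b (j - 1)"
    using s c(1) by (intro power_decreasing) auto
  finally have 1: "exp (a * th) ^ ?c * g ^ ?c \<le> s ^ explorations b (j - 1)" .
  have "a * ?t \<le> a * (th * (real ?c + ?l))" using t a by simp
  then have "exp (- a * (th * (real ?c + ?l))) \<le> exp (- a * ?t)" by simp
  then have 2: "exp (- a * (th * (real ?c + ?l))) * (1 / g) ^ ?c \<le> service_martingale a g (epoch x (Suc n)) (srv n)"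
    using g c(2) by (simp add: service_martingale_def mult_right_mono)
  have e: "exp (a * th * ?l) * ((exp (a * th) ^ ?c) * exp (- a * (th * (real ?c + ?l)))) = 1"
    by (simp add: exp_of_nat_mult[symmetric] mult_exp_exp algebra_simps)
  have gg: "g ^ ?c * (1 / g) ^ ?c = 1" using g by (simp add: power_one_over)
  have "1 = exp (a * th * ?l) * ((exp (a * th) ^ ?c * g ^ ?c) * (exp (- a * (th * (real ?c + ?l))) * (1 / g) ^ ?c))"
  proof -
    have "E * ((A * G) * (D * H)) = (E * (A * D)) * (G * H)" for E A G D H :: real by (simp only: ac_simps)
    then show ?thesis by (simp only: e gg mult_1)
  qed
  also have "\<dots> \<le> exp (a * th * ?l) * (s ^ explorations b (j - 1) * service_martingale a g (epoch x (Suc n)) (srv n))"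
    using 1 2 s g by (intro mult_left_mono mult_mono) auto
  finally show ?thesis .
qed

end

context dispatch
begin

lemma measurable_explorations: "(\<lambda>b. explorations b j) \<in> measurable Sbool (count_space UNIV)"
proof -
  have [measurable]: "(\<lambda>b. b i) \<in> measurable Sbool (count_space UNIV)" for i
    by (rule measurable_component_singleton) simp
  show ?thesis unfolding explorations_def of_bool_def by measurable
qed

text \<open>Once the martingale has been eliminated, only trials remain; they are independent, so
  their generating function is a product.\<close>

lemma expectation_explorations:
  assumes "0 \<le> s" "s \<le> 1"
  shows "(\<integral>\<^sup>+\<omega>. ennreal (s ^ explorations (bs \<omega>) k) \<partial>M) = ennreal (\<Prod>i=1..k. 1 - (1 - s) * pr (\<lambda>x y b. b i))"
proof -
  let ?z = "\<lambda>v. ennreal (if v = 1 then s else 1)"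
  have "(\<integral>\<^sup>+\<omega>. ennreal (s ^ explorations (bs \<omega>) k) \<partial>M) = (\<integral>\<^sup>+\<omega>. (\<Prod>i=1..k. ?z (B i \<omega>)) \<partial>M)"
  proof (rule nn_integral_cong)
    fix \<omega>
    have "s ^ explorations (bs \<omega>) k = (\<Prod>i=1..k. s ^ of_bool (bs \<omega> i))"
      unfolding explorations_def by (rule power_sum)
    also have "\<dots> = (\<Prod>i=1..k. if B i \<omega> = 1 then s else 1)"
      by (intro prod.cong) (auto simp: bs_def)
    finally show "ennreal (s ^ explorations (bs \<omega>) k) = (\<Prod>i=1..k. ?z (B i \<omega>))"
      using assms by (simp add: prod_ennreal)
  qed
  also have "\<dots> = (\<Prod>i=1..k. \<integral>\<^sup>+\<omega>. ?z (B i \<omega>) \<partial>M)"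
  proof (rule indep_vars_nn_integral)
    have "indep_vars (\<lambda>_. borel) B {1..k}" by (rule indep_vars_subset[OF indep_B]) auto
    then show "indep_vars (\<lambda>_. borel) (\<lambda>i \<omega>. ?z (B i \<omega>)) {1..k}"
      by (rule indep_vars_compose2) measurable
  qed auto
  also have "\<dots> = (\<Prod>i=1..k. ennreal (1 - (1 - s) * pr (\<lambda>x y b. b i)))"
  proof (rule prod.cong)
    fix i assume i: "i \<in> {1..k}"
    have "(\<integral>\<^sup>+\<omega>. ?z (B i \<omega>) \<partial>M) = (\<integral>\<^sup>+\<omega>. ennreal (1 - (1 - s) * of_bool (bs \<omega> i)) \<partial>M)"
      using i by (intro nn_integral_cong) (auto simp: bs_def)
    also have "\<dots> = ennreal (expectation (\<lambda>\<omega>. 1 - (1 - s) * of_bool (bs \<omega> i)))"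
      using assms integrable_of_bool[OF event_bs[of i]]
      by (intro nn_integral_eq_integral Bochner_Integration.integrable_diff integrable_mult_right integrable_const) auto
    also have "expectation (\<lambda>\<omega>. 1 - (1 - s) * of_bool (bs \<omega> i)) = 1 - (1 - s) * pr (\<lambda>x y b. b i)"
      using integrable_of_bool[OF event_bs[of i]] expectation_of_bool[OF event_bs[of i]] prob_space
      by (subst Bochner_Integration.integral_diff) auto
    finally show "(\<integral>\<^sup>+\<omega>. ?z (B i \<omega>) \<partial>M) = ennreal (1 - (1 - s) * pr (\<lambda>x y b. b i))" .
  qed simp
  also have "\<dots> = ennreal (\<Prod>i=1..k. 1 - (1 - s) * pr (\<lambda>x y b. b i))"
  proof (rule prod_ennreal)
    fix i
    have "pr (\<lambda>x y b. b i) \<le> 1" by (simp add: pr_def)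
    then show "0 \<le> 1 - (1 - s) * pr (\<lambda>x y b. b i)"
      using assms pr_nonneg[of "\<lambda>x y b. b i"] mult_mono[of "1 - s" 1 "pr (\<lambda>x y b. b i)" 1] by simp
  qed
  finally show ?thesis .
qed

text \<open>Markov's inequality for the martingale weighted with \<open>s\<close> to the number of
  trials: \<open>deceptive_start_bound\<close> dominates the indicator, and
  \<open>martingale_bound\<close> leaves the mean of the weight alone.\<close>

lemma sum_deceptive_starts:
  assumes a: "0 < a" and j: "1 < j"
  defines "g \<equiv> mu / (mu + a)"
  assumes lt: "exp (a * th) * g < 1"
  defines "s \<equiv> sqrt (exp (a * th) * g)"
  shows "(\<Sum>n<N. pr (\<lambda>x y b. deceptive_start p th x y b j n)) \<le>
    exp (a * th * real (explore_len p)) * (\<Prod>i=1..j - 1. 1 - (1 - s) * pr (\<lambda>x y b. b i))"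
proof -
  let ?E = "exp (a * th * real (explore_len p))"
  let ?F = "\<lambda>b. ennreal (s ^ explorations b (j - 1))"
  have g: "0 < g" using mu_pos a by (simp add: g_def)
  have s: "0 < s" "s \<le> 1" using g lt by (auto simp: s_def)
  have F: "?F \<in> borel_measurable Sbool"
  proof -
    note [measurable] = measurable_explorations
    show ?thesis by measurable
  qed
  have FM: "(\<lambda>\<omega>. ?F (bs \<omega>)) \<in> borel_measurable M" by (rule measurable_compose[OF measurable_bs F])
  note [measurable] = FM measurable_martingale(3) MM.measurable_new_batch
  let ?W = "\<lambda>n \<omega>. ?F (bs \<omega>) * ennreal (martingale_seen a g n (xs \<omega>) (ys \<omega>) (bs \<omega>)) * of_bool (new_batch p (xs \<omega>) (ys \<omega>) (bs \<omega>) j n)"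
  have "ennreal (\<Sum>n<N. pr (\<lambda>x y b. deceptive_start p th x y b j n)) =
    (\<Sum>n<N. \<integral>\<^sup>+\<omega>. of_bool (deceptive_start p th (xs \<omega>) (ys \<omega>) (bs \<omega>) j n) \<partial>M)"
    by (simp add: nn_integral_of_bool[OF event_deceptive_start] pr_nonneg sum_ennreal)
  also have "\<dots> \<le> (\<Sum>n<N. \<integral>\<^sup>+\<omega>. ennreal ?E * ?W n \<omega> \<partial>M)"
  proof (intro sum_mono nn_integral_mono_AE)
    fix n
    show "AE \<omega> in M. of_bool (deceptive_start p th (xs \<omega>) (ys \<omega>) (bs \<omega>) j n) \<le> ennreal ?E * ?W n \<omega>"
      using AE_path
    proof eventually_elim
      case (elim \<omega>)
      interpret queue_path p "xs \<omega>" "ys \<omega>" "bs \<omega>" by fact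
      show ?case
      proof (cases "deceptive_start p th (xs \<omega>) (ys \<omega>) (bs \<omega>) j n")
        case True
        have m0: "0 \<le> martingale_seen a g n (xs \<omega>) (ys \<omega>) (bs \<omega>)"
          using g by (simp add: martingale_seen_def service_martingale_def)
        have "1 \<le> ?E * (s ^ explorations (bs \<omega>) (j - 1) * martingale_seen a g n (xs \<omega>) (ys \<omega>) (bs \<omega>))"
          using deceptive_start_bound[OF True a g lt] unfolding martingale_seen_def server_seen s_def .
        then have "ennreal 1 \<le> ennreal (?E * (s ^ explorations (bs \<omega>) (j - 1) * martingale_seen a g n (xs \<omega>) (ys \<omega>) (bs \<omega>)))"
          by (rule ennreal_leI)
        also have "\<dots> = ennreal ?E * (?F (bs \<omega>) * ennreal (martingale_seen a g n (xs \<omega>) (ys \<omega>) (bs \<omega>)))"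
          using s m0 by (simp add: ennreal_mult')
        finally show ?thesis using True by (simp add: deceptive_start_def)
      qed simp
    qed
  qed
  also have "\<dots> = ennreal ?E * (\<Sum>n<N. \<integral>\<^sup>+\<omega>. ?W n \<omega> \<partial>M)"
    unfolding sum_distrib_left
    by (intro sum.cong refl nn_integral_cmult; unfold of_bool_def; measurable)
  also have "\<dots> \<le> ennreal ?E * (\<integral>\<^sup>+\<omega>. ?F (bs \<omega>) \<partial>M)"
  proof (rule mult_left_mono)
    show "(\<Sum>n<N. \<integral>\<^sup>+\<omega>. ?W n \<omega> \<partial>M) \<le> (\<integral>\<^sup>+\<omega>. ?F (bs \<omega>) \<partial>M)"
      using martingale_bound[OF F less_imp_le[OF a] j, of N] unfolding g_def[symmetric]
      by (rule order_trans[rotated]) simp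
  qed simp
  also have "\<dots> = ennreal (?E * (\<Prod>i=1..j - 1. 1 - (1 - s) * pr (\<lambda>x y b. b i)))"
    using s by (subst expectation_explorations) (auto simp: ennreal_mult')
  finally show ?thesis
  proof (subst (asm) ennreal_le_iff)
    have "0 \<le> 1 - (1 - s) * pr (\<lambda>x y b. b i)" for i
    proof -
      have "pr (\<lambda>x y b. b i) \<le> 1" by (simp add: pr_def)
      then show ?thesis
        using s pr_nonneg[of "\<lambda>x y b. b i"] mult_mono[of "1 - s" 1 "pr (\<lambda>x y b. b i)" 1] by simp
    qed
    then show "0 \<le> ?E * (\<Prod>i=1..j - 1. 1 - (1 - s) * pr (\<lambda>x y b. b i))"
      by (intro mult_nonneg_nonneg prod_nonneg) auto
  qed
qed

lemma over_starts_le: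
  assumes j: "1 < j" and th: "0 < th"
    "\<And>m v. genie_opt p < crit_threshold (reward p) (hold_cost p) (1 / m) (1 / v) \<Longrightarrow> m \<le> th"
    and B1: "AE \<omega> in M. bs \<omega> 1"
  shows "over_starts N j \<le> 2 * (\<Sum>n<N. pr (\<lambda>x y b. deceptive_start p th x y b j n))"
proof -
  have "over_starts N j \<le> 2 * (\<Sum>n<N. pr (\<lambda>x y b. deceptive_start p th x y b j n)) + (\<Sum>n<0. pr (\<lambda>x y b. False)) + 0"
    unfolding over_starts_def
  proof (rule sum_pr_le[OF event_over_at event_deceptive_start event_False])
    show "AE \<omega> in M. (\<Sum>n<N. of_bool (over_at p (xs \<omega>) (ys \<omega>) (bs \<omega>) j 0 n)) \<le>
      2 * (\<Sum>n<N. of_bool (deceptive_start p th (xs \<omega>) (ys \<omega>) (bs \<omega>) j n)) + (\<Sum>n<0. of_bool False) + (0 :: real)"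
      using AE_path B1
    proof eventually_elim
      case (elim \<omega>)
      interpret queue_path p "xs \<omega>" "ys \<omega>" "bs \<omega>" by (rule elim(1))
      have "real (\<Sum>n<N. of_bool (over_at p (xs \<omega>) (ys \<omega>) (bs \<omega>) j 0 n)) \<le>
        real (2 * (\<Sum>n<N. of_bool (deceptive_start p th (xs \<omega>) (ys \<omega>) (bs \<omega>) j n)))"
        unfolding of_nat_le_iff by (rule sum_over_at_0_le[OF j elim(2) th(1)]) (rule th(2))
      then show ?case by (simp only: of_nat_mult of_nat_sum of_nat_of_bool of_nat_numeral) simp
    qed
  qed
  then show ?thesis by (simp add: pr_False)
qed

section \<open>The expected profit gap\<close>

lemma next_gap:
  assumes e: "event \<phi>" and ad: "adapted n \<phi>"
  shows "has_bochner_integral M (\<lambda>\<omega>. of_bool (\<phi> (xs \<omega>) (ys \<omega>) (bs \<omega>)) * xs \<omega> n) (pr \<phi> / lam)"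
proof (rule has_bochner_integral_nn_integral)
  note [measurable] = event_M[OF e] xs_component
  show "(\<lambda>\<omega>. of_bool (\<phi> (xs \<omega>) (ys \<omega>) (bs \<omega>)) * xs \<omega> n) \<in> borel_measurable M"
    unfolding of_bool_def by measurable
  show "AE \<omega> in M. 0 \<le> of_bool (\<phi> (xs \<omega>) (ys \<omega>) (bs \<omega>)) * xs \<omega> n"
    using AE_path
  proof eventually_elim
    case (elim \<omega>)
    interpret queue_path p "xs \<omega>" "ys \<omega>" "bs \<omega>" by fact
    show ?case using x_pos by (simp add: less_imp_le)
  qed
  show "0 \<le> pr \<phi> / lam" using lam_pos pr_nonneg by simp
  have "(\<integral>\<^sup>+\<omega>. of_bool (\<phi> (xs \<omega>) (ys \<omega>) (bs \<omega>)) * ennreal (xs \<omega> n) \<partial>M) =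
    (\<integral>\<^sup>+\<omega>. of_bool (\<phi> (xs \<omega>) (ys \<omega>) (bs \<omega>)) \<partial>M) * (\<integral>\<^sup>+s. \<integral>\<^sup>+y. ennreal s \<partial>Sy \<partial>XX.E)"
  proof (rule one_step[where g="\<lambda>s y. ennreal s"])
    show "(\<lambda>w. of_bool (\<phi> (fst w) (snd (snd w)) (fst (snd w))) :: ennreal) \<in> borel_measurable N3"
      using e unfolding event_def of_bool_def by measurable
    show "adapted n (\<lambda>x y b. of_bool (\<phi> x y b) :: ennreal)" by (rule adapted_compose[OF ad])
  qed measurable
  also have "\<dots> = ennreal (pr \<phi> / lam)"
    using YY.P.emeasure_space_1 lam_pos
    by (simp add: nn_integral_of_bool[OF e] exponential_mean[OF lam_pos] ennreal_mult'[symmetric] pr_nonneg)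
  moreover have "ennreal (of_bool P * r) = of_bool P * ennreal r" for P r by (cases P) auto
  ultimately show "(\<integral>\<^sup>+\<omega>. ennreal (of_bool (\<phi> (xs \<omega>) (ys \<omega>) (bs \<omega>)) * xs \<omega> n) \<partial>M) = ennreal (pr \<phi> / lam)"
    by (simp only:)
qed

lemma adapted_over_batch:
  "adapted (Suc n) (\<lambda>x y b. overestimating p x y b n \<and> batch (learner_seen p x y b (Suc n)) = j)"
  unfolding overestimating_def by (rule adapted_compose[OF adapted_learner_seen])

text \<open>The holding cost of an overestimating arrival depends on its random batch. Splitting by
  the batch number first makes each summand a constant times an indicator times an independent gap,
  whose mean is \<open>1 / lam\<close>; integrability of the gap comes out of the same
  domination.\<close>

lemma expected_gap:
  defines "G \<equiv> \<lambda>N \<omega>. profit_gap p (xs \<omega>) (ys \<omega>) (bs \<omega>) (epoch (xs \<omega>) N)"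
    and "e \<equiv> \<lambda>n. pr (\<lambda>x y b. exploring p x y b n)" and "l \<equiv> \<lambda>n. pr (\<lambda>x y b. lagging p x y b n)"
    and "v \<equiv> \<lambda>j n. pr (\<lambda>x y b. overestimating p x y b n \<and> batch (learner_seen p x y b (Suc n)) = j)"
  shows "integrable M (G N)"
    "\<bar>expectation (G N)\<bar> \<le> reward p * (\<Sum>n<N. e n + (\<Sum>j=1..Suc N. v j n) + l n) +
       hold_cost p * (\<Sum>n<N. real kstar * (l n / lam) + (\<Sum>j=1..Suc N. real (max_threshold p j) * (v j n / lam)))"
proof -
  let ?ev = "\<lambda>\<phi> \<omega>. of_bool (\<phi> (xs \<omega>) (ys \<omega>) (bs \<omega>)) :: real"
  let ?E = "\<lambda>n x y b. exploring p x y b n" and ?L = "\<lambda>n x y b. lagging p x y b n"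
  let ?O = "\<lambda>j n x y b. overestimating p x y b n \<and> batch (learner_seen p x y b (Suc n)) = j"
  let ?rhs = "\<lambda>\<omega>. reward p * (\<Sum>n<N. ?ev (?E n) \<omega> + (\<Sum>j=1..Suc N. ?ev (?O j n) \<omega>) + ?ev (?L n) \<omega>) +
       hold_cost p * (\<Sum>n<N. real kstar * (?ev (?L n) \<omega> * xs \<omega> (Suc n)) +
         (\<Sum>j=1..Suc N. real (max_threshold p j) * (?ev (?O j n) \<omega> * xs \<omega> (Suc n))))"
  have bound: "AE \<omega> in M. \<bar>G N \<omega>\<bar> \<le> ?rhs \<omega>"
    using AE_path
  proof eventually_elim
    case (elim \<omega>)
    interpret queue_path p "xs \<omega>" "ys \<omega>" "bs \<omega>" by fact
    have o1: "of_bool (overestimating p (xs \<omega>) (ys \<omega>) (bs \<omega>) n) = (\<Sum>j=1..Suc N. ?ev (?O j n) \<omega>)" if "n < N" for n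
      using overestimating_split[OF that, of "\<lambda>_. 1"] by simp
    have o2: "(real kstar * ?ev (?L n) \<omega> + real (max_threshold p (batch (seen n))) * of_bool (overestimating p (xs \<omega>) (ys \<omega>) (bs \<omega>) n)) * xs \<omega> (Suc n) =
       real kstar * (?ev (?L n) \<omega> * xs \<omega> (Suc n)) + (\<Sum>j=1..Suc N. real (max_threshold p j) * (?ev (?O j n) \<omega> * xs \<omega> (Suc n)))"
      if "n < N" for n
      unfolding overestimating_split[OF that, of "\<lambda>j. real (max_threshold p j)"]
      by (simp only: distrib_right sum_distrib_right mult.assoc)
    have "\<bar>G N \<omega>\<bar> \<le> reward p * (\<Sum>n<N. ?ev (?E n) \<omega> + of_bool (overestimating p (xs \<omega>) (ys \<omega>) (bs \<omega>) n) + ?ev (?L n) \<omega>) +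
      hold_cost p * (\<Sum>n<N. (real kstar * ?ev (?L n) \<omega> + real (max_threshold p (batch (seen n))) * of_bool (overestimating p (xs \<omega>) (ys \<omega>) (bs \<omega>) n)) * xs \<omega> (Suc n))"
      unfolding G_def using reward_pos hold_cost_pos by (intro profit_gap_le) auto
    also have "\<dots> = ?rhs \<omega>"
      using o1 o2 by (intro arg_cong2[where f="(+)"] arg_cong2[where f="(*)"] refl sum.cong) auto
    finally show ?case .
  qed
  have hb_ev: "has_bochner_integral M (?ev \<phi>) (pr \<phi>)" if "event \<phi>" for \<phi>
    using integrable_of_bool[OF that] expectation_of_bool[OF that] by (simp add: has_bochner_integral_iff)
  have hb: "has_bochner_integral M ?rhs (reward p * (\<Sum>n<N. e n + (\<Sum>j=1..Suc N. v j n) + l n) +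
       hold_cost p * (\<Sum>n<N. real kstar * (l n / lam) + (\<Sum>j=1..Suc N. real (max_threshold p j) * (v j n / lam))))"
    unfolding e_def l_def v_def
    by (intro has_bochner_integral_add has_bochner_integral_mult_right has_bochner_integral_sum hb_ev
      next_gap event_exploring event_lagging event_over_batch adapted_lagging adapted_over_batch)
  have Gm: "G N \<in> borel_measurable M"
    unfolding G_def by (rule MM.measurable_profit_gap) (rule MM.epoch_x)
  have irhs: "integrable M ?rhs" using hb by (simp only: has_bochner_integral_iff)
  show int: "integrable M (G N)"
  proof (rule Bochner_Integration.integrable_bound[OF irhs Gm])
    show "AE \<omega> in M. norm (G N \<omega>) \<le> norm (?rhs \<omega>)"
      using bound
    proof (rule eventually_mono)
      fix \<omega> assume "\<bar>G N \<omega>\<bar> \<le> ?rhs \<omega>"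
      then show "norm (G N \<omega>) \<le> norm (?rhs \<omega>)"
        unfolding real_norm_def by (rule order_trans[OF _ abs_ge_self])
    qed
  qed
  have "\<bar>expectation (G N)\<bar> \<le> expectation (\<lambda>\<omega>. \<bar>G N \<omega>\<bar>)" by (rule integral_abs_bound)
  also have "\<dots> \<le> expectation ?rhs"
    by (rule integral_mono_AE[OF integrable_abs[OF int] irhs bound])
  also have "\<dots> = reward p * (\<Sum>n<N. e n + (\<Sum>j=1..Suc N. v j n) + l n) +
       hold_cost p * (\<Sum>n<N. real kstar * (l n / lam) + (\<Sum>j=1..Suc N. real (max_threshold p j) * (v j n / lam)))"
    using hb by (simp only: has_bochner_integral_iff)
  finally show "\<bar>expectation (G N)\<bar> \<le> reward p * (\<Sum>n<N. e n + (\<Sum>j=1..Suc N. v j n) + l n) +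
       hold_cost p * (\<Sum>n<N. real kstar * (l n / lam) + (\<Sum>j=1..Suc N. real (max_threshold p j) * (v j n / lam)))" .
qed

text \<open>An exploring arrival costs at most a reward plus the lag it causes: at most
  \<open>1 / emptying ^ kstar\<close> lagging arrivals on average, each costing a reward and the
  holding of \<open>kstar\<close> customers for a mean gap.\<close>

lemma expected_gap_le:
  "\<bar>expectation (\<lambda>\<omega>. profit_gap p (xs \<omega>) (ys \<omega>) (bs \<omega>) (epoch (xs \<omega>) N))\<bar> \<le>
    (reward p + (reward p + hold_cost p * real kstar / lam) / emptying ^ kstar) *
      (real (explore_len p) * (1 + (\<Sum>i=1..Suc N. pr (\<lambda>x y b. b i)))) +
    (reward p + hold_cost p / lam) * (\<Sum>j=1..Suc N. real (max_threshold p j) *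
      ((real (batch_len p j) + 1 / emptying ^ max_threshold p j) * over_starts N j))"
proof -
  let ?e = "\<lambda>n. pr (\<lambda>x y b. exploring p x y b n)" and ?l = "\<lambda>n. pr (\<lambda>x y b. lagging p x y b n)"
  let ?o = "\<lambda>j n. pr (\<lambda>x y b. overestimating p x y b n \<and> batch (learner_seen p x y b (Suc n)) = j)"
  let ?k = "\<lambda>j. real (max_threshold p j)"
  let ?x = "real (explore_len p) * (1 + (\<Sum>i=1..Suc N. pr (\<lambda>x y b. b i)))"
  let ?O = "\<Sum>j=1..Suc N. ?k j * (\<Sum>n<N. ?o j n)"
  have d: "0 < emptying ^ kstar" using emptying by simp
  have e: "(\<Sum>n<N. ?e n) \<le> ?x" by (rule sum_exploring)
  have l: "(\<Sum>n<N. ?l n) \<le> ?x / emptying ^ kstar"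
    using sum_lagging[of N] e d by (simp add: le_divide_eq mult.commute)
  \<comment> \<open>The caps are at least \<open>1\<close>, so lost rewards of overestimating
    arrivals can be absorbed into the sum weighted with the caps.\<close>
  have k1: "1 \<le> ?k j" for j using explore_len kstar_le_max_threshold[of j] by simp
  have o1: "(\<Sum>n<N. \<Sum>j=1..Suc N. ?o j n) \<le> ?O"
  proof (subst sum.swap, rule sum_mono)
    fix j
    show "(\<Sum>n<N. ?o j n) \<le> ?k j * (\<Sum>n<N. ?o j n)"
      using mult_right_mono[OF k1[of j] sum_nonneg[OF pr_nonneg], of "\<lambda>n. \<lambda>x y b. overestimating p x y b n \<and> batch (learner_seen p x y b (Suc n)) = j" "{..<N}"]
      by simp
  qed
  have o2: "?O \<le> (\<Sum>j=1..Suc N. ?k j * ((real (batch_len p j) + 1 / emptying ^ max_threshold p j) * over_starts N j))"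
    by (intro sum_mono mult_left_mono sum_over_batch) simp
  have o3: "(\<Sum>n<N. \<Sum>j=1..Suc N. ?k j * (?o j n / lam)) = ?O / lam"
    by (subst sum.swap) (simp only: sum_distrib_left sum_divide_distrib times_divide_eq_right)
  have "\<bar>expectation (\<lambda>\<omega>. profit_gap p (xs \<omega>) (ys \<omega>) (bs \<omega>) (epoch (xs \<omega>) N))\<bar> \<le>
    reward p * (\<Sum>n<N. ?e n + (\<Sum>j=1..Suc N. ?o j n) + ?l n) +
       hold_cost p * (\<Sum>n<N. real kstar * (?l n / lam) + (\<Sum>j=1..Suc N. ?k j * (?o j n / lam)))"
    by (rule expected_gap(2))
  also have "\<dots> = reward p * ((\<Sum>n<N. ?e n) + (\<Sum>n<N. \<Sum>j=1..Suc N. ?o j n) + (\<Sum>n<N. ?l n)) +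
      hold_cost p * (real kstar / lam * (\<Sum>n<N. ?l n) + ?O / lam)"
    unfolding sum.distrib o3 by (simp only: sum_distrib_left times_divide_eq_left times_divide_eq_right)
  also have "\<dots> \<le> reward p * (?x + ?O + ?x / emptying ^ kstar) + hold_cost p * (real kstar / lam * (?x / emptying ^ kstar) + ?O / lam)"
    using reward_pos hold_cost_pos lam_pos by (intro add_mono mult_left_mono e l o1) auto
  also have "\<dots> = (reward p + (reward p + hold_cost p * real kstar / lam) / emptying ^ kstar) * ?x + (reward p + hold_cost p / lam) * ?O"
  proof -
    have "R * (x + v + x / d) + H * (k / m * (x / d) + v / m) = (R + (R + H * k / m) / d) * x + (R + H / m) * v"
      for R x v d H k m :: real by (simp add: add_divide_distrib algebra_simps)
    then show ?thesis .
  qed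
  also have "\<dots> \<le> (reward p + (reward p + hold_cost p * real kstar / lam) / emptying ^ kstar) * ?x +
    (reward p + hold_cost p / lam) * (\<Sum>j=1..Suc N. ?k j * ((real (batch_len p j) + 1 / emptying ^ max_threshold p j) * over_starts N j))"
    using reward_pos hold_cost_pos lam_pos by (intro add_left_mono mult_left_mono o2) auto
  finally show ?thesis .
qed

end

section \<open>Growth rates\<close>

lemma harm_le_ln: "1 \<le> n \<Longrightarrow> harm n \<le> ln (real n) + (1 :: real)"
proof -
  assume "1 \<le> n"
  then obtain m where m: "n = Suc m" by (cases n) auto
  have "harm (Suc m) - ln (real (Suc m)) \<le> harm (Suc 0) - ln (real (Suc 0))"
    using decseq_harm_diff_ln by (rule decseqD) simp
  then show ?thesis unfolding m by (simp add: harm_def)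
qed

lemma sum_inverse_harm: "(\<Sum>i=1..n. a / real i) = a * harm n"
  by (simp add: harm_def sum_distrib_left divide_inverse)

text \<open>Bounding each numerator by its value at \<open>N\<close> leaves a harmonic sum from
  \<open>2\<close> to \<open>N\<close>, which is at most \<open>ln N\<close>. The \<open>2\<close>
  pays for the indices \<open>1\<close> and \<open>Suc N\<close>.\<close>

lemma sum_exploration_le:
  fixes q :: "nat \<Rightarrow> real"
  assumes "q 1 = 1" "\<And>i. 1 < i \<Longrightarrow> q i = min 1 (ln (real i) powr eps / real i)" "0 < eps" "1 \<le> N"
  shows "(\<Sum>i=1..Suc N. q i) \<le> 2 + ln (real N) powr (1 + eps)"
proof -
  have "q i \<le> ln (real N) powr eps / real i" if "i \<in> {2..N}" for i
  proof -
    have "ln (real i) powr eps \<le> ln (real N) powr eps"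
      using that assms(3) by (intro powr_mono2) auto
    then show ?thesis using that assms(2)[of i] by (simp add: divide_right_mono min.coboundedI2)
  qed
  then have "(\<Sum>i=2..N. q i) \<le> (\<Sum>i=2..N. ln (real N) powr eps / real i)" by (rule sum_mono)
  also have "\<dots> = ln (real N) powr eps * (harm N - 1)"
  proof -
    have "{1..N} = insert 1 {2..N}" using assms(4) by auto
    then have "(\<Sum>i=1..N. ln (real N) powr eps / real i) = ln (real N) powr eps + (\<Sum>i=2..N. ln (real N) powr eps / real i)"
      by simp
    then show ?thesis unfolding sum_inverse_harm by (simp add: algebra_simps)
  qed
  also have "\<dots> \<le> ln (real N) powr eps * ln (real N)"
    using harm_le_ln[OF assms(4)] by (intro mult_left_mono) auto
  also have "\<dots> = ln (real N) powr (1 + eps)"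
    using assms(4) by (cases "ln (real N) = 0") (auto simp: powr_add)
  finally have "(\<Sum>i=2..N. q i) \<le> ln (real N) powr (1 + eps)" .
  moreover have "(\<Sum>i=1..Suc N. q i) = q 1 + (\<Sum>i=2..N. q i) + q (Suc N)"
  proof -
    have "{1..Suc N} = insert 1 (insert (Suc N) {2..N})" "Suc N \<noteq> 1" using assms(4) by auto
    then show ?thesis by simp
  qed
  moreover have "q (Suc N) \<le> 1" using assms(2)[of "Suc N"] assms(4) by simp
  ultimately show ?thesis using assms(1) by simp
qed

text \<open>Here \<open>eps > 0\<close> is essential: \<open>ln\<close> to the power \<open>eps\<close> outgrows every constant \<open>A\<close>.\<close>

lemma exploration_superpolynomial:
  fixes q :: "nat \<Rightarrow> real"
  assumes q1: "q 1 = 1" and q: "\<And>i. 1 < i \<Longrightarrow> q i = min 1 (ln (real i) powr eps / real i)"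
    and "0 < eps" "0 < k" "0 < m"
  shows "\<exists>C>0. \<forall>j>1. exp (- k * (\<Sum>i=1..j - 1. q i)) \<le> C * real j powr (- m)"
proof -
  \<comment> \<open>Chosen so that \<open>k * A = m\<close>, the required order of decay.\<close>
  define A where "A = m / k"
  have A: "0 < A" using assms by (simp add: A_def)
  have "filterlim (\<lambda>i::nat. ln (real i) powr eps) at_top sequentially"
    using \<open>0 < eps\<close> by real_asymp
  then have "\<forall>\<^sub>F i in sequentially. A \<le> ln (real i) powr eps"
    by (simp add: filterlim_at_top)
  moreover have "\<forall>\<^sub>F i in sequentially. A \<le> real i" by real_asymp
  moreover have "\<forall>\<^sub>F i in sequentially. 1 < (i::nat)" by (rule eventually_gt_at_top)
  ultimately have "\<forall>\<^sub>F i in sequentially. A / real i \<le> q i"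
  proof eventually_elim
    case (elim i)
    then show ?case using q[of i] by (simp add: divide_le_eq divide_right_mono)
  qed
  then obtain n where n: "\<And>i. n \<le> i \<Longrightarrow> A / real i \<le> q i"
    unfolding eventually_sequentially by blast
  have q0: "0 \<le> q i" if "1 \<le> i" for i
    using q[of i] q1 that by (cases "i = 1") auto
  \<comment> \<open>Compensates for the finitely many indices below \<open>n\<close>, where
    \<open>q i\<close> may be smaller than \<open>A / i\<close>: their total deficit is at most
    \<open>A * harm n\<close>, and \<open>k * A = m\<close>.\<close>
  define C where "C = exp (m * harm n)"
  have "exp (- k * (\<Sum>i=1..j - 1. q i)) \<le> C * real j powr (- m)" if j: "1 < j" for j
  proof -
    have "(\<Sum>i=1..j - 1. A / real i - (if i \<le> n then A / real i else 0)) \<le> (\<Sum>i=1..j - 1. q i)"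
      using q0 n by (intro sum_mono) auto
    moreover have "(\<Sum>i=1..j - 1. if i \<le> n then A / real i else 0) \<le> A * harm n"
    proof -
      have "(\<Sum>i=1..j - 1. if i \<le> n then A / real i else 0) = (\<Sum>i\<in>{i\<in>{1..j - 1}. i \<le> n}. A / real i)"
        by (simp only: sum.inter_filter finite_atLeastAtMost)
      also have "\<dots> \<le> (\<Sum>i=1..n. A / real i)" using A by (intro sum_mono2) auto
      finally show ?thesis unfolding sum_inverse_harm .
    qed
    ultimately have "A * harm (j - 1) - A * harm n \<le> (\<Sum>i=1..j - 1. q i)"
      unfolding sum_subtractf sum_inverse_harm by linarith
    moreover have "A * ln (real j) \<le> A * harm (j - 1)"
      using ln_le_harm[of "j - 1"] j A by (intro mult_left_mono) auto
    ultimately have "A * ln (real j) - A * harm n \<le> (\<Sum>i=1..j - 1. q i)" by linarith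
    then have "k * (A * ln (real j) - A * harm n) \<le> k * (\<Sum>i=1..j - 1. q i)"
      using assms(4) by (intro mult_left_mono) auto
    moreover have "k * (A * ln (real j) - A * harm n) = m * ln (real j) - m * harm n"
      using assms(4) by (simp add: A_def right_diff_distrib)
    ultimately have "exp (- k * (\<Sum>i=1..j - 1. q i)) \<le> exp (m * harm n + - m * ln (real j))" by simp
    also have "\<dots> = C * real j powr (- m)" unfolding exp_add C_def powr_def using j by simp
    finally show ?thesis .
  qed
  then show ?thesis by (intro exI[of _ C]) (auto simp: C_def)
qed

lemma prod_one_minus_le_exp:
  fixes q :: "nat \<Rightarrow> real"
  assumes "\<And>i. 0 \<le> q i" "\<And>i. q i \<le> 1" "0 \<le> k" "k \<le> 1"
  shows "(\<Prod>i=1..n. 1 - k * q i) \<le> exp (- k * (\<Sum>i=1..n. q i))"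
proof -
  have "(\<Prod>i=1..n. 1 - k * q i) \<le> (\<Prod>i=1..n. exp (- (k * q i)))"
  proof (rule prod_mono)
    fix i
    have "k * q i \<le> 1" using mult_mono[of k 1 "q i" 1] assms by simp
    then show "0 \<le> 1 - k * q i \<and> 1 - k * q i \<le> exp (- (k * q i))"
      using exp_ge_add_one_self[of "- (k * q i)"] by simp
  qed
  also have "\<dots> = exp (- k * (\<Sum>i=1..n. q i))"
    by (simp add: exp_sum[symmetric] sum_negf sum_distrib_left)
  finally show ?thesis .
qed

text \<open>With a cap of order \<open>ln j\<close>, the exponential waiting time
  \<open>1 / r ^ max_threshold p j\<close> is at most of order \<open>j\<close> to the power
  \<open>ln (1 / r)\<close>; the other factors are polynomial by the growth condition.\<close>

lemma (in queue_params) cost_polynomial: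
  fixes r :: real
  assumes r: "0 < r" "r < 1" and a: "0 < a" "0 < c'" "\<And>j. 1 \<le> j \<Longrightarrow> growth p j \<le> c' * real j powr a"
  shows "\<exists>C>0. \<exists>d>0. \<forall>j\<ge>1. real (max_threshold p j) * (real (batch_len p j) + 1 / r ^ max_threshold p j) \<le> C * real j powr d"
proof -
  define e where "e = ln (1 / r)"
  have e: "0 < e" using r by (simp add: e_def)
  define C1 where "C1 = 1 + real kstar"
  define C2 where "C2 = c' * real (exploit_len p) + 1 + (1 / r) ^ kstar"
  have C: "0 < C1" "0 < C2" using a r by (auto simp: C1_def C2_def add_pos_nonneg intro!: add_nonneg_pos)
  have "real (max_threshold p j) * (real (batch_len p j) + 1 / r ^ max_threshold p j) \<le> (C1 * C2) * real j powr (1 + a + e)"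
    if j: "1 \<le> j" for j
  proof -
    define n where "n = nat (max \<lfloor>ln (real j)\<rfloor> 0)"
    have n: "real n \<le> ln (real j)" using j by (simp add: n_def le_floor_iff[symmetric])
    have mt: "max_threshold p j = n + kstar" by (simp add: max_threshold_def n_def)
    have j1: "1 \<le> real j powr b" if "0 \<le> b" for b using j that by (simp add: ge_one_powr_ge_zero)
    have "ln (real j) \<le> real j" using j by (intro ln_bound) auto
    then have 1: "real (max_threshold p j) \<le> C1 * real j powr 1"
      using n j mult_right_mono[of 1 "real j" "real kstar"] unfolding mt C1_def by (simp add: algebra_simps)
    have "1 / r ^ max_threshold p j = (1 / r) ^ kstar * (1 / r) powr real n"
      using r by (simp add: mt power_add powr_realpow power_one_over)
    also have "\<dots> \<le> (1 / r) ^ kstar * (1 / r) powr ln (real j)"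
      using r n by (intro mult_left_mono powr_mono) auto
    also have "(1 / r) powr ln (real j) = real j powr e"
      using r j by (simp add: powr_def e_def mult.commute)
    finally have 2: "1 / r ^ max_threshold p j \<le> (1 / r) ^ kstar * real j powr e" .
    have "real (batch_len p j) \<le> growth p j * real (exploit_len p) + 1"
      using growth[OF j] unfolding batch_len_def by (simp add: of_nat_nat)
    also have "\<dots> \<le> c' * real j powr a * real (exploit_len p) + real j powr a"
      using a(3)[OF j] j1[of a] a by (intro add_mono mult_right_mono) auto
    finally have 3: "real (batch_len p j) \<le> (c' * real (exploit_len p) + 1) * real j powr a"
      by (simp add: algebra_simps)
    have "real j powr a \<le> real j powr (a + e)" "real j powr e \<le> real j powr (a + e)"
      using j a e by (auto intro!: powr_mono)
    then have "(c' * real (exploit_len p) + 1) * real j powr a + (1 / r) ^ kstar * real j powr e \<le>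
      (c' * real (exploit_len p) + 1) * real j powr (a + e) + (1 / r) ^ kstar * real j powr (a + e)"
      using a r by (intro add_mono mult_left_mono) auto
    with 2 3 have 4: "real (batch_len p j) + 1 / r ^ max_threshold p j \<le> C2 * real j powr (a + e)"
      unfolding C2_def by (simp add: algebra_simps)
    have "real (max_threshold p j) * (real (batch_len p j) + 1 / r ^ max_threshold p j) \<le>
      (C1 * real j powr 1) * (C2 * real j powr (a + e))"
      using C r by (intro mult_mono 1 4) auto
    also have "\<dots> = (C1 * C2) * real j powr (1 + a + e)"
      by (simp add: powr_add algebra_simps)
    finally show ?thesis .
  qed
  moreover have "0 < 1 + a + e" using a e by simp
  moreover have "0 < C1 * C2" using C by simp
  ultimately show ?thesis by blast
qed

text \<open>Batches are numbered from \<open>1\<close>, so \<open>b 0\<close> is never inspected.\<close>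

lemma before_arrival_cong:
  assumes "\<And>j. 1 \<le> j \<Longrightarrow> b j = b' j"
  shows "before_arrival p x y b i s = before_arrival p x y b' i s"
proof -
  have e: "b (batch s + 1) = b' (batch s + 1)" by (rule assms) simp
  show ?thesis unfolding before_arrival_def Let_def e ..
qed

lemma learner_run_cong:
  assumes "\<And>j. 1 \<le> j \<Longrightarrow> b j = b' j"
  shows "learner_run p x y b n = learner_run p x y b' n"
  by (induction n) (simp_all only: learner_run.simps before_arrival_cong[of b b', OF assms])

lemma learner_seen_cong:
  assumes "\<And>j. 1 \<le> j \<Longrightarrow> b j = b' j"
  shows "learner_seen p x y b n = learner_seen p x y b' n"
  by (simp only: learner_seen_def learner_run_cong[of b b', OF assms] before_arrival_cong[of b b', OF assms])

lemma genie_run_cong: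
  assumes "\<And>j. 1 \<le> j \<Longrightarrow> b j = b' j"
  shows "genie_run p x y b n = genie_run p x y b' n"
  by (induction n) (simp_all only: genie_run.simps genie_before_arrival_def learner_seen_cong[of b b', OF assms])

lemma profit_gap_cong:
  assumes "\<And>j. 1 \<le> j \<Longrightarrow> b j = b' j"
  shows "profit_gap p x y b t = profit_gap p x y b' t"
  by (simp only: profit_gap_def genie_seen_def genie_before_arrival_def
    learner_run_cong[of b b', OF assms] learner_seen_cong[of b b', OF assms] genie_run_cong[of b b', OF assms])

lemma (in dispatch) regret_var_eq:
  "regret_var p X Y B N = (\<lambda>\<omega>. profit_gap p (xs \<omega>) (ys \<omega>) (bs \<omega>) (epoch (xs \<omega>) N))"
proof
  fix \<omega>
  have e: "(\<lambda>n. X n \<omega>) = xs \<omega>" "(\<lambda>n. Y n \<omega>) = ys \<omega>" by (auto simp: xs_def ys_def)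
  show "regret_var p X Y B N \<omega> = profit_gap p (xs \<omega>) (ys \<omega>) (bs \<omega>) (epoch (xs \<omega>) N)"
    unfolding regret_var_def e by (rule profit_gap_cong) (simp add: bs_def)
qed

text \<open>The cost of an overestimating batch is of some polynomial order \<open>d\<close>, fixed
  before the decay of its probability is chosen. Taking the order \<open>d + 2\<close> for the
  latter leaves the summable sequence \<open>j powr (- 2)\<close>, so all overestimations together
  cost a bounded amount.\<close>

lemma (in dispatch) overestimation_cost_bounded:
  fixes q :: "nat \<Rightarrow> real"
  assumes growth_le: "0 < a" "0 < c'" "\<And>j. 1 \<le> j \<Longrightarrow> growth p j \<le> c' * real j powr a"
    and eps: "0 < eps"
    and q_def: "\<And>i. q i = pr (\<lambda>x y b. b i)"
    and q1: "q 1 = 1" and q: "\<And>i. 1 < i \<Longrightarrow> q i = min 1 (ln (real i) powr eps / real i)"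
    and th: "0 < th" "th < 1 / mu"
    and short: "\<And>m v. genie_opt p < crit_threshold (reward p) (hold_cost p) (1 / m) (1 / v) \<Longrightarrow> m \<le> th"
    and B1: "AE \<omega> in M. bs \<omega> 1"
  shows "\<exists>C. \<forall>N. (\<Sum>j=1..Suc N. real (max_threshold p j) *
      ((real (batch_len p j) + 1 / emptying ^ max_threshold p j) * over_starts N j)) \<le> C"
proof -
  obtain C2 d where C2: "0 < C2" "0 < d"
    and cost: "\<And>j. 1 \<le> j \<Longrightarrow> real (max_threshold p j) * (real (batch_len p j) + 1 / emptying ^ max_threshold p j) \<le> C2 * real j powr d"
    using cost_polynomial[OF emptying growth_le] by blast
  obtain t where t: "0 < t" "exp (t * th) * (mu / (mu + t)) < 1"
    using exp_tilt[OF mu_pos th] by blast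
  define s where "s = sqrt (exp (t * th) * (mu / (mu + t)))"
  have s: "0 < s" "s < 1" using t mu_pos by (auto simp: s_def)
  define E where "E = exp (t * th * real (explore_len p))"
  have q01: "0 \<le> q i" "q i \<le> 1" for i unfolding q_def by (auto simp: pr_def)
  obtain C1 where C1: "0 < C1" and decay: "\<And>j. 1 < j \<Longrightarrow> exp (- (1 - s) * (\<Sum>i=1..j - 1. q i)) \<le> C1 * real j powr (- (d + 2))"
    using exploration_superpolynomial[OF q1 q eps, of "1 - s" "d + 2"] s C2 by auto
  define C3 where "C3 = 1 + 2 * (E * C1)"
  have C3: "0 < C3" using C1 by (simp add: C3_def E_def add_pos_nonneg)
  have starts: "over_starts N j \<le> C3 * real j powr (- (d + 2))" if j: "1 \<le> j" for N j
  proof (cases "j = 1")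
    case True
    have "0 \<le> E * C1" using C1 by (simp add: E_def)
    then show ?thesis using over_starts_1[of N] True unfolding C3_def by simp
  next
    case False
    then have j: "1 < j" using j by simp
    have "over_starts N j \<le> 2 * (\<Sum>n<N. pr (\<lambda>x y b. deceptive_start p th x y b j n))"
      by (rule over_starts_le[OF j th(1) _ B1]) (rule short)
    also have "(\<Sum>n<N. pr (\<lambda>x y b. deceptive_start p th x y b j n)) \<le> E * (\<Prod>i=1..j - 1. 1 - (1 - s) * q i)"
      unfolding E_def s_def q_def by (rule sum_deceptive_starts[OF t(1) j t(2)])
    also have "(\<Prod>i=1..j - 1. 1 - (1 - s) * q i) \<le> exp (- (1 - s) * (\<Sum>i=1..j - 1. q i))"
      using s by (intro prod_one_minus_le_exp q01) auto
    also have "\<dots> \<le> C1 * real j powr (- (d + 2))" by (rule decay[OF j])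
    finally have "over_starts N j \<le> 2 * (E * C1) * real j powr (- (d + 2))"
      by (simp add: E_def mult.assoc)
    also have "\<dots> \<le> C3 * real j powr (- (d + 2))"
      unfolding C3_def by (intro mult_right_mono) auto
    finally show ?thesis .
  qed
  have sm: "summable (\<lambda>j. real j powr (- 2))" by (simp add: summable_real_powr_iff)
  define C where "C = C2 * C3 * (\<Sum>j. real j powr (- 2))"
  have "(\<Sum>j=1..Suc N. real (max_threshold p j) *
      ((real (batch_len p j) + 1 / emptying ^ max_threshold p j) * over_starts N j)) \<le> C" for N
  proof -
    have o0: "0 \<le> over_starts N j" for j unfolding over_starts_def by (intro sum_nonneg pr_nonneg)
    have "(\<Sum>j=1..Suc N. real (max_threshold p j) *
      ((real (batch_len p j) + 1 / emptying ^ max_threshold p j) * over_starts N j)) \<le> (\<Sum>j=1..Suc N. C2 * C3 * real j powr (- 2))"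
    proof (rule sum_mono)
      fix j assume "j \<in> {1..Suc N}"
      then have j: "1 \<le> j" by simp
      have "real (max_threshold p j) * ((real (batch_len p j) + 1 / emptying ^ max_threshold p j) * over_starts N j) \<le>
        (C2 * real j powr d) * (C3 * real j powr (- (d + 2)))"
        unfolding mult.assoc[symmetric, of "real (max_threshold p j)"]
        using C2 by (intro mult_mono cost[OF j] starts[OF j] o0) auto
      also have "\<dots> = C2 * C3 * (real j powr d * real j powr (- (d + 2)))" by (simp only: ac_simps)
      also have "real j powr d * real j powr (- (d + 2)) = real j powr (- 2)"
        unfolding powr_add[symmetric] by simp
      finally show "real (max_threshold p j) * ((real (batch_len p j) + 1 / emptying ^ max_threshold p j) * over_starts N j) \<le>
        C2 * C3 * real j powr (- 2)" .
    qed
    also have "\<dots> = C2 * C3 * (\<Sum>j=1..Suc N. real j powr (- 2))" by (rule sum_distrib_left[symmetric])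
    also have "\<dots> \<le> C"
      unfolding C_def using C2 C3 by (intro mult_left_mono sum_le_suminf[OF sm]) auto
    finally show ?thesis .
  qed
  then show ?thesis by blast
qed

theorem theorem2p2:
  fixes M :: "'a measure"
    and X Y B :: "nat \<Rightarrow> 'a \<Rightarrow> real"
    and p :: params
    and eps :: real
  assumes "prob_space M"
    and "0 < reward p" and "0 < hold_cost p" and "0 < arrival_rate p" and "0 < service_rate p"
    and "1 < explore_len p" and "explore_len p \<le> exploit_len p"
    and "\<And>j. 1 \<le> j \<Longrightarrow> 1 \<le> growth p j"
    and "\<exists>a>0. \<exists>c>0. \<exists>c'>0. \<forall>j\<ge>1.
           c * real j powr a \<le> growth p j \<and> growth p j \<le> c' * real j powr a"
    and "\<And>j x. 1 \<le> j \<Longrightarrow> fallback p j x \<le> max_threshold p j"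
    and "\<And>j. 1 \<le> j \<Longrightarrow> fallback p j \<in> (\<Pi>\<^sub>M k\<in>UNIV. borel) \<rightarrow>\<^sub>M count_space UNIV"
    and "0 < eps"
    and "\<And>n. distributed M lborel (X n) (exponential_density (arrival_rate p))"
    and "\<And>n. distributed M lborel (Y n) (exponential_density (service_rate p))"
    and "\<And>j. 1 \<le> j \<Longrightarrow> AE \<omega> in M. B j \<omega> = 0 \<or> B j \<omega> = 1"
    and "measure M {\<omega> \<in> space M. B 1 \<omega> = 1} = 1"
    and "\<And>j. 1 < j \<Longrightarrow>
           measure M {\<omega> \<in> space M. B j \<omega> = 1} = min 1 (ln (real j) powr eps / real j)"
    and "prob_space.indep_vars M (\<lambda>_. borel) (case_sum X (case_sum Y B))
           (UNIV <+> (UNIV <+> {1..}))"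
    and "genie_init_queue p = init_queue p"
    and "0 \<in> opt_thresholds (reward p) (hold_cost p) (arrival_rate p) (service_rate p)"
  shows "(\<forall>N\<ge>1. integrable M (regret_var p X Y B N)) \<and>
         regret M p X Y B \<in> O(\<lambda>N. ln (real N) powr (1 + eps))"
proof -
  interpret prob_space M by fact
  note opt = overestimate_imp_short_services[OF assms(2-5,20)]
  have K: "genie_opt p = crit_threshold (reward p) (hold_cost p) (service_rate p) (arrival_rate p)"
    by (simp add: genie_opt_def)
  interpret dispatch M X Y B p
  proof
    show "genie_opt p \<le> 1" unfolding K by (rule opt(1))
    show "genie_static p \<longleftrightarrow> genie_opt p = 0" unfolding genie_static_def K by (rule opt(2))
  qed (use assms in auto)
  obtain th where th: "0 < th" "th < 1 / mu"
    and short: "\<And>m v. genie_opt p < crit_threshold (reward p) (hold_cost p) (1 / m) (1 / v) \<Longrightarrow> m \<le> th"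
    using opt(3) unfolding K by blast
  obtain a c' where gr: "0 < a" "0 < c'" "\<And>j. 1 \<le> j \<Longrightarrow> growth p j \<le> c' * real j powr a"
    using assms(9) by blast
  define q where "q i = pr (\<lambda>x y b. b i)" for i
  have q: "q i = prob {\<omega> \<in> space M. B i \<omega> = 1}" if "1 \<le> i" for i
    using that by (simp add: q_def pr_def bs_def)
  have q1: "q 1 = 1" using q[of 1] assms(16) by simp
  have q2: "q i = min 1 (ln (real i) powr eps / real i)" if "1 < i" for i
    using q[of i] assms(17)[OF that] that by simp
  \<comment> \<open>The sure trial of batch \<open>1\<close> guarantees a completed service before
    every later batch, so that their thresholds are genuine estimates.\<close>
  have B1: "AE \<omega> in M. bs \<omega> 1"
  proof -
    have "AE \<omega> in M. \<omega> \<in> {\<omega> \<in> space M. B 1 \<omega> = 1}" using assms(16) by (rule AE_prob_1)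
    then show ?thesis by eventually_elim (simp add: bs_def)
  qed
  have "\<exists>C. \<forall>N. (\<Sum>j=1..Suc N. real (max_threshold p j) *
      ((real (batch_len p j) + 1 / emptying ^ max_threshold p j) * over_starts N j)) \<le> C"
    by (rule overestimation_cost_bounded[where q=q, OF gr(1,2) _ assms(12) _ q1 _ th _ B1]) (fact gr(3) q_def q2 short)+
  then obtain C where C: "\<And>N. (\<Sum>j=1..Suc N. real (max_threshold p j) *
      ((real (batch_len p j) + 1 / emptying ^ max_threshold p j) * over_starts N j)) \<le> C"
    by blast
  define C1 where "C1 = (reward p + (reward p + hold_cost p * real kstar / lam) / emptying ^ kstar) * real (explore_len p)"
  define C2 where "C2 = (reward p + hold_cost p / lam) * \<bar>C\<bar>"
  have C12: "0 \<le> C1" "0 \<le> C2"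
    using reward_pos hold_cost_pos lam_pos emptying by (auto simp: C1_def C2_def)
  have regret_le: "\<bar>regret M p X Y B N\<bar> \<le> C1 * (3 + ln (real N) powr (1 + eps)) + C2" if "1 \<le> N" for N
  proof -
    have "\<bar>regret M p X Y B N\<bar> \<le> (reward p + (reward p + hold_cost p * real kstar / lam) / emptying ^ kstar) *
      (real (explore_len p) * (1 + (\<Sum>i=1..Suc N. q i))) +
      (reward p + hold_cost p / lam) * (\<Sum>j=1..Suc N. real (max_threshold p j) *
      ((real (batch_len p j) + 1 / emptying ^ max_threshold p j) * over_starts N j))"
      unfolding regret_def regret_var_eq q_def by (rule expected_gap_le)
    also have "\<dots> \<le> (reward p + (reward p + hold_cost p * real kstar / lam) / emptying ^ kstar) *
      (real (explore_len p) * (3 + ln (real N) powr (1 + eps))) + (reward p + hold_cost p / lam) * \<bar>C\<bar>"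
    proof (rule add_mono[OF mult_left_mono[OF mult_left_mono] mult_left_mono])
      show "1 + (\<Sum>i=1..Suc N. q i) \<le> 3 + ln (real N) powr (1 + eps)"
        using sum_exploration_le[of q, OF q1 q2 assms(12) that] by simp
      show "(\<Sum>j=1..Suc N. real (max_threshold p j) *
        ((real (batch_len p j) + 1 / emptying ^ max_threshold p j) * over_starts N j)) \<le> \<bar>C\<bar>"
        using C[of N] by linarith
    qed (use reward_pos hold_cost_pos lam_pos emptying in auto)
    finally show ?thesis unfolding C1_def C2_def by (simp add: mult.assoc)
  qed
  have "regret M p X Y B \<in> O(\<lambda>N. ln (real N) powr (1 + eps))"
  proof (rule bigoI)
    \<comment> \<open>From here on \<open>ln N\<close> is at least \<open>1\<close>, so the additive
      constants can be absorbed into the leading term.\<close>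
    have "\<forall>\<^sub>F N in sequentially. 1 \<le> ln (real N)" by real_asymp
    moreover have "\<forall>\<^sub>F N in sequentially. 1 \<le> (N::nat)" by (rule eventually_ge_at_top)
    ultimately show "\<forall>\<^sub>F N in sequentially. norm (regret M p X Y B N) \<le> (4 * C1 + C2) * norm (ln (real N) powr (1 + eps))"
    proof eventually_elim
      case (elim N)
      let ?L = "ln (real N) powr (1 + eps)"
      have L: "1 \<le> ?L" using elim(1) assms(12) by (intro ge_one_powr_ge_zero) auto
      have "\<bar>regret M p X Y B N\<bar> \<le> C1 * (3 + ?L) + C2" by (rule regret_le[OF elim(2)])
      also have "\<dots> \<le> C1 * (4 * ?L) + C2 * ?L"
        using L C12 mult_left_mono[OF L C12(2)] by (intro add_mono mult_left_mono) auto
      finally show ?case by (simp add: algebra_simps)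
    qed
  qed
  moreover have "integrable M (regret_var p X Y B N)" for N
    unfolding regret_var_eq by (rule expected_gap(1))
  ultimately show ?thesis by blast
qed

end
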